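(* Let $T>0$, $\gamma_1\gamma_2>0$, $u_0\in H^1$, $v_0\in H^1_{\mathbb R}$, $\Phi_1\in\mathcal L_2(H_{\mathbb R};H^1)$, $\Phi_2\in\mathcal L_2(H_{\mathbb R};H^1_{\mathbb R})$, and let $(u,v)$ be the solution of the stochastic Schrödinger--KdV equation described in the context. Then for all $t\in[0,T]$, $$\mathbb E\Big[\int_{\mathcal O}|u(t,x)|^2\,dx\Big]=\mathbb E\Big[\int_{\mathcal O}|u_0(x)|^2\,dx\Big]+\|\Phi_1\|_{\mathcal L_2^0}^2\,t.$$
   Context: $\mathcal O=(0,L)$ with periodic boundary conditions; $\mathbf i=\sqrt{-1}$; $\gamma_1,\gamma_2,\beta\in\mathbb R$. $H=L^2(\mathcal O;\mathbb C)$, $H_{\mathbb R}=L^2(\mathcal O;\mathbb R)$, $H^m=H^m(\mathcal O;\mathbb C)$, $H^m_{\mathbb R}=H^m(\mathcal O;\mathbb R)$, and $\mathcal L_2(U_1;U_2)$ denotes the Hilbert--Schmidt operators from $U_1$ to $U_2$. $W_1,W_2$ are independent cylindrical Wiener processes on $H_{\mathbb R}$: $W_k(t)=\sum_{i=1}^\infty\beta_k^{(i)}(t)e_k^{(i)}$ with independent real standard Brownian motions $\beta_k^{(i)}$ and orthonormal bases $\{e_k^{(i)}\}_{i}$ of $H_{\mathbb R}$, $k=1,2$. Write $\|\Phi_k\|_{\mathcal L_2^0}^2:=\sum_{i=1}^\infty\|\Phi_ke_k^{(i)}\|_{L^2(\mathcal O)}^2$. The stochastic Schrödinger--KdV equation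 is $$du=\big(\mathbf i\partial_x^2u-\mathbf i(\gamma_1v+\beta|u|^2)u\big)dt+\Phi_1\,dW_1(t),\qquad dv=\big(-\partial_x^3v+\gamma_2\partial_x|u|^2-v\partial_xv\big)dt+\Phi_2\,dW_2(t),$$ with $(u(0),v(0))=(u_0,v_0)$, $u$ complex-valued, $v$ real-valued, and periodic boundary conditions ($u,u_x,v,v_x,v_{xx}$ agree at $x=0$ and $x=L$). Under the stated hypotheses it has a unique strong solution $(u,v)\in L^2(\Omega;C([0,T];H^1\times H^1))$; this is the solution meant. *)

theory Defs
  imports "HOL-Probability.Probability"
begin

section \<open>Periodic function spaces on (0, L)\<close>

text \<open>Elements of L^2 and H^1 are represented by functions on the real line, of which only the
  almost everywhere class on (0, L) matters.  The codomain is \<^typ>\<open>real\<close> for the real spaces and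
  \<^typ>\<open>complex\<close> for the complex ones.\<close>

abbreviation interval_measure0 :: "real \<Rightarrow> real measure"
  where "interval_measure0 L \<equiv> lebesgue_on {0<..<L}"

definition L2_space :: "real \<Rightarrow> (real \<Rightarrow> 'a::euclidean_space) set" where
  "L2_space L = {f. f \<in> borel_measurable (interval_measure0 L) \<and>
                    integrable (interval_measure0 L) (\<lambda>x. (norm (f x))\<^sup>2)}"

definition l2_norm :: "real \<Rightarrow> (real \<Rightarrow> 'a::euclidean_space) \<Rightarrow> real" where
  "l2_norm L f = sqrt (LINT x|interval_measure0 L. (norm (f x))\<^sup>2)"

definition test_function :: "real \<Rightarrow> (real \<Rightarrow> real) \<Rightarrow> bool" where
  "test_function L \<phi> \<longleftrightarrow>
     (\<forall>x. \<phi> (x + L) = \<phi> x) \<and> (\<forall>n. (deriv ^^ n) \<phi> differentiable_on UNIV)"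

text \<open>The action of a function, as a periodic distribution, on a test function.  Real test
  functions suffice for complex distributions, by linearity.\<close>

definition pairing :: "real \<Rightarrow> (real \<Rightarrow> real) \<Rightarrow> (real \<Rightarrow> 'a::euclidean_space) \<Rightarrow> 'a" where
  "pairing L \<phi> f = (LINT x|interval_measure0 L. \<phi> x *\<^sub>R f x)"

text \<open>Test functions are periodic and need not vanish at the end points, so having a weak
  derivative in this sense includes the periodic boundary condition.\<close>

definition has_weak_deriv ::
  "real \<Rightarrow> (real \<Rightarrow> 'a::euclidean_space) \<Rightarrow> (real \<Rightarrow> 'a) \<Rightarrow> bool" where
  "has_weak_deriv L f g \<longleftrightarrow> f \<in> L2_space L \<and> g \<in> L2_space L \<and>
     (\<forall>\<phi>. test_function L \<phi> \<longrightarrow> pairing L (deriv \<phi>) f = - pairing L \<phi> g)"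

definition H1_space :: "real \<Rightarrow> (real \<Rightarrow> 'a::euclidean_space) set" where
  "H1_space L = {f. \<exists>g. has_weak_deriv L f g}"

definition weak_deriv :: "real \<Rightarrow> (real \<Rightarrow> 'a::euclidean_space) \<Rightarrow> real \<Rightarrow> 'a" where
  "weak_deriv L f = (SOME g. has_weak_deriv L f g)"

definition h1_norm :: "real \<Rightarrow> (real \<Rightarrow> 'a::euclidean_space) \<Rightarrow> real" where
  "h1_norm L f = sqrt ((l2_norm L f)\<^sup>2 + (l2_norm L (weak_deriv L f))\<^sup>2)"

text \<open>The Borel sigma algebra of H^1, generated by the norm-open sets.\<close>

definition H1_borel :: "real \<Rightarrow> (real \<Rightarrow> 'a::euclidean_space) measure" where
  "H1_borel L = sigma (H1_space L)
     {U. U \<subseteq> H1_space L \<and>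
         (\<forall>f\<in>U. \<exists>r>0. \<forall>g\<in>H1_space L. h1_norm L (\<lambda>x. g x - f x) < r \<longrightarrow> g \<in> U)}"

section \<open>Hilbert--Schmidt operators\<close>

definition l2_inner :: "real \<Rightarrow> (real \<Rightarrow> real) \<Rightarrow> (real \<Rightarrow> real) \<Rightarrow> real" where
  "l2_inner L f g = (LINT x|interval_measure0 L. f x * g x)"

definition L2_orthonormal_basis :: "real \<Rightarrow> (nat \<Rightarrow> real \<Rightarrow> real) \<Rightarrow> bool" where
  "L2_orthonormal_basis L e \<longleftrightarrow>
     (\<forall>i. e i \<in> L2_space L) \<and>
     (\<forall>i j. l2_inner L (e i) (e j) = (if i = j then 1 else 0)) \<and>
     (\<forall>f\<in>L2_space L. (\<lambda>n. l2_norm L (\<lambda>x. f x - (\<Sum>i<n. l2_inner L f (e i) * e i x)))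
        \<longlonglongrightarrow> 0)"

text \<open>Boundedness together with almost everywhere linearity makes the operator respect almost
  everywhere equality.  The last conjunct does not depend on the choice of the basis.\<close>

definition hilbert_schmidt ::
  "real \<Rightarrow> ((real \<Rightarrow> real) \<Rightarrow> real \<Rightarrow> 'a::euclidean_space) \<Rightarrow> bool" where
  "hilbert_schmidt L \<Phi> \<longleftrightarrow>
     (\<forall>f\<in>L2_space L. \<Phi> f \<in> H1_space L) \<and>
     (\<forall>f\<in>L2_space L. \<forall>g\<in>L2_space L.
        AE x in interval_measure0 L. \<Phi> (\<lambda>y. f y + g y) x = \<Phi> f x + \<Phi> g x) \<and>
     (\<forall>f\<in>L2_space L. \<forall>c.
        AE x in interval_measure0 L. \<Phi> (\<lambda>y. c * f y) x = c *\<^sub>R \<Phi> f x) \<and>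
     (\<exists>C. \<forall>f\<in>L2_space L. h1_norm L (\<Phi> f) \<le> C * l2_norm L f) \<and>
     (\<forall>e. L2_orthonormal_basis L e \<longrightarrow> summable (\<lambda>i. (h1_norm L (\<Phi> (e i)))\<^sup>2))"

definition L20_norm ::
  "real \<Rightarrow> (nat \<Rightarrow> real \<Rightarrow> real) \<Rightarrow> ((real \<Rightarrow> real) \<Rightarrow> real \<Rightarrow> 'a::euclidean_space) \<Rightarrow> real" where
  "L20_norm L e \<Phi> = sqrt (\<Sum>i. (l2_norm L (\<Phi> (e i)))\<^sup>2)"

section \<open>Wiener processes\<close>

text \<open>A mutually independent family of real standard Brownian motions relative to the filtration
  \<open>F\<close>.  The increments after time \<open>s\<close> are jointly independent of \<open>F s\<close>.  Only nonnegative times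
  are relevant.\<close>

definition brownian_family ::
  "'w measure \<Rightarrow> (real \<Rightarrow> 'w measure) \<Rightarrow> ('i \<Rightarrow> real \<Rightarrow> 'w \<Rightarrow> real) \<Rightarrow> bool" where
  "brownian_family M F B \<longleftrightarrow>
     (\<forall>j. \<forall>t\<ge>0. B j t \<in> borel_measurable (F t)) \<and>
     (\<forall>j. AE \<omega> in M. B j 0 \<omega> = 0) \<and>
     (\<forall>j. AE \<omega> in M. continuous_on {0..} (\<lambda>t. B j t \<omega>)) \<and>
     (\<forall>j s t. 0 \<le> s \<longrightarrow> s < t \<longrightarrow>
        distributed M lborel (\<lambda>\<omega>. B j t \<omega> - B j s \<omega>) (normal_density 0 (sqrt (t - s)))) \<and>
     (\<forall>s t. 0 \<le> s \<longrightarrow> s < t \<longrightarrow>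
        prob_space.indep_set M (sets (F s))
          (sets (vimage_algebra (space M) (\<lambda>\<omega> j. B j t \<omega> - B j s \<omega>) (Pi\<^sub>M UNIV (\<lambda>_. borel))))) \<and>
     prob_space.indep_vars M (\<lambda>_. Pi\<^sub>M {0..} (\<lambda>_. borel)) (\<lambda>j \<omega>. \<lambda>t\<in>{0..}. B j t \<omega>) UNIV"

text \<open>\<open>Z\<close> is the process \<open>\<Phi> W(t)\<close>, i.e. the integral of the constant \<open>\<Phi>\<close> against the cylindrical
  Wiener process \<open>W(t) = \<Sum>i. B i t e i\<close>.  That series does not converge in L^2(0, L), but its image
  under \<open>\<Phi>\<close> converges in mean square in H^1.\<close>

definition wiener_integral ::
  "'w measure \<Rightarrow> real \<Rightarrow> (nat \<Rightarrow> real \<Rightarrow> real) \<Rightarrow> (nat \<Rightarrow> real \<Rightarrow> 'w \<Rightarrow> real) \<Rightarrow>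
   ((real \<Rightarrow> real) \<Rightarrow> real \<Rightarrow> 'a::euclidean_space) \<Rightarrow> (real \<Rightarrow> 'w \<Rightarrow> real \<Rightarrow> 'a) \<Rightarrow> bool" where
  "wiener_integral M L e B \<Phi> Z \<longleftrightarrow>
     (\<forall>t\<ge>0. Z t \<in> M \<rightarrow>\<^sub>M H1_borel L \<and>
       (\<lambda>n. \<integral>\<^sup>+\<omega>. ennreal ((h1_norm L
          (\<lambda>x. Z t \<omega> x - (\<Sum>i<n. B i t \<omega> *\<^sub>R \<Phi> (e i) x)))\<^sup>2) \<partial>M) \<longlonglongrightarrow> 0)"

section \<open>The stochastic Schroedinger--KdV equation\<close>

text \<open>Adapted processes in L^2(Omega; C([0,T]; H^1)).\<close>

definition L2_C_H1 ::
  "'w measure \<Rightarrow> (real \<Rightarrow> 'w measure) \<Rightarrow> real \<Rightarrow> real \<Rightarrow>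
   (real \<Rightarrow> 'w \<Rightarrow> real \<Rightarrow> 'a::euclidean_space) \<Rightarrow> bool" where
  "L2_C_H1 M F L T u \<longleftrightarrow>
     (\<forall>t\<in>{0..T}. u t \<in> F t \<rightarrow>\<^sub>M H1_borel L) \<and>
     (AE \<omega> in M. \<forall>s\<in>{0..T}.
        ((\<lambda>t. h1_norm L (\<lambda>x. u t \<omega> x - u s \<omega> x)) \<longlongrightarrow> 0) (at s within {0..T})) \<and>
     (\<integral>\<^sup>+\<omega>. (SUP t\<in>{0..T}. ennreal ((h1_norm L (u t \<omega>))\<^sup>2)) \<partial>M) < \<infinity>"

text \<open>The equations hold in the integrated form, as identities of periodic distributions in space:
  since \<open>u\<close> and \<open>v\<close> take values in H^1 only, the linear terms \<open>\<i> \<partial>\<^sub>x\<^sup>2 u\<close> and \<open>- \<partial>\<^sub>x\<^sup>3 v\<close> have their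
  derivatives moved to the test function.  In the nonlinear terms the weak derivatives exist
  in L^2.  The periodic boundary conditions are contained in the class of test functions.\<close>

definition SKdV_solution ::
  "'w measure \<Rightarrow> (real \<Rightarrow> 'w measure) \<Rightarrow> real \<Rightarrow> real \<Rightarrow> real \<Rightarrow> real \<Rightarrow> real \<Rightarrow>
   (nat \<Rightarrow> real \<Rightarrow> real) \<Rightarrow> (nat \<Rightarrow> real \<Rightarrow> 'w \<Rightarrow> real) \<Rightarrow>
   (nat \<Rightarrow> real \<Rightarrow> real) \<Rightarrow> (nat \<Rightarrow> real \<Rightarrow> 'w \<Rightarrow> real) \<Rightarrow>
   ((real \<Rightarrow> real) \<Rightarrow> real \<Rightarrow> complex) \<Rightarrow> ((real \<Rightarrow> real) \<Rightarrow> real \<Rightarrow> real) \<Rightarrow>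
   (real \<Rightarrow> complex) \<Rightarrow> (real \<Rightarrow> real) \<Rightarrow>
   (real \<Rightarrow> 'w \<Rightarrow> real \<Rightarrow> complex) \<Rightarrow> (real \<Rightarrow> 'w \<Rightarrow> real \<Rightarrow> real) \<Rightarrow> bool" where
  "SKdV_solution M F L T \<gamma>\<^sub>1 \<gamma>\<^sub>2 \<beta> e\<^sub>1 B\<^sub>1 e\<^sub>2 B\<^sub>2 \<Phi>\<^sub>1 \<Phi>\<^sub>2 u\<^sub>0 v\<^sub>0 u v \<longleftrightarrow>
     L2_C_H1 M F L T u \<and> L2_C_H1 M F L T v \<and>
     (AE \<omega> in M. AE x in interval_measure0 L. u 0 \<omega> x = u\<^sub>0 x \<and> v 0 \<omega> x = v\<^sub>0 x) \<and>
     (\<exists>Z\<^sub>1 Z\<^sub>2. wiener_integral M L e\<^sub>1 B\<^sub>1 \<Phi>\<^sub>1 Z\<^sub>1 \<and> wiener_integral M L e\<^sub>2 B\<^sub>2 \<Phi>\<^sub>2 Z\<^sub>2 \<and>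
       (\<forall>t\<in>{0..T}. AE \<omega> in M. \<forall>\<phi>. test_function L \<phi> \<longrightarrow>
          pairing L \<phi> (u t \<omega>) = pairing L \<phi> u\<^sub>0
            + (LINT s|lebesgue_on {0..t}.
                 \<i> * pairing L ((deriv ^^ 2) \<phi>) (u s \<omega>)
                 - \<i> * pairing L \<phi>
                     (\<lambda>x. of_real (\<gamma>\<^sub>1 * v s \<omega> x + \<beta> * (cmod (u s \<omega> x))\<^sup>2) * u s \<omega> x))
            + pairing L \<phi> (Z\<^sub>1 t \<omega>) \<and>
          pairing L \<phi> (v t \<omega>) = pairing L \<phi> v\<^sub>0
            + (LINT s|lebesgue_on {0..t}.
                 pairing L ((deriv ^^ 3) \<phi>) (v s \<omega>)
                 + \<gamma>\<^sub>2 * pairing L \<phi> (weak_deriv L (\<lambda>x. (cmod (u s \<omega> x))\<^sup>2))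
                 - pairing L \<phi> (\<lambda>x. v s \<omega> x * weak_deriv L (v s \<omega>) x))
            + pairing L \<phi> (Z\<^sub>2 t \<omega>)))"

end

theory Submission
  imports Defs
begin

text \<open>
  Ito's formula for the squared norm reads
  \<open>d |u|^2 = 2 Re <u, i u_xx - i q u> dt + 2 Re <u, \<Phi> dW> + |\<Phi>|^2 dt\<close>
  with the real potential \<open>q = \<gamma> v + \<beta> |u|^2\<close>.  The drift vanishes because the second derivative is
  symmetric and \<open>q\<close> is real, the stochastic integral has mean zero, and \<open>|\<Phi>|^2 t\<close> remains.

  Since the noise is additive, this can be carried out with classical calculus along single paths.
  A Fourier coefficient of the solution satisfies
  \<open>u_k(s) = u_k(0) + \<integral>_0^s b_k dr + Z_k(s)\<close>.  For a fixed final time \<open>t\<close> the path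
  \<open>y(s) = u_k(0) + \<integral>_0^s b_k dr + Z_k(t) = u_k(s) + (Z_k(t) - Z_k(s))\<close>, in which the noise is frozen
  at its final value, is differentiable in \<open>s\<close>, and
  \<open>d |y|^2 / ds = 2 Re (cnj u_k b_k) + 2 Re (cnj (Z_k(t) - Z_k(s)) b_k)\<close>.
  The increment \<open>Z_k(t) - Z_k(s)\<close> is independent of the past up to time \<open>s\<close> and centred, so the last
  term has mean zero.  The path ends at \<open>u_k(t)\<close> and starts at \<open>u_k(0) + Z_k(t)\<close>, whose mean square is
  \<open>|u_k(0)|^2 + t \<sigma>_k\<close>.

  This argument needs \<open>b_k\<close> and \<open>cnj u_k b_k\<close> to be integrable.  They are of degree three and four in
  the solution, which has second moments only.  Therefore \<open>|y|^2\<close> is multiplied by the weight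
  \<open>\<theta>(s) = exp (- \<epsilon> \<integral>_0^s h dr)\<close>, where \<open>h\<close> is the fourth power of one plus the \<open>H^1\<close> norms.  As
  \<open>\<epsilon> h \<theta>\<close> is the derivative of \<open>- \<theta>\<close>, the integral of \<open>h \<theta>\<close> over time is at most \<open>1 / \<epsilon>\<close> on every path,
  whatever the size of \<open>h\<close>.  The weight adds the term \<open>\<epsilon> \<integral> h \<theta> |y|^2 ds\<close>; after averaging out the
  increment it only involves second moments and it is at most \<open>E [(1 - \<theta>(t)) (S + t \<sigma>)]\<close>, where \<open>S\<close> is
  the supremum of the squared norm over time.  The outcome for one mode is \<open>energy_identity\<close>.

  In the sum over \<open>|k| \<le> N\<close> the second derivative contributes nothing, and the contribution of the
  potential tends to the real part of \<open>- i <u, q u>\<close>, which is zero (\<open>nonlin_cancel\<close>).  Letting \<open>N\<close> tend to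
  infinity gives \<open>weighted_energy\<close>; letting \<open>\<epsilon>\<close> tend to zero makes the weight disappear
  (\<open>mean_energy\<close>).

  The completeness of the trigonometric system (\<open>trig_approx_L2\<close>) is used throughout: it yields
  Parseval's identity, the uniqueness of weak derivatives, the embedding of \<open>H^1\<close> into the bounded
  functions, and the identification of \<open>\<Sum>k. \<sigma>_k\<close> with the squared Hilbert--Schmidt norm.
\<close>

section \<open>Square-integrable functions on an interval\<close>

text \<open>The integral of \<open>(a f + b g)^2\<close> is a nonnegative quadratic form in \<open>a\<close> and \<open>b\<close>, so its
  discriminant is not positive.\<close>

lemma Cauchy_Schwarz_integral:
  fixes f g :: "'a \<Rightarrow> real"
  assumes [measurable]: "f \<in> borel_measurable M" "g \<in> borel_measurable M"
    and f: "integrable M (\<lambda>x. (f x)\<^sup>2)" and g: "integrable M (\<lambda>x. (g x)\<^sup>2)"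
  shows integrable_mult_squares: "integrable M (\<lambda>x. f x * g x)"
    and "(\<integral>x. f x * g x \<partial>M)\<^sup>2 \<le> (\<integral>x. (f x)\<^sup>2 \<partial>M) * (\<integral>x. (g x)\<^sup>2 \<partial>M)"
proof -
  show int: "integrable M (\<lambda>x. f x * g x)"
  proof (rule Bochner_Integration.integrable_bound)
    show "integrable M (\<lambda>x. (f x)\<^sup>2 + (g x)\<^sup>2)" using f g by simp
    have "\<bar>f x * g x\<bar> \<le> (f x)\<^sup>2 + (g x)\<^sup>2" for x
    proof -
      have "0 \<le> \<bar>f x\<bar> * \<bar>g x\<bar>" by simp
      with sum_squares_bound[of "\<bar>f x\<bar>" "\<bar>g x\<bar>"] show ?thesis unfolding abs_mult power2_abs by linarith
    qed
    then show "AE x in M. norm (f x * g x) \<le> norm ((f x)\<^sup>2 + (g x)\<^sup>2)" by simp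
  qed measurable
  define I A B where "I = (\<integral>x. f x * g x \<partial>M)" and "A = (\<integral>x. (f x)\<^sup>2 \<partial>M)" and "B = (\<integral>x. (g x)\<^sup>2 \<partial>M)"
  have q: "0 \<le> a\<^sup>2 * A + 2 * a * b * I + b\<^sup>2 * B" for a b :: real
  proof -
    have "0 \<le> (\<integral>x. (a * f x + b * g x)\<^sup>2 \<partial>M)" by simp
    also have "(\<lambda>x. (a * f x + b * g x)\<^sup>2) = (\<lambda>x. a\<^sup>2 * (f x)\<^sup>2 + 2 * a * b * (f x * g x) + b\<^sup>2 * (g x)\<^sup>2)"
      by (auto simp: power2_eq_square algebra_simps)
    finally show ?thesis using f g int by (simp add: I_def A_def B_def)
  qed
  have A: "0 \<le> A" and B: "0 \<le> B" by (auto simp: A_def B_def)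
  have "I\<^sup>2 \<le> A * B"
  proof (cases "B = 0")
    case False
    with B have B: "B > 0" by simp
    have "0 \<le> B * (A * B - I\<^sup>2)"
      using q[of B "- I"] by (simp add: power2_eq_square algebra_simps)
    with B show ?thesis by (simp add: zero_le_mult_iff)
  next
    case True
    have "I = 0"
    proof (rule ccontr)
      assume "I \<noteq> 0"
      then have "2 * 1 * (- (A + 1) / I) * I = - 2 * (A + 1)" by simp
      then show False using q[of 1 "- (A + 1) / I"] True A by simp
    qed
    then show ?thesis using A B by simp
  qed
  then show "(\<integral>x. f x * g x \<partial>M)\<^sup>2 \<le> (\<integral>x. (f x)\<^sup>2 \<partial>M) * (\<integral>x. (g x)\<^sup>2 \<partial>M)"
    by (simp add: I_def A_def B_def)
qed

lemma finite_interval_measure: "finite_measure (interval_measure0 L)"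
  by (rule finite_measure_lebesgue_on) simp

lemma L2_measurable: "f \<in> L2_space L \<Longrightarrow> f \<in> borel_measurable (interval_measure0 L)"
  by (simp add: L2_space_def)

lemma L2_sq_integrable: "f \<in> L2_space L \<Longrightarrow> integrable (interval_measure0 L) (\<lambda>x. (norm (f x))\<^sup>2)"
  by (simp add: L2_space_def)

lemma l2_norm_nonneg [simp]: "0 \<le> l2_norm L f"
  by (simp add: l2_norm_def)

lemma l2_norm_sq: "(l2_norm L f)\<^sup>2 = (LINT x|interval_measure0 L. (norm (f x))\<^sup>2)"
  by (simp add: l2_norm_def)

lemma L2_bound:
  fixes f :: "real \<Rightarrow> 'a::euclidean_space" and g :: "real \<Rightarrow> 'b::euclidean_space"
  assumes "g \<in> L2_space L" "f \<in> borel_measurable (interval_measure0 L)"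
    and "AE x in interval_measure0 L. norm (f x) \<le> C * norm (g x)"
  shows L2_boundI: "f \<in> L2_space L"
    and l2_norm_bound: "0 \<le> C \<Longrightarrow> l2_norm L f \<le> C * l2_norm L g"
proof -
  note [measurable] = assms(2)
  have i: "integrable (interval_measure0 L) (\<lambda>x. C\<^sup>2 * (norm (g x))\<^sup>2)"
    using L2_sq_integrable[OF assms(1)] by simp
  have le: "AE x in interval_measure0 L. (norm (f x))\<^sup>2 \<le> C\<^sup>2 * (norm (g x))\<^sup>2"
    using assms(3)
  proof eventually_elim
    case (elim x)
    then have "(norm (f x))\<^sup>2 \<le> (C * norm (g x))\<^sup>2" by (intro power_mono) auto
    then show ?case by (simp add: power_mult_distrib)
  qed
  have fi: "integrable (interval_measure0 L) (\<lambda>x. (norm (f x))\<^sup>2)"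
    by (rule Bochner_Integration.integrable_bound[OF i]) (use le in auto)
  then show "f \<in> L2_space L" using assms(2) by (simp add: L2_space_def)
  assume C: "0 \<le> C"
  have "(l2_norm L f)\<^sup>2 \<le> (LINT x|interval_measure0 L. C\<^sup>2 * (norm (g x))\<^sup>2)"
    unfolding l2_norm_sq by (rule integral_mono_AE[OF fi i le])
  also have "\<dots> = (C * l2_norm L g)\<^sup>2" by (simp add: power_mult_distrib l2_norm_sq)
  finally show "l2_norm L f \<le> C * l2_norm L g" by (rule power2_le_imp_le) (simp add: C)
qed

lemma l2_norm_cong_AE:
  assumes "f \<in> borel_measurable (interval_measure0 L)" "g \<in> borel_measurable (interval_measure0 L)"
    and "AE x in interval_measure0 L. f x = g x"
  shows "l2_norm L f = l2_norm L g"
  unfolding l2_norm_def using assms by (intro arg_cong[where f=sqrt] integral_cong_AE) auto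

lemma L2_add:
  fixes f g :: "real \<Rightarrow> 'a::euclidean_space"
  assumes "f \<in> L2_space L" "g \<in> L2_space L"
  shows "(\<lambda>x. f x + g x) \<in> L2_space L"
proof -
  note [measurable] = assms[THEN L2_measurable]
  have "integrable (interval_measure0 L) (\<lambda>x. (norm (f x + g x))\<^sup>2)"
  proof (rule Bochner_Integration.integrable_bound)
    show "integrable (interval_measure0 L) (\<lambda>x. 2 * (norm (f x))\<^sup>2 + 2 * (norm (g x))\<^sup>2)"
      using assms[THEN L2_sq_integrable] by simp
    have "(norm (f x + g x))\<^sup>2 \<le> 2 * (norm (f x))\<^sup>2 + 2 * (norm (g x))\<^sup>2" for x
    proof -
      have "(norm (f x + g x))\<^sup>2 \<le> (norm (f x) + norm (g x))\<^sup>2"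
        by (intro power_mono norm_triangle_ineq) auto
      also have "\<dots> \<le> 2 * (norm (f x))\<^sup>2 + 2 * (norm (g x))\<^sup>2"
        using zero_le_power2[of "norm (f x) - norm (g x)"] by (simp add: power2_eq_square algebra_simps)
      finally show ?thesis .
    qed
    then show "AE x in interval_measure0 L. norm ((norm (f x + g x))\<^sup>2) \<le> norm (2 * (norm (f x))\<^sup>2 + 2 * (norm (g x))\<^sup>2)"
      by auto
  qed measurable
  then show ?thesis unfolding L2_space_def by simp
qed

lemma L2_bounded_linear:
  fixes f :: "real \<Rightarrow> 'a::euclidean_space" and T :: "'a \<Rightarrow> 'b::euclidean_space"
  assumes "bounded_linear T" "f \<in> L2_space L"
  shows "(\<lambda>x. T (f x)) \<in> L2_space L"
proof -
  interpret bounded_linear T by fact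
  obtain K where K: "\<And>x. norm (T x) \<le> norm x * K" using bounded by blast
  have [measurable]: "T \<in> borel_measurable borel"
    by (intro borel_measurable_continuous_onI continuous_on continuous_on_id)
  show ?thesis
    by (rule L2_boundI[OF assms(2), of _ K]) (use K L2_measurable[OF assms(2)] in \<open>auto simp: mult.commute\<close>)
qed

lemmas L2_scaleR = L2_bounded_linear[OF bounded_linear_scaleR_right]
lemmas L2_uminus = L2_bounded_linear[OF bounded_linear_minus[OF bounded_linear_ident]]
lemmas L2_mult_left = L2_bounded_linear[OF bounded_linear_mult_right]

lemma L2_diff:
  fixes f g :: "real \<Rightarrow> 'a::euclidean_space"
  assumes "f \<in> L2_space L" "g \<in> L2_space L"
  shows "(\<lambda>x. f x - g x) \<in> L2_space L"
  using L2_add[OF assms(1) L2_uminus[OF assms(2)]] by simp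

lemma L2_zero: "(\<lambda>x. 0::'a::euclidean_space) \<in> L2_space L"
  by (simp add: L2_space_def)

lemma L2_sum:
  fixes f :: "'i \<Rightarrow> real \<Rightarrow> 'a::euclidean_space"
  shows "(\<And>i. i \<in> I \<Longrightarrow> f i \<in> L2_space L) \<Longrightarrow> (\<lambda>x. \<Sum>i\<in>I. f i x) \<in> L2_space L"
  by (induction I rule: infinite_finite_induct) (auto intro: L2_zero L2_add)

lemma L2_bounded_mult:
  fixes f :: "real \<Rightarrow> 'a::euclidean_space"
  assumes "f \<in> L2_space L" "m \<in> borel_measurable (interval_measure0 L)"
    and "AE x in interval_measure0 L. norm (m x) \<le> C"
  shows "(\<lambda>x. m x *\<^sub>R f x) \<in> L2_space L"
  by (rule L2_boundI[OF assms(1), of _ C])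
    (use assms(3) L2_measurable[OF assms(1)] assms(2) in \<open>auto intro!: mult_right_mono\<close>)

lemma L2_bounded:
  fixes f :: "real \<Rightarrow> 'a::euclidean_space"
  assumes "f \<in> borel_measurable (interval_measure0 L)" "AE x in interval_measure0 L. norm (f x) \<le> C"
  shows "f \<in> L2_space L"
proof -
  have "(\<lambda>x. 1::real) \<in> L2_space L"
    using finite_measure.integrable_const[OF finite_interval_measure] by (simp add: L2_space_def)
  from L2_boundI[OF this assms(1), of C] assms(2) show ?thesis by simp
qed

lemma
  fixes f :: "real \<Rightarrow> 'a::euclidean_space" and g :: "real \<Rightarrow> 'b::euclidean_space"
  assumes "f \<in> L2_space L" "g \<in> L2_space L"
  shows L2_prod_integrable: "integrable (interval_measure0 L) (\<lambda>x. norm (f x) * norm (g x))"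
    and Cauchy_Schwarz_L2: "(LINT x|interval_measure0 L. norm (f x) * norm (g x)) \<le> l2_norm L f * l2_norm L g"
proof -
  note [measurable] = assms[THEN L2_measurable]
  have m: "(\<lambda>x. norm (f x)) \<in> borel_measurable (interval_measure0 L)" "(\<lambda>x. norm (g x)) \<in> borel_measurable (interval_measure0 L)"
    by measurable
  note CS = Cauchy_Schwarz_integral[OF m assms[THEN L2_sq_integrable]]
  show "integrable (interval_measure0 L) (\<lambda>x. norm (f x) * norm (g x))" by (rule CS(1))
  have "(LINT x|interval_measure0 L. norm (f x) * norm (g x))\<^sup>2 \<le> (l2_norm L f * l2_norm L g)\<^sup>2"
    using CS(2) by (simp only: power_mult_distrib l2_norm_sq)
  then show "(LINT x|interval_measure0 L. norm (f x) * norm (g x)) \<le> l2_norm L f * l2_norm L g"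
    by (rule power2_le_imp_le) simp
qed

lemma l2_norm_triangle:
  fixes f g :: "real \<Rightarrow> 'a::euclidean_space"
  assumes "f \<in> L2_space L" "g \<in> L2_space L"
  shows "l2_norm L (\<lambda>x. f x + g x) \<le> l2_norm L f + l2_norm L g"
proof -
  let ?M = "interval_measure0 L"
  have "(l2_norm L (\<lambda>x. f x + g x))\<^sup>2 \<le> (LINT x|?M. (norm (f x))\<^sup>2 + 2 * (norm (f x) * norm (g x)) + (norm (g x))\<^sup>2)"
    unfolding l2_norm_sq
  proof (rule integral_mono)
    show "integrable ?M (\<lambda>x. (norm (f x + g x))\<^sup>2)" using L2_sq_integrable[OF L2_add[OF assms]] .
    show "integrable ?M (\<lambda>x. (norm (f x))\<^sup>2 + 2 * (norm (f x) * norm (g x)) + (norm (g x))\<^sup>2)"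
      using assms[THEN L2_sq_integrable] L2_prod_integrable[OF assms] by simp
    fix x
    have "(norm (f x + g x))\<^sup>2 \<le> (norm (f x) + norm (g x))\<^sup>2"
      by (intro power_mono norm_triangle_ineq) auto
    then show "(norm (f x + g x))\<^sup>2 \<le> (norm (f x))\<^sup>2 + 2 * (norm (f x) * norm (g x)) + (norm (g x))\<^sup>2"
      by (simp add: power2_eq_square algebra_simps)
  qed
  also have "\<dots> = (l2_norm L f)\<^sup>2 + 2 * (LINT x|?M. norm (f x) * norm (g x)) + (l2_norm L g)\<^sup>2"
    using assms[THEN L2_sq_integrable] L2_prod_integrable[OF assms] by (simp add: l2_norm_sq)
  also have "\<dots> \<le> (l2_norm L f + l2_norm L g)\<^sup>2"
    using Cauchy_Schwarz_L2[OF assms] by (simp add: power2_eq_square algebra_simps)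
  finally show ?thesis by (rule power2_le_imp_le) simp
qed

lemma l2_norm_mult_const:
  fixes f :: "real \<Rightarrow> 'a::{euclidean_space,real_normed_div_algebra}"
  shows "l2_norm L (\<lambda>x. c * f x) = norm c * l2_norm L f"
  by (simp add: l2_norm_def norm_mult power_mult_distrib real_sqrt_mult)

lemma l2_norm_of_real [simp]: "l2_norm L (\<lambda>x. complex_of_real (f x)) = l2_norm L f"
  by (simp add: l2_norm_def)

lemma l2_norm_minus_commute: "l2_norm L (\<lambda>x. f x - g x) = l2_norm L (\<lambda>x. g x - f x)"
  by (simp add: l2_norm_def norm_minus_commute)

lemma l2_norm_triangle_abs:
  fixes f g :: "real \<Rightarrow> 'a::euclidean_space"
  assumes "f \<in> L2_space L" "g \<in> L2_space L"
  shows "\<bar>l2_norm L f - l2_norm L g\<bar> \<le> l2_norm L (\<lambda>x. f x - g x)"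
  using l2_norm_triangle[OF L2_diff[OF assms] assms(2)] l2_norm_triangle[OF L2_diff[OF assms(2,1)] assms(1)]
  by (simp add: l2_norm_minus_commute[of L g f])

lemma L2_mult_integrable:
  fixes f g :: "real \<Rightarrow> complex"
  assumes "f \<in> L2_space L" "g \<in> L2_space L"
  shows "integrable (interval_measure0 L) (\<lambda>x. f x * g x)"
  by (rule Bochner_Integration.integrable_bound[OF L2_prod_integrable[OF assms]])
    (use assms[THEN L2_measurable] in \<open>auto simp: norm_mult\<close>)

lemma norm_L2_integral_le:
  fixes f g :: "real \<Rightarrow> complex"
  assumes "f \<in> L2_space L" "g \<in> L2_space L"
  shows "norm (LINT x|interval_measure0 L. f x * g x) \<le> l2_norm L f * l2_norm L g"
proof -
  have "norm (LINT x|interval_measure0 L. f x * g x) \<le> (LINT x|interval_measure0 L. norm (f x * g x))"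
    by (rule integral_norm_bound)
  also have "\<dots> \<le> l2_norm L f * l2_norm L g"
    using Cauchy_Schwarz_L2[OF assms] by (simp add: norm_mult)
  finally show ?thesis .
qed

section \<open>Fourier series\<close>

definition freq :: "real \<Rightarrow> int \<Rightarrow> real" where
  "freq L k = 2 * pi * of_int k / L"

definition fmode :: "real \<Rightarrow> int \<Rightarrow> real \<Rightarrow> complex" where
  "fmode L k x = cis (freq L k * x) / of_real (sqrt L)"

definition fcoef :: "real \<Rightarrow> int \<Rightarrow> (real \<Rightarrow> complex) \<Rightarrow> complex" where
  "fcoef L k f = (LINT x|interval_measure0 L. cnj (fmode L k x) * f x)"

lemma continuous_fmode: "continuous_on UNIV (fmode L k)"
  unfolding fmode_def divide_inverse by (intro continuous_intros)

lemma fmode_measurable [measurable]: "fmode L k \<in> borel_measurable (interval_measure0 L)"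
  by (intro continuous_imp_measurable_on_sets_lebesgue continuous_on_subset[OF continuous_fmode]) auto

lemma norm_fmode: "0 < L \<Longrightarrow> norm (fmode L k x) = 1 / sqrt L"
  by (simp add: fmode_def norm_divide)

lemma L2_fmode: "0 < L \<Longrightarrow> fmode L k \<in> L2_space L"
  by (rule L2_bounded[of _ _ "1 / sqrt L"]) (auto simp: norm_fmode)

lemma L2_cnj: "f \<in> L2_space L \<Longrightarrow> (\<lambda>x. cnj (f x)) \<in> L2_space L"
  by (rule L2_bounded_linear[OF bounded_linear_cnj])

lemma l2_norm_cnj [simp]: "l2_norm L (\<lambda>x. cnj (f x)) = l2_norm L f"
  by (simp add: l2_norm_def)

lemma integral_interval_measure0:
  fixes f :: "real \<Rightarrow> 'a::euclidean_space"
  assumes "integrable (interval_measure0 L) f"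
  shows "(LINT x|interval_measure0 L. f x) = integral {0..L} f"
  using lebesgue_integral_eq_integral[OF assms] by (simp add: integral_open_interval_real)

lemma integral_cis_freq:
  assumes "0 < L" "k \<noteq> 0"
  shows "integral {0..L} (\<lambda>x. cis (freq L k * x)) = 0"
proof -
  define a where "a = freq L k"
  have a: "a \<noteq> 0" using assms by (simp add: a_def freq_def)
  have "((\<lambda>x. cis (a * x)) has_integral (cis (a * L) / (\<i> * a) - cis (a * 0) / (\<i> * a))) {0..L}"
  proof (rule fundamental_theorem_of_calculus)
    fix x assume "x \<in> {0..L}"
    have "((\<lambda>z. exp (\<i> * a * z) / (\<i> * a)) has_field_derivative exp (\<i> * a * of_real x)) (at (of_real x))"
      using a by (auto intro!: derivative_eq_intros)
    from has_vector_derivative_real_field[OF this]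
    show "((\<lambda>x. cis (a * x) / (\<i> * a)) has_vector_derivative cis (a * x)) (at x within {0..L})"
      by (simp add: cis_conv_exp o_def mult.assoc)
  qed (use assms in auto)
  moreover have "cis (a * L) = 1"
  proof -
    have "a * L = 2 * pi * of_int k" using assms by (simp add: a_def freq_def)
    then show ?thesis by (simp add: cis_multiple_2pi)
  qed
  ultimately show ?thesis by (simp add: a_def integral_unique)
qed

lemma cnj_fmode_mult:
  assumes "0 < L"
  shows "cnj (fmode L j x) * fmode L k x = cis (freq L (k - j) * x) / L"
proof -
  have "cnj (fmode L j x) * fmode L k x = cis (- (freq L j * x)) * cis (freq L k * x) / (of_real (sqrt L) * of_real (sqrt L))"
    by (simp add: fmode_def cis_cnj)
  also have "of_real (sqrt L) * of_real (sqrt L) = complex_of_real L"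
    using assms by (simp flip: of_real_mult)
  also have "cis (- (freq L j * x)) * cis (freq L k * x) = cis (freq L (k - j) * x)"
    by (simp add: cis_mult freq_def diff_divide_distrib algebra_simps)
  finally show ?thesis .
qed

lemma fcoef_fmode:
  assumes "0 < L"
  shows "fcoef L j (fmode L k) = (if j = k then 1 else 0)"
proof -
  have "fcoef L j (fmode L k) = integral {0..L} (\<lambda>x. cis (freq L (k - j) * x) / L)"
    unfolding fcoef_def using L2_mult_integrable[OF L2_cnj[OF L2_fmode] L2_fmode, OF assms assms]
    by (subst integral_interval_measure0) (simp_all add: cnj_fmode_mult[OF assms])
  also have "\<dots> = integral {0..L} (\<lambda>x. cis (freq L (k - j) * x)) / L"
    by simp
  also have "\<dots> = (if j = k then 1 else 0)"
    using integral_cis_freq[of L "k - j"] assms by (auto simp: freq_def complex_eq_iff)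
  finally show ?thesis .
qed

lemma fcoef_add:
  assumes "0 < L" "f \<in> L2_space L" "g \<in> L2_space L"
  shows "fcoef L k (\<lambda>x. f x + g x) = fcoef L k f + fcoef L k g"
  unfolding fcoef_def using L2_mult_integrable[OF L2_cnj[OF L2_fmode[OF assms(1)]]] assms
  by (simp add: algebra_simps)

lemma fcoef_diff:
  assumes "0 < L" "f \<in> L2_space L" "g \<in> L2_space L"
  shows "fcoef L k (\<lambda>x. f x - g x) = fcoef L k f - fcoef L k g"
  unfolding fcoef_def using L2_mult_integrable[OF L2_cnj[OF L2_fmode[OF assms(1)]]] assms
  by (simp add: algebra_simps)

lemma fcoef_mult: "fcoef L k (\<lambda>x. c * f x) = c * fcoef L k f"
  unfolding fcoef_def by (simp add: mult.left_commute[of _ c])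

lemma fcoef_sum:
  assumes "0 < L" "\<And>i. i \<in> I \<Longrightarrow> f i \<in> L2_space L"
  shows "fcoef L k (\<lambda>x. \<Sum>i\<in>I. f i x) = (\<Sum>i\<in>I. fcoef L k (f i))"
  using assms(2)
  by (induction I rule: infinite_finite_induct) (auto simp: fcoef_def[of _ _ "\<lambda>x. 0"] fcoef_add[OF assms(1)] L2_sum)

lemma l2_norm_fmode:
  assumes "0 < L" shows "l2_norm L (fmode L k) = 1"
proof -
  have "complex_of_real ((l2_norm L (fmode L k))\<^sup>2) = fcoef L k (fmode L k)"
    unfolding l2_norm_sq fcoef_def integral_complex_of_real[symmetric]
    by (simp add: complex_norm_square mult.commute del: of_real_power)
  then have "complex_of_real ((l2_norm L (fmode L k))\<^sup>2) = 1"
    using assms by (simp del: of_real_power add: fcoef_fmode)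
  then have "(l2_norm L (fmode L k))\<^sup>2 = 1" by (simp only: of_real_eq_1_iff)
  then show ?thesis using l2_norm_nonneg[of L "fmode L k"] by (auto simp: power2_eq_1_iff)
qed

lemma norm_fcoef_le:
  assumes "0 < L" "f \<in> L2_space L"
  shows "norm (fcoef L k f) \<le> l2_norm L f"
  using norm_L2_integral_le[OF L2_cnj[OF L2_fmode[OF assms(1)]] assms(2)]
  by (simp add: fcoef_def l2_norm_fmode[OF assms(1)])

text \<open>Orthonormality turns the distance to a trigonometric sum into a sum of squares.  It is
  smallest when \<open>d\<close> consists of the Fourier coefficients, and for that choice it is Bessel's deficit.\<close>

lemma l2_dist_trig:
  assumes "0 < L" "f \<in> L2_space L" "finite K"
  shows "(l2_norm L (\<lambda>x. f x - (\<Sum>k\<in>K. d k * fmode L k x)))\<^sup>2 =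
    (l2_norm L f)\<^sup>2 - (\<Sum>k\<in>K. (norm (fcoef L k f))\<^sup>2) + (\<Sum>k\<in>K. (norm (fcoef L k f - d k))\<^sup>2)"
proof -
  let ?M = "interval_measure0 L"
  let ?c = "\<lambda>k. fcoef L k f"
  define p where "p x = (\<Sum>k\<in>K. d k * fmode L k x)" for x
  have p: "p \<in> L2_space L"
    unfolding p_def by (intro L2_sum L2_mult_left L2_fmode assms)
  have pint: "(LINT x|?M. cnj (p x) * g x) = (\<Sum>k\<in>K. cnj (d k) * fcoef L k g)" if g: "g \<in> L2_space L" for g
  proof -
    have "(LINT x|?M. cnj (p x) * g x) = (LINT x|?M. (\<Sum>k\<in>K. cnj (d k) * (cnj (fmode L k x) * g x)))"
      by (simp add: p_def sum_distrib_right mult.assoc)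
    also have "\<dots> = (\<Sum>k\<in>K. cnj (d k) * fcoef L k g)"
      unfolding fcoef_def using L2_mult_integrable[OF L2_cnj[OF L2_fmode[OF assms(1)]] g]
      by (subst Bochner_Integration.integral_sum) auto
    finally show ?thesis .
  qed
  have cp: "fcoef L k p = d k" if "k \<in> K" for k
  proof -
    have "fcoef L k p = (\<Sum>j\<in>K. d j * (if k = j then 1 else 0))"
      unfolding p_def using assms
      by (subst fcoef_sum) (auto simp: fcoef_mult fcoef_fmode intro!: L2_mult_left L2_fmode)
    then show ?thesis using that assms(3) by (simp add: if_distrib cong: if_cong)
  qed
  have sq: "complex_of_real ((l2_norm L g)\<^sup>2) = (LINT x|?M. cnj (g x) * g x)" for g :: "real \<Rightarrow> complex"
    unfolding l2_norm_sq integral_complex_of_real[symmetric] by (simp add: complex_norm_square mult.commute del: of_real_power)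
  have "(LINT x|?M. cnj (f x - p x) * (f x - p x)) =
      (LINT x|?M. cnj (f x) * f x - cnj (p x) * f x - (cnj (f x) * p x) + cnj (p x) * p x)"
    by (simp add: algebra_simps)
  also have "\<dots> = (LINT x|?M. cnj (f x) * f x) - (LINT x|?M. cnj (p x) * f x) - (LINT x|?M. cnj (f x) * p x) + (LINT x|?M. cnj (p x) * p x)"
    using L2_mult_integrable[OF L2_cnj] assms(2) p by simp
  also have "(LINT x|?M. cnj (f x) * p x) = cnj (LINT x|?M. cnj (p x) * f x)"
    by (subst Bochner_Integration.integral_cnj[symmetric]) (simp add: mult.commute)
  finally have "complex_of_real ((l2_norm L (\<lambda>x. f x - p x))\<^sup>2) =
     of_real ((l2_norm L f)\<^sup>2) - (\<Sum>k\<in>K. cnj (d k) * ?c k) - (\<Sum>k\<in>K. d k * cnj (?c k)) + (\<Sum>k\<in>K. cnj (d k) * d k)"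
    unfolding sq by (simp add: pint assms p cp)
  also have "\<dots> = of_real ((l2_norm L f)\<^sup>2) - (\<Sum>k\<in>K. ?c k * cnj (?c k)) + (\<Sum>k\<in>K. (?c k - d k) * cnj (?c k - d k))"
    by (simp add: algebra_simps sum_subtractf sum.distrib)
  also have "\<dots> = complex_of_real ((l2_norm L f)\<^sup>2 - (\<Sum>k\<in>K. (norm (?c k))\<^sup>2) + (\<Sum>k\<in>K. (norm (?c k - d k))\<^sup>2))"
    by (simp only: of_real_add of_real_diff of_real_sum complex_norm_square)
  finally show ?thesis unfolding of_real_eq_iff p_def .
qed

subsection \<open>Density of the trigonometric polynomials\<close>

inductive trig_poly :: "real \<Rightarrow> (real \<Rightarrow> complex) \<Rightarrow> bool" for L where
  mode: "trig_poly L (\<lambda>x. c * fmode L k x)"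
| add: "trig_poly L f \<Longrightarrow> trig_poly L g \<Longrightarrow> trig_poly L (\<lambda>x. f x + g x)"

lemma fmode_mult:
  assumes "0 < L" shows "fmode L j x * fmode L k x = fmode L (j + k) x / of_real (sqrt L)"
proof -
  have "cis (freq L j * x) * cis (freq L k * x) = cis (freq L (j + k) * x)"
    by (simp add: cis_mult freq_def add_divide_distrib distrib_left distrib_right)
  then show ?thesis by (simp add: fmode_def)
qed

lemma trig_poly_mult:
  assumes "0 < L" "trig_poly L f" "trig_poly L g" shows "trig_poly L (\<lambda>x. f x * g x)"
  using assms(2)
proof induction
  case (mode c k)
  show ?case using assms(3)
  proof induction
    case (mode d j)
    have "(\<lambda>x. c * fmode L k x * (d * fmode L j x)) = (\<lambda>x. (c * d / of_real (sqrt L)) * fmode L (k + j) x)"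
      using fmode_mult[OF assms(1), of k _ j] by (auto simp: fun_eq_iff algebra_simps)
    then show ?case by (simp only: trig_poly.mode)
  next
    case (add f g)
    then show ?case using trig_poly.add[OF add.IH] by (simp add: distrib_left)
  qed
next
  case (add f g)
  then show ?case using trig_poly.add[OF add.IH] by (simp add: distrib_right)
qed

lemma trig_poly_representation:
  assumes "trig_poly L f" obtains N :: nat and d where "\<And>x. f x = (\<Sum>k\<in>{-int N..int N}. d k * fmode L k x)"
proof -
  have "\<exists>N d. \<forall>x. f x = (\<Sum>k\<in>{-int N..int N}. d k * fmode L k x)"
    using assms
  proof induction
    case (mode c k)
    have "(\<Sum>j\<in>{-int (nat \<bar>k\<bar>)..int (nat \<bar>k\<bar>)}. (if j = k then c else 0) * fmode L j x) = c * fmode L k x" for x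
      by (subst sum.remove[of _ k]) (auto intro!: sum.neutral)
    then show ?case by (intro exI[of _ "nat \<bar>k\<bar>"] exI[of _ "\<lambda>j. if j = k then c else 0"]) simp
  next
    case (add f g)
    then obtain N d M e where f: "\<And>x. f x = (\<Sum>k\<in>{-int N..int N}. d k * fmode L k x)"
      and g: "\<And>x. g x = (\<Sum>k\<in>{-int M..int M}. e k * fmode L k x)" by blast
    define R where "R = max N M"
    have ext: "(\<Sum>k\<in>{-int N..int N}. d k * fmode L k x) = (\<Sum>k\<in>{-int R..int R}. (if k \<in> {-int N..int N} then d k else 0) * fmode L k x)"
      if "N \<le> R" for N d x
      using that by (intro sum.mono_neutral_cong_left) auto
    have "f x + g x = (\<Sum>k\<in>{-int R..int R}. ((if k \<in> {-int N..int N} then d k else 0) + (if k \<in> {-int M..int M} then e k else 0)) * fmode L k x)" for x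
      unfolding f g by (subst (1 2) ext) (auto simp: R_def sum.distrib distrib_right)
    then show ?case by (intro exI allI)
  qed
  then show ?thesis using that by blast
qed

text \<open>A polynomial on the unit circle is a trigonometric polynomial on the interval; this is what
  makes the Stone--Weierstrass theorem on the circle applicable.\<close>

lemma trig_poly_polynomial:
  assumes "0 < L" "real_polynomial_function h"
  shows "trig_poly L (\<lambda>x. of_real (h (cis (freq L 1 * x))))"
  using assms(2)
proof induction
  case (linear f)
  interpret bounded_linear f by fact
  have f: "f z = Re z * f 1 + Im z * f \<i>" for z
  proof -
    have "f z = f (Re z *\<^sub>R 1 + Im z *\<^sub>R \<i>)"
      by (rule arg_cong[where f=f]) (simp add: complex_eq_iff)
    then show ?thesis by (simp add: add scaleR)
  qed
  let ?a = "of_real (f 1) / 2 + of_real (f \<i>) / (2 * \<i>)"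
  let ?b = "of_real (f 1) / 2 - of_real (f \<i>) / (2 * \<i>)"
  have neg: "freq L (-1) = - freq L 1" by (simp add: freq_def)
  have "of_real (f (cis (freq L 1 * x))) = (?a * of_real (sqrt L)) * fmode L 1 x + (?b * of_real (sqrt L)) * fmode L (-1) x" for x
  proof -
    let ?z = "cis (freq L 1 * x)"
    have "?z + cnj ?z = 2 * complex_of_real (Re ?z)" "?z - cnj ?z = (2 * \<i>) * complex_of_real (Im ?z)"
      by (simp_all add: complex_eq_iff)
    then have "complex_of_real (Re ?z) = (?z + cnj ?z) / 2" "complex_of_real (Im ?z) = (?z - cnj ?z) / (2 * \<i>)"
      by simp_all
    then have "of_real (f ?z) = (?z + cnj ?z) / 2 * of_real (f 1) + (?z - cnj ?z) / (2 * \<i>) * of_real (f \<i>)"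
      unfolding f[of ?z] by simp
    also have "\<dots> = ?a * ?z + ?b * cnj ?z"
      by (simp add: ring_distribs diff_divide_distrib add_divide_distrib ac_simps)
    finally show ?thesis
      using assms(1) by (simp add: fmode_def neg cis_cnj)
  qed
  then show ?case using trig_poly.add[OF trig_poly.mode trig_poly.mode] by presburger
next
  case (const c)
  have "(\<lambda>x. complex_of_real c) = (\<lambda>x. (of_real c * of_real (sqrt L)) * fmode L 0 x)"
    using assms by (simp add: fmode_def freq_def)
  then show ?case using trig_poly.mode by presburger
next
  case (add f g)
  then show ?case using trig_poly.add by simp
next
  case (mult f g)
  then show ?case using trig_poly_mult[OF assms(1)] by simp
qed

definition trig_approx :: "real \<Rightarrow> (real \<Rightarrow> complex) \<Rightarrow> bool" where
  "trig_approx L f \<longleftrightarrow> f \<in> L2_space L \<and> (\<forall>e>0. \<exists>p. trig_poly L p \<and> l2_norm L (\<lambda>x. f x - p x) < e)"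

lemma L2_trig_poly: "0 < L \<Longrightarrow> trig_poly L p \<Longrightarrow> p \<in> L2_space L"
  by (erule trig_poly.induct) (auto intro!: L2_add L2_mult_left L2_fmode)

lemma trig_approx_limit:
  assumes "0 < L" "f \<in> L2_space L" "\<And>e. 0 < e \<Longrightarrow> \<exists>g. trig_approx L g \<and> l2_norm L (\<lambda>x. f x - g x) < e"
  shows "trig_approx L f"
  unfolding trig_approx_def
proof (intro conjI allI impI assms(2))
  fix e :: real assume "0 < e"
  then have e2: "0 < e / 2" by simp
  obtain g where g: "trig_approx L g" "l2_norm L (\<lambda>x. f x - g x) < e / 2" using assms(3)[OF e2] by blast
  then obtain p where p: "trig_poly L p" "l2_norm L (\<lambda>x. g x - p x) < e / 2"
    using e2 unfolding trig_approx_def by blast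
  have gL: "g \<in> L2_space L" using g by (simp add: trig_approx_def)
  have "l2_norm L (\<lambda>x. (f x - g x) + (g x - p x)) < e"
    using l2_norm_triangle[OF L2_diff[OF assms(2) gL] L2_diff[OF gL L2_trig_poly[OF assms(1) p(1)]]] g(2) p(2) by linarith
  then show "\<exists>p. trig_poly L p \<and> l2_norm L (\<lambda>x. f x - p x) < e" using p(1) by auto
qed

lemma trig_approx_combine:
  assumes "0 < L" "trig_approx L f" "trig_approx L g"
  shows "trig_approx L (\<lambda>x. f x + c * g x)"
  unfolding trig_approx_def
proof (intro conjI allI impI)
  have L: "f \<in> L2_space L" "g \<in> L2_space L" using assms by (auto simp: trig_approx_def)
  show "(\<lambda>x. f x + c * g x) \<in> L2_space L" by (intro L2_add L2_mult_left L)
  fix e :: real assume e: "0 < e"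
  obtain p where p: "trig_poly L p" "l2_norm L (\<lambda>x. f x - p x) < e / 2"
    using assms(2) e unfolding trig_approx_def by (meson half_gt_zero)
  obtain q where q: "trig_poly L q" "l2_norm L (\<lambda>x. g x - q x) < e / (2 * (norm c + 1))"
    using assms(3) e unfolding trig_approx_def by (smt (verit) divide_pos_pos norm_ge_zero)
  note pq = L2_trig_poly[OF assms(1) p(1)] L2_trig_poly[OF assms(1) q(1)]
  have cq: "trig_poly L (\<lambda>x. c * q x)"
  proof -
    have "trig_poly L (\<lambda>x. (c * of_real (sqrt L)) * fmode L 0 x)" by (rule trig_poly.mode)
    then have "trig_poly L (\<lambda>x. c)" using assms(1) by (simp add: fmode_def freq_def)
    from trig_poly_mult[OF assms(1) this q(1)] show ?thesis .
  qed
  have "norm c * l2_norm L (\<lambda>x. g x - q x) \<le> (norm c + 1) * l2_norm L (\<lambda>x. g x - q x)"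
    by (intro mult_right_mono) auto
  also have "\<dots> < (norm c + 1) * (e / (2 * (norm c + 1)))"
    by (intro mult_strict_left_mono q) (simp add: add_nonneg_pos)
  also have "\<dots> = e / 2"
  proof -
    have "K * (e / (2 * K)) = e / 2" if "K \<noteq> 0" for K :: real using that by simp
    moreover have "norm c + 1 \<noteq> 0" using norm_ge_zero[of c] by linarith
    ultimately show ?thesis by blast
  qed
  finally have *: "l2_norm L (\<lambda>x. c * (g x - q x)) < e / 2"
    by (simp add: l2_norm_mult_const)
  have "l2_norm L (\<lambda>x. (f x - p x) + c * (g x - q x)) < e"
    using l2_norm_triangle[OF L2_diff[OF L(1) pq(1)] L2_mult_left[OF L2_diff[OF L(2) pq(2)], of c]] p(2) * by linarith
  moreover have "(\<lambda>x. (f x - p x) + c * (g x - q x)) = (\<lambda>x. f x + c * g x - (p x + c * q x))"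
    by (auto simp: algebra_simps)
  ultimately show "\<exists>p. trig_poly L p \<and> l2_norm L (\<lambda>x. f x + c * g x - p x) < e"
    using trig_poly.add[OF p(1) cq] by metis
qed

lemma l2_dominated_convergence:
  fixes g :: "nat \<Rightarrow> real \<Rightarrow> 'a::euclidean_space" and w :: "real \<Rightarrow> 'b::euclidean_space"
  assumes g: "\<And>n. g n \<in> borel_measurable (interval_measure0 L)"
    and f: "f \<in> borel_measurable (interval_measure0 L)"
    and w: "w \<in> L2_space L" and le: "\<And>n. AE x in interval_measure0 L. norm (g n x) \<le> norm (w x)"
    and lim: "AE x in interval_measure0 L. (\<lambda>n. g n x) \<longlonglongrightarrow> f x"
  shows "f \<in> L2_space L" "(\<lambda>n. l2_norm L (\<lambda>x. f x - g n x)) \<longlonglongrightarrow> 0"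
proof -
  let ?M = "interval_measure0 L"
  note [measurable] = g f
  have all: "AE x in ?M. \<forall>n. norm (g n x) \<le> norm (w x)" using le by (simp add: AE_all_countable)
  then have fw: "AE x in ?M. norm (f x) \<le> norm (w x)"
    using lim by eventually_elim (rule Lim_bounded[OF tendsto_norm], auto)
  show fL: "f \<in> L2_space L" by (rule L2_boundI[OF w f, of 1]) (use fw in auto)
  have "(\<lambda>n. LINT x|?M. (norm (f x - g n x))\<^sup>2) \<longlonglongrightarrow> (LINT x|?M. 0)"
  proof (rule integral_dominated_convergence[where w="\<lambda>x. 4 * (norm (w x))\<^sup>2"])
    show "integrable ?M (\<lambda>x. 4 * (norm (w x))\<^sup>2)" using L2_sq_integrable[OF w] by simp
    show "AE x in ?M. (\<lambda>n. (norm (f x - g n x))\<^sup>2) \<longlonglongrightarrow> 0"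
      using lim
    proof eventually_elim
      case (elim x)
      then have "(\<lambda>n. (norm (f x - g n x))\<^sup>2) \<longlonglongrightarrow> (norm (f x - f x))\<^sup>2" by (intro tendsto_intros)
      then show ?case by simp
    qed
    show "AE x in ?M. norm ((norm (f x - g n x))\<^sup>2) \<le> 4 * (norm (w x))\<^sup>2" for n
      using all fw
    proof eventually_elim
      case (elim x)
      have "norm (f x - g n x) \<le> 2 * norm (w x)"
        using norm_triangle_ineq4[of "f x" "g n x"] elim(1)[rule_format, of n] elim(2) by linarith
      then have "(norm (f x - g n x))\<^sup>2 \<le> (2 * norm (w x))\<^sup>2" by (intro power_mono) auto
      then show ?case by (simp add: power_mult_distrib)
    qed
  qed auto
  from tendsto_real_sqrt[OF this] show "(\<lambda>n. l2_norm L (\<lambda>x. f x - g n x)) \<longlonglongrightarrow> 0"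
    by (simp add: l2_norm_def)
qed

lemma trig_approx_dominated:
  assumes "0 < L" "\<And>n. trig_approx L (g n)" "f \<in> borel_measurable (interval_measure0 L)"
    and w: "w \<in> L2_space L" and le: "\<And>n. AE x in interval_measure0 L. norm (g n x) \<le> norm (w x :: complex)"
    and lim: "AE x in interval_measure0 L. (\<lambda>n. g n x) \<longlonglongrightarrow> f x"
  shows "trig_approx L f"
proof (rule trig_approx_limit[OF assms(1)])
  have g: "g n \<in> borel_measurable (interval_measure0 L)" for n
    using assms(2) by (auto simp: trig_approx_def intro: L2_measurable)
  note * = l2_dominated_convergence[OF g assms(3) w le lim]
  show "f \<in> L2_space L" by (rule *)
  fix e :: real assume "0 < e"
  then obtain n where "l2_norm L (\<lambda>x. f x - g n x) < e"
    using order_tendstoD(2)[OF *(2)] by (auto simp: eventually_sequentially)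
  then show "\<exists>g. trig_approx L g \<and> l2_norm L (\<lambda>x. f x - g x) < e" using assms(2) by blast
qed

text \<open>With equal values at the end points, \<open>g\<close> descends to a function \<open>G\<close> on the unit circle.
  The interval is compact, so the preimage under \<open>G\<close> of a closed set is the image of a compact set;
  hence \<open>G\<close> is continuous.\<close>

lemma trig_approx_continuous:
  fixes g :: "real \<Rightarrow> real"
  assumes L: "0 < L" and g: "continuous_on {0..L} g" and per: "g 0 = g L"
  shows "trig_approx L (\<lambda>x. of_real (g x))"
proof -
  define p where "p x = cis (freq L 1 * x)" for x
  define G where "G z = g (L * Arg2pi z / (2 * pi))" for z
  let ?S = "sphere 0 1 :: complex set"
  have Gp: "G (p x) = g x" if "x \<in> {0..L}" for x
  proof (cases "x = L")
    case True
    then have "p x = 1" using L by (simp add: p_def freq_def)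
    moreover have "Arg2pi 1 = 0" by (rule Arg2pi_unique[of 1]) auto
    ultimately show ?thesis using True per by (simp add: G_def)
  next
    case False
    then have "Arg2pi (p x) = freq L 1 * x"
      using that L by (intro Arg2pi_unique[of 1]) (auto simp: p_def cis_conv_exp freq_def field_simps)
    then show ?thesis using L by (simp add: G_def freq_def)
  qed
  have surj: "\<exists>x\<in>{0..L}. p x = z" if "z \<in> ?S" for z
  proof
    have z: "norm z = 1" using that by simp
    show "p (L * Arg2pi z / (2 * pi)) = z"
    proof -
      have "freq L 1 * (L * Arg2pi z / (2 * pi)) = Arg2pi z" using L by (simp add: freq_def)
      then show ?thesis using Arg2pi_eq[of z] z by (simp add: p_def cis_conv_exp)
    qed
    show "L * Arg2pi z / (2 * pi) \<in> {0..L}"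
    proof -
      have "L * Arg2pi z \<le> L * (2 * pi)"
        using Arg2pi_lt_2pi[of z] L by (intro mult_left_mono) auto
      then show ?thesis using Arg2pi_ge_0[of z] L by (auto simp: divide_le_eq)
    qed
  qed
  have pS: "p x \<in> ?S" for x by (simp add: p_def)
  have pc: "continuous_on A p" for A unfolding p_def by (intro continuous_intros)
  have "continuous_on ?S G"
    unfolding continuous_on_closed_vimage[OF closed_sphere]
  proof (intro allI impI)
    fix B :: "real set" assume B: "closed B"
    have "closed (g -` B \<inter> {0..L})"
      using g B continuous_on_closed_vimage[of "{0..L}" g] by simp
    then have "compact (g -` B \<inter> {0..L})"
      by (metis Int_absorb Int_assoc closed_Int_compact compact_Icc)
    then have "closed (p ` (g -` B \<inter> {0..L}))"
      by (intro compact_imp_closed compact_continuous_image pc)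
    also have "p ` (g -` B \<inter> {0..L}) = G -` B \<inter> ?S"
    proof (intro equalityI subsetI)
      fix z assume "z \<in> p ` (g -` B \<inter> {0..L})"
      then obtain x where "x \<in> {0..L}" "g x \<in> B" "z = p x" by blast
      then show "z \<in> G -` B \<inter> ?S" using Gp[of x] pS[of x] by simp
    next
      fix z assume z: "z \<in> G -` B \<inter> ?S"
      then obtain x where x: "x \<in> {0..L}" "p x = z" using surj[of z] by blast
      then have "g x \<in> B" using Gp[OF x(1)] z by simp
      then show "z \<in> p ` (g -` B \<inter> {0..L})" using x by blast
    qed
    finally show "closed (G -` B \<inter> ?S)" .
  qed
  note SW = Stone_Weierstrass_real_polynomial_function[OF compact_sphere this]
  have gm: "(\<lambda>x. complex_of_real (g x)) \<in> borel_measurable (interval_measure0 L)"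
    by (intro continuous_imp_measurable_on_sets_lebesgue continuous_intros continuous_on_subset[OF g]) auto
  have "compact (g ` {0..L})" by (intro compact_continuous_image g) simp
  then obtain C where C: "\<And>x. x \<in> {0..L} \<Longrightarrow> norm (g x) \<le> C"
    using compact_imp_bounded bounded_iff by (metis imageI)
  show ?thesis unfolding trig_approx_def
  proof (intro conjI allI impI)
    show gL: "(\<lambda>x. complex_of_real (g x)) \<in> L2_space L"
      by (rule L2_bounded[OF gm, of C]) (use C in \<open>auto intro!: AE_I2\<close>)
    fix e :: real assume e: "0 < e"
    define e' where "e' = e / (2 * sqrt L)"
    have "0 < e'" using e L by (simp add: e'_def)
    then obtain h where h: "real_polynomial_function h" "\<And>z. z \<in> ?S \<Longrightarrow> \<bar>G z - h z\<bar> < e'"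
      using SW by metis
    have tp: "trig_poly L (\<lambda>x. of_real (h (p x)))"
      unfolding p_def by (rule trig_poly_polynomial[OF L h(1)])
    have "l2_norm L (\<lambda>x. complex_of_real (g x) - of_real (h (p x))) \<le> (e' * sqrt L) * l2_norm L (fmode L 0)"
    proof (rule l2_norm_bound[OF L2_fmode[OF L]])
      show "(\<lambda>x. complex_of_real (g x) - of_real (h (p x))) \<in> borel_measurable (interval_measure0 L)"
        using L2_measurable[OF L2_diff[OF gL L2_trig_poly[OF L tp]]] .
      have "norm (complex_of_real (g x) - of_real (h (p x))) \<le> e'" if "x \<in> {0<..<L}" for x
        using h(2)[OF pS[of x]] that Gp[of x] by (simp flip: of_real_diff)
      then show "AE x in interval_measure0 L. norm (complex_of_real (g x) - of_real (h (p x))) \<le> (e' * sqrt L) * norm (fmode L 0 x)"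
        using L by (intro AE_I2) (auto simp: norm_fmode)
    qed (use \<open>0 < e'\<close> L in auto)
    also have "\<dots> < e" using e L by (simp add: l2_norm_fmode e'_def)
    finally show "\<exists>p. trig_poly L p \<and> l2_norm L (\<lambda>x. complex_of_real (g x) - p x) < e" using tp by blast
  qed
qed

text \<open>A measurable function is an almost everywhere limit of continuous functions.  Clipping keeps
  these dominated, and the cut-off \<open>w\<close>, which tends to one inside the interval, gives them the value
  zero at both end points.\<close>

lemma trig_approx_real_bounded:
  fixes f :: "real \<Rightarrow> real"
  assumes L: "0 < L" and f: "f \<in> borel_measurable (interval_measure0 L)" and C: "\<And>x. \<bar>f x\<bar> \<le> C"
  shows "trig_approx L (\<lambda>x. of_real (f x))"
proof -
  have "f measurable_on {0<..<L}"
    using f by (simp add: measurable_on_iff_borel_measurable)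
  then obtain N g where N: "negligible N" and g: "\<And>n. continuous_on UNIV (g n)"
    and lim: "\<And>x. x \<notin> N \<Longrightarrow> (\<lambda>n. g n x) \<longlonglongrightarrow> (if x \<in> {0<..<L} then f x else 0)"
    unfolding measurable_on_def by blast
  define w where "w n x = min 1 (real n * min x (L - x))" for n x
  define r where "r n x = w n x * max (- C) (min C (g n x))" for n x
  have C0: "0 \<le> C" using C[of 0] by linarith
  show ?thesis
  proof (rule trig_approx_dominated[OF L, where g="\<lambda>n x. of_real (r n x)" and w="\<lambda>x. of_real C"])
    show "trig_approx L (\<lambda>x. of_real (r n x))" for n
      by (rule trig_approx_continuous[OF L])
        (auto simp: r_def w_def L less_imp_le intro!: continuous_intros continuous_on_subset[OF g])
    show "(\<lambda>x. complex_of_real (f x)) \<in> borel_measurable (interval_measure0 L)" using f by measurable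
    show "(\<lambda>x. complex_of_real C) \<in> L2_space L" by (rule L2_bounded[of _ _ "\<bar>C\<bar>"]) auto
    show "AE x in interval_measure0 L. norm (complex_of_real (r n x)) \<le> norm (complex_of_real C)" for n
    proof (rule AE_I2)
      fix x assume "x \<in> space (interval_measure0 L)"
      then have "\<bar>w n x\<bar> \<le> 1" by (auto simp: w_def)
      moreover have "\<bar>max (- C) (min C (g n x))\<bar> \<le> C" using C0 by auto
      ultimately have "\<bar>r n x\<bar> \<le> 1 * C" unfolding r_def abs_mult by (intro mult_mono) auto
      then show "norm (complex_of_real (r n x)) \<le> norm (complex_of_real C)" by simp
    qed
    have "AE x in lebesgue. x \<notin> N" using N by (simp add: negligible_iff_null_sets AE_not_in)
    then have "AE x in interval_measure0 L. x \<notin> N" by (auto simp: AE_restrict_space_iff elim: eventually_mono)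
    then show "AE x in interval_measure0 L. (\<lambda>n. complex_of_real (r n x)) \<longlonglongrightarrow> of_real (f x)"
    proof (rule AE_mp, intro AE_I2 impI)
      fix x assume x: "x \<in> space (interval_measure0 L)" "x \<notin> N"
      have m: "0 < min x (L - x)" using x by auto
      obtain n0 where n0: "1 / min x (L - x) < real n0" using reals_Archimedean2 by blast
      have "w n x = 1" if "n0 \<le> n" for n
      proof -
        have "1 / min x (L - x) \<le> real n" using n0 that by linarith
        then have "1 \<le> real n * min x (L - x)" using m by (simp add: divide_le_eq)
        then show ?thesis by (simp add: w_def)
      qed
      then have "(\<lambda>n. w n x) \<longlonglongrightarrow> 1" by (intro tendsto_eventually) (auto simp: eventually_sequentially)
      moreover have "(\<lambda>n. g n x) \<longlonglongrightarrow> f x" using lim[OF x(2)] x(1) by simp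
      ultimately have "(\<lambda>n. r n x) \<longlonglongrightarrow> 1 * max (- C) (min C (f x))"
        unfolding r_def by (intro tendsto_intros)
      moreover have "max (- C) (min C (f x)) = f x" using C[of x] by auto
      ultimately show "(\<lambda>n. complex_of_real (r n x)) \<longlonglongrightarrow> of_real (f x)" by (intro tendsto_of_real) simp
    qed
  qed
qed

lemma trig_approx_real:
  fixes f :: "real \<Rightarrow> real"
  assumes L: "0 < L" and f: "f \<in> L2_space L"
  shows "trig_approx L (\<lambda>x. of_real (f x))"
proof (rule trig_approx_dominated[OF L, where g="\<lambda>n x. of_real (max (- real n) (min (real n) (f x)))" and w="\<lambda>x. of_real (f x)"])
  note [measurable] = L2_measurable[OF f]
  show "trig_approx L (\<lambda>x. of_real (max (- real n) (min (real n) (f x))))" for n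
    by (rule trig_approx_real_bounded[OF L, of _ "real n"]) auto
  show "(\<lambda>x. complex_of_real (f x)) \<in> borel_measurable (interval_measure0 L)" by measurable
  show "(\<lambda>x. complex_of_real (f x)) \<in> L2_space L" by (rule L2_bounded_linear[OF bounded_linear_of_real f])
  have "(\<lambda>n. max (- real n) (min (real n) (f x))) \<longlonglongrightarrow> f x" for x
  proof -
    obtain n0 where n0: "\<bar>f x\<bar> < real n0" using reals_Archimedean2 by blast
    then have "max (- real n) (min (real n) (f x)) = f x" if "n0 \<le> n" for n using that by auto
    then show ?thesis by (intro tendsto_eventually) (auto simp: eventually_sequentially)
  qed
  then show "AE x in interval_measure0 L. (\<lambda>n. complex_of_real (max (- real n) (min (real n) (f x)))) \<longlonglongrightarrow> of_real (f x)"
    by (intro AE_I2 tendsto_of_real)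
qed auto

theorem trig_approx_L2:
  assumes L: "0 < L" and f: "f \<in> L2_space L"
  shows "trig_approx L f"
proof -
  have "trig_approx L (\<lambda>x. of_real (Re (f x)) + \<i> * of_real (Im (f x)))"
    by (intro trig_approx_combine trig_approx_real L L2_bounded_linear[OF bounded_linear_Re f] L2_bounded_linear[OF bounded_linear_Im f])
  moreover have "(\<lambda>x. of_real (Re (f x)) + \<i> * of_real (Im (f x))) = f"
    by (auto simp: complex_eq_iff)
  ultimately show ?thesis by simp
qed

subsection \<open>Parseval's identity\<close>

definition fproj :: "real \<Rightarrow> nat \<Rightarrow> (real \<Rightarrow> complex) \<Rightarrow> real \<Rightarrow> complex" where
  "fproj L N f x = (\<Sum>k\<in>{-int N..int N}. fcoef L k f * fmode L k x)"

lemma L2_fproj: "0 < L \<Longrightarrow> fproj L N f \<in> L2_space L"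
  unfolding fproj_def by (intro L2_sum L2_mult_left L2_fmode)

lemma l2_dist_fproj:
  assumes "0 < L" "f \<in> L2_space L"
  shows "(l2_norm L (\<lambda>x. f x - fproj L N f x))\<^sup>2 = (l2_norm L f)\<^sup>2 - (\<Sum>k\<in>{-int N..int N}. (norm (fcoef L k f))\<^sup>2)"
  using l2_dist_trig[OF assms, of "{-int N..int N}" "\<lambda>k. fcoef L k f"] by (simp add: fproj_def)

lemma Bessel:
  assumes "0 < L" "f \<in> L2_space L"
  shows "(\<Sum>k\<in>{-int N..int N}. (norm (fcoef L k f))\<^sup>2) \<le> (l2_norm L f)\<^sup>2"
  using l2_dist_fproj[OF assms, of N] zero_le_power2[of "l2_norm L (\<lambda>x. f x - fproj L N f x)"] by linarith

lemma fproj_tendsto: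
  assumes L: "0 < L" and f: "f \<in> L2_space L"
  shows "(\<lambda>N. l2_norm L (\<lambda>x. f x - fproj L N f x)) \<longlonglongrightarrow> 0"
proof (rule LIMSEQ_I)
  fix e :: real assume "0 < e"
  then obtain p where p: "trig_poly L p" "l2_norm L (\<lambda>x. f x - p x) < e"
    using trig_approx_L2[OF assms] unfolding trig_approx_def by blast
  obtain N d where d: "\<And>x. p x = (\<Sum>k\<in>{-int N..int N}. d k * fmode L k x)"
    using trig_poly_representation[OF p(1)] by blast
  have "l2_norm L (\<lambda>x. f x - fproj L n f x) < e" if n: "N \<le> n" for n
  proof -
    have "(l2_norm L (\<lambda>x. f x - fproj L n f x))\<^sup>2 \<le> (l2_norm L f)\<^sup>2 - (\<Sum>k\<in>{-int N..int N}. (norm (fcoef L k f))\<^sup>2)"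
      unfolding l2_dist_fproj[OF assms] using n by (intro diff_left_mono sum_mono2) auto
    also have "\<dots> \<le> (l2_norm L (\<lambda>x. f x - p x))\<^sup>2"
      unfolding d l2_dist_trig[OF assms finite_atLeastAtMost_int] by (simp add: sum_nonneg)
    finally have "l2_norm L (\<lambda>x. f x - fproj L n f x) \<le> l2_norm L (\<lambda>x. f x - p x)"
      by (rule power2_le_imp_le) simp
    then show ?thesis using p(2) by linarith
  qed
  then show "\<exists>no. \<forall>n\<ge>no. norm (l2_norm L (\<lambda>x. f x - fproj L n f x) - 0) < e" by auto
qed

lemma Parseval:
  assumes L: "0 < L" and f: "f \<in> L2_space L"
  shows "(\<lambda>N. \<Sum>k\<in>{-int N..int N}. (norm (fcoef L k f))\<^sup>2) \<longlonglongrightarrow> (l2_norm L f)\<^sup>2"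
proof -
  have "(\<lambda>N. (l2_norm L f)\<^sup>2 - (l2_norm L (\<lambda>x. f x - fproj L N f x))\<^sup>2) \<longlonglongrightarrow> (l2_norm L f)\<^sup>2 - 0\<^sup>2"
    by (intro tendsto_intros fproj_tendsto assms)
  then show ?thesis by (simp add: l2_dist_fproj assms)
qed

text \<open>The partial sums are the inner products of \<open>g\<close> with the projections of \<open>f\<close>, which converge to \<open>f\<close>.\<close>

lemma Parseval_inner:
  assumes L: "0 < L" and f: "f \<in> L2_space L" and g: "g \<in> L2_space L"
  shows "(\<lambda>N. \<Sum>k\<in>{-int N..int N}. cnj (fcoef L k f) * fcoef L k g) \<longlonglongrightarrow> (LINT x|interval_measure0 L. cnj (f x) * g x)"
    and "norm (\<Sum>k\<in>{-int N..int N}. cnj (fcoef L k f) * fcoef L k g) \<le> l2_norm L f * l2_norm L g"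
proof -
  let ?M = "interval_measure0 L"
  have eq: "(\<Sum>k\<in>{-int N..int N}. cnj (fcoef L k f) * fcoef L k g) = (LINT x|?M. cnj (fproj L N f x) * g x)" for N
  proof -
    have "(LINT x|?M. cnj (fproj L N f x) * g x) = (LINT x|?M. (\<Sum>k\<in>{-int N..int N}. cnj (fcoef L k f) * (cnj (fmode L k x) * g x)))"
      by (simp add: fproj_def sum_distrib_right mult.assoc)
    also have "\<dots> = (\<Sum>k\<in>{-int N..int N}. cnj (fcoef L k f) * fcoef L k g)"
      unfolding fcoef_def[of _ _ g] using L2_mult_integrable[OF L2_cnj[OF L2_fmode[OF L]] g]
      by (subst Bochner_Integration.integral_sum) auto
    finally show ?thesis by simp
  qed
  note P = L2_fproj[OF L, of _ f]
  have "norm ((LINT x|?M. cnj (fproj L N f x) * g x) - (LINT x|?M. cnj (f x) * g x)) \<le> l2_norm L (\<lambda>x. f x - fproj L N f x) * l2_norm L g" for N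
  proof -
    have "(LINT x|?M. cnj (fproj L N f x) * g x) - (LINT x|?M. cnj (f x) * g x) = - (LINT x|?M. cnj (f x - fproj L N f x) * g x)"
      using L2_mult_integrable[OF L2_cnj[OF P] g] L2_mult_integrable[OF L2_cnj[OF f] g]
      by (simp add: left_diff_distrib)
    then show ?thesis using norm_L2_integral_le[OF L2_cnj[OF L2_diff[OF f P]] g, of N] by (simp only: norm_minus_cancel l2_norm_cnj)
  qed
  moreover have "(\<lambda>N. l2_norm L (\<lambda>x. f x - fproj L N f x) * l2_norm L g) \<longlonglongrightarrow> 0"
    by (rule tendsto_mult_left_zero[OF fproj_tendsto[OF L f]])
  ultimately have "(\<lambda>N. (LINT x|?M. cnj (fproj L N f x) * g x) - (LINT x|?M. cnj (f x) * g x)) \<longlonglongrightarrow> 0"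
    by (rule Lim_null_comparison[OF always_eventually[OF allI]])
  then show "(\<lambda>N. \<Sum>k\<in>{-int N..int N}. cnj (fcoef L k f) * fcoef L k g) \<longlonglongrightarrow> (LINT x|?M. cnj (f x) * g x)"
    unfolding eq by (simp only: LIM_zero_iff)
  have "norm (\<Sum>k\<in>{-int N..int N}. cnj (fcoef L k f) * fcoef L k g) \<le> (\<Sum>k\<in>{-int N..int N}. norm (fcoef L k f) * norm (fcoef L k g))"
    by (rule order_trans[OF norm_sum]) (simp add: norm_mult)
  also have "\<dots> \<le> sqrt (\<Sum>k\<in>{-int N..int N}. (norm (fcoef L k f))\<^sup>2) * sqrt (\<Sum>k\<in>{-int N..int N}. (norm (fcoef L k g))\<^sup>2)"
    using Cauchy_Schwarz_ineq_sum[of "\<lambda>k. norm (fcoef L k f)" "\<lambda>k. norm (fcoef L k g)" "{-int N..int N}"]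
    by (simp flip: real_sqrt_mult add: real_le_rsqrt)
  also have "\<dots> \<le> l2_norm L f * l2_norm L g"
    using Bessel[OF L f] Bessel[OF L g] by (intro mult_mono real_le_lsqrt) (auto simp: sum_nonneg)
  finally show "norm (\<Sum>k\<in>{-int N..int N}. cnj (fcoef L k f) * fcoef L k g) \<le> l2_norm L f * l2_norm L g" .
qed

lemma l2_norm_eq_0D:
  fixes f :: "real \<Rightarrow> 'a::euclidean_space"
  assumes "f \<in> L2_space L" "l2_norm L f = 0"
  shows "AE x in interval_measure0 L. f x = 0"
  using integral_nonneg_eq_0_iff_AE[OF L2_sq_integrable[OF assms(1)]] assms(2)
  by (simp add: l2_norm_def)

lemma fcoef_unique:
  assumes L: "0 < L" and f: "f \<in> L2_space L" and "g \<in> L2_space L" and eq: "\<And>k. fcoef L k f = fcoef L k g"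
  shows "AE x in interval_measure0 L. f x = g x"
proof -
  have d: "(\<lambda>x. f x - g x) \<in> L2_space L" using assms by (intro L2_diff)
  have "(\<lambda>N. 0) \<longlonglongrightarrow> (l2_norm L (\<lambda>x. f x - g x))\<^sup>2"
    using Parseval[OF L d] by (simp add: fcoef_diff assms)
  from LIMSEQ_unique[OF this tendsto_const] have "l2_norm L (\<lambda>x. f x - g x) = 0" by simp
  from l2_norm_eq_0D[OF d this] show ?thesis by simp
qed

section \<open>The space \<open>H^1\<close>\<close>

subsection \<open>Weak derivatives and Fourier coefficients\<close>

lemma deriv_trig:
  fixes a b c :: real
  shows "deriv (\<lambda>x. a * cos (c * x) + b * sin (c * x)) = (\<lambda>x. (b * c) * cos (c * x) + (- a * c) * sin (c * x))"
  by (rule ext, rule DERIV_imp_deriv) (auto intro!: derivative_eq_intros)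

lemma test_function_trig: "test_function L (\<lambda>x. a * cos (freq L k * x) + b * sin (freq L k * x))" if "0 < L"
proof -
  let ?c = "freq L k"
  have shift: "?c * (x + L) = ?c * x + 2 * pi * of_int k" for x
    using that by (simp add: freq_def field_simps)
  have "\<exists>p q. (deriv ^^ n) (\<lambda>x. a * cos (?c * x) + b * sin (?c * x)) = (\<lambda>x. p * cos (?c * x) + q * sin (?c * x))" for n
  proof (induction n)
    case 0
    show ?case by auto
  next
    case (Suc n)
    then obtain p q where "(deriv ^^ n) (\<lambda>x. a * cos (?c * x) + b * sin (?c * x)) = (\<lambda>x. p * cos (?c * x) + q * sin (?c * x))" by blast
    then have "(deriv ^^ Suc n) (\<lambda>x. a * cos (?c * x) + b * sin (?c * x)) = (\<lambda>x. (q * ?c) * cos (?c * x) + (- p * ?c) * sin (?c * x))"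
      using deriv_trig[of p ?c q] by simp
    then show ?case by blast
  qed
  moreover have "(\<lambda>x. p * cos (?c * x) + q * sin (?c * x)) differentiable_on UNIV" for p q
    unfolding differentiable_on_def
  proof
    fix x :: real
    have "((\<lambda>x. p * cos (?c * x) + q * sin (?c * x)) has_real_derivative (q * ?c * cos (?c * x) - p * ?c * sin (?c * x))) (at x)"
      by (auto intro!: derivative_eq_intros)
    then show "(\<lambda>x. p * cos (?c * x) + q * sin (?c * x)) differentiable (at x within UNIV)"
      using real_differentiable_def by blast
  qed
  ultimately have "(deriv ^^ n) (\<lambda>x. a * cos (?c * x) + b * sin (?c * x)) differentiable_on UNIV" for n
    by metis
  moreover have "cos (?c * (x + L)) = cos (?c * x)" "sin (?c * (x + L)) = sin (?c * x)" for x
    unfolding shift using sin_cos_eq_iff[of "?c * x + 2 * pi * of_int k" "?c * x"] by (auto simp: cos_add sin_add)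
  ultimately show ?thesis unfolding test_function_def by auto
qed

text \<open>Test functions are real, so a mode is tested through its real and imaginary parts.\<close>

definition ftest_cos :: "real \<Rightarrow> int \<Rightarrow> real \<Rightarrow> real" where
  "ftest_cos L k x = cos (freq L k * x)"
definition ftest_sin :: "real \<Rightarrow> int \<Rightarrow> real \<Rightarrow> real" where
  "ftest_sin L k x = sin (freq L k * x)"

lemma test_function_ftest:
  assumes "0 < L" shows "test_function L (ftest_cos L k)" "test_function L (ftest_sin L k)"
  using test_function_trig[OF assms, of 1 k 0] test_function_trig[OF assms, of 0 k 1]
  by (simp_all add: ftest_cos_def[abs_def] ftest_sin_def[abs_def])

lemma deriv_ftest:
  "deriv (ftest_cos L k) = (\<lambda>x. - freq L k * ftest_sin L k x)"
  "deriv (ftest_sin L k) = (\<lambda>x. freq L k * ftest_cos L k x)"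
  using deriv_trig[of 1 "freq L k" 0] deriv_trig[of 0 "freq L k" 1]
  by (simp_all add: ftest_cos_def[abs_def] ftest_sin_def[abs_def])

lemma deriv2_ftest:
  "(deriv ^^ 2) (ftest_cos L k) = (\<lambda>x. - (freq L k)\<^sup>2 * ftest_cos L k x)"
  "(deriv ^^ 2) (ftest_sin L k) = (\<lambda>x. - (freq L k)\<^sup>2 * ftest_sin L k x)"
proof -
  have D: "(deriv ^^ 2) \<phi> = deriv (deriv \<phi>)" for \<phi> :: "real \<Rightarrow> real" by (simp add: numeral_2_eq_2)
  show "(deriv ^^ 2) (ftest_cos L k) = (\<lambda>x. - (freq L k)\<^sup>2 * ftest_cos L k x)"
    "(deriv ^^ 2) (ftest_sin L k) = (\<lambda>x. - (freq L k)\<^sup>2 * ftest_sin L k x)"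
    using deriv_trig[of 0 "freq L k" "- freq L k"] deriv_trig[of "freq L k" "freq L k" 0]
    unfolding D deriv_ftest unfolding ftest_cos_def ftest_sin_def by (simp_all add: power2_eq_square)
qed

lemma ftest_measurable [measurable]:
  "ftest_cos L k \<in> borel_measurable (interval_measure0 L)"
  "ftest_sin L k \<in> borel_measurable (interval_measure0 L)"
  unfolding ftest_cos_def[abs_def] ftest_sin_def[abs_def]
  by (intro continuous_imp_measurable_on_sets_lebesgue continuous_intros; simp)+

lemma L2_ftest:
  fixes f :: "real \<Rightarrow> 'a::euclidean_space"
  assumes "f \<in> L2_space L"
  shows "(\<lambda>x. ftest_cos L k x *\<^sub>R f x) \<in> L2_space L" "(\<lambda>x. ftest_sin L k x *\<^sub>R f x) \<in> L2_space L"
  by (auto intro!: L2_bounded_mult[OF assms, of _ 1]) (simp_all add: ftest_cos_def ftest_sin_def)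

lemma L2_integrable:
  fixes f :: "real \<Rightarrow> 'a::euclidean_space"
  assumes "f \<in> L2_space L" shows "integrable (interval_measure0 L) f"
proof -
  have "(\<lambda>x. 1::real) \<in> L2_space L" by (rule L2_bounded[of _ _ 1]) auto
  from Bochner_Integration.integrable_bound[OF L2_prod_integrable[OF assms this] L2_measurable[OF assms]]
  show ?thesis by simp
qed

lemma pairing_scale: "pairing L (\<lambda>x. c * \<phi> x) f = c *\<^sub>R pairing L \<phi> f"
proof -
  have "(\<lambda>x. (c * \<phi> x) *\<^sub>R f x) = (\<lambda>x. c *\<^sub>R (\<phi> x *\<^sub>R f x))" by simp
  then show ?thesis unfolding pairing_def by (simp only: integral_scaleR_right)
qed

lemma fcoef_eq_pairing:
  assumes "0 < L" "f \<in> L2_space L"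
  shows "fcoef L k f = (pairing L (ftest_cos L k) f - \<i> * pairing L (ftest_sin L k) f) / of_real (sqrt L)"
proof -
  have "cnj (fmode L k x) * f x = (ftest_cos L k x *\<^sub>R f x - \<i> * (ftest_sin L k x *\<^sub>R f x)) / of_real (sqrt L)" for x
  proof -
    have "cnj (cis (freq L k * x)) = of_real (ftest_cos L k x) - \<i> * of_real (ftest_sin L k x)"
      by (simp add: ftest_cos_def ftest_sin_def complex_eq_iff)
    then show ?thesis by (simp add: fmode_def scaleR_conv_of_real left_diff_distrib mult.assoc)
  qed
  then have "fcoef L k f = (LINT x|interval_measure0 L. (ftest_cos L k x *\<^sub>R f x - \<i> * (ftest_sin L k x *\<^sub>R f x)) / of_real (sqrt L))"
    by (simp add: fcoef_def)
  also have "\<dots> = (pairing L (ftest_cos L k) f - \<i> * pairing L (ftest_sin L k) f) / of_real (sqrt L)"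
    unfolding pairing_def using L2_integrable[OF L2_ftest(1)[OF assms(2)]] L2_integrable[OF L2_ftest(2)[OF assms(2)]]
    by (simp del: mult_scaleR_right)
  finally show ?thesis .
qed

lemma fcoef_weak_deriv:
  assumes "0 < L" "has_weak_deriv L f g"
  shows "fcoef L k g = \<i> * freq L k * fcoef L k f"
proof -
  have fg: "f \<in> L2_space L" "g \<in> L2_space L" using assms(2) by (auto simp: has_weak_deriv_def)
  have "pairing L (deriv (ftest_cos L k)) f = - pairing L (ftest_cos L k) g"
    "pairing L (deriv (ftest_sin L k)) f = - pairing L (ftest_sin L k) g"
    using assms(2) test_function_ftest[OF assms(1)] by (auto simp: has_weak_deriv_def)
  then have "pairing L (ftest_cos L k) g = freq L k *\<^sub>R pairing L (ftest_sin L k) f"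
    "pairing L (ftest_sin L k) g = - (freq L k *\<^sub>R pairing L (ftest_cos L k) f)"
    unfolding deriv_ftest pairing_scale by simp_all
  then show ?thesis
    by (simp add: fcoef_eq_pairing[OF assms(1)] fg scaleR_conv_of_real algebra_simps)
qed

lemma pairing_of_real: "pairing L \<phi> (\<lambda>x. complex_of_real (f x)) = of_real (pairing L \<phi> f)"
  unfolding pairing_def integral_complex_of_real[symmetric] by (simp add: scaleR_conv_of_real)

lemma has_weak_deriv_of_real:
  "has_weak_deriv L f g \<Longrightarrow> has_weak_deriv L (\<lambda>x. complex_of_real (f x)) (\<lambda>x. of_real (g x))"
  unfolding has_weak_deriv_def
  by (intro conjI allI impI; elim conjE; (rule L2_bounded_linear[OF bounded_linear_of_real], assumption)?)
    (simp add: pairing_of_real)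

lemma test_function_continuous:
  "test_function L \<phi> \<Longrightarrow> continuous_on UNIV ((deriv ^^ n) \<phi>)"
  by (auto simp: test_function_def intro: differentiable_imp_continuous_on)

lemma integrable_continuous_pairing:
  fixes f :: "real \<Rightarrow> 'a::euclidean_space"
  assumes "continuous_on UNIV \<phi>" "f \<in> L2_space L"
  shows "integrable (interval_measure0 L) (\<lambda>x. \<phi> x *\<^sub>R f x)"
proof -
  have "compact (\<phi> ` {0..L})" by (intro compact_continuous_image continuous_on_subset[OF assms(1)]) auto
  then obtain C where "\<And>x. x \<in> {0..L} \<Longrightarrow> norm (\<phi> x) \<le> C"
    using compact_imp_bounded bounded_iff by (metis imageI)
  moreover have "\<phi> \<in> borel_measurable (interval_measure0 L)"
    by (intro continuous_imp_measurable_on_sets_lebesgue continuous_on_subset[OF assms(1)]) auto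
  ultimately show ?thesis
    by (intro L2_integrable L2_bounded_mult[OF assms(2), of _ C]) (auto intro!: AE_I2)
qed

lemma has_weak_deriv_diff:
  fixes f g :: "real \<Rightarrow> 'a::euclidean_space"
  assumes "has_weak_deriv L f f'" "has_weak_deriv L g g'"
  shows "has_weak_deriv L (\<lambda>x. f x - g x) (\<lambda>x. f' x - g' x)"
proof -
  have L: "f \<in> L2_space L" "g \<in> L2_space L" "f' \<in> L2_space L" "g' \<in> L2_space L"
    using assms by (auto simp: has_weak_deriv_def)
  have "pairing L (deriv \<phi>) (\<lambda>x. f x - g x) = - pairing L \<phi> (\<lambda>x. f' x - g' x)" if t: "test_function L \<phi>" for \<phi>
  proof -
    note c = test_function_continuous[OF t, of 0, simplified] test_function_continuous[OF t, of 1, simplified]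
    have "pairing L (deriv \<phi>) f = - pairing L \<phi> f'" "pairing L (deriv \<phi>) g = - pairing L \<phi> g'"
      using assms t by (auto simp: has_weak_deriv_def)
    then show ?thesis
      using integrable_continuous_pairing[OF c(1) L(3)] integrable_continuous_pairing[OF c(1) L(4)]
        integrable_continuous_pairing[OF c(2) L(1)] integrable_continuous_pairing[OF c(2) L(2)]
      by (simp add: pairing_def scaleR_diff_right)
  qed
  then show ?thesis using L by (auto simp: has_weak_deriv_def intro: L2_diff)
qed

lemma H1_L2: "f \<in> H1_space L \<Longrightarrow> f \<in> L2_space L"
  by (auto simp: H1_space_def has_weak_deriv_def)

lemma H1_diff: "f \<in> H1_space L \<Longrightarrow> g \<in> H1_space L \<Longrightarrow> (\<lambda>x. f x - g x) \<in> H1_space L"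
  unfolding H1_space_def using has_weak_deriv_diff by blast

lemma H1_of_real: "f \<in> H1_space L \<Longrightarrow> (\<lambda>x. complex_of_real (f x)) \<in> H1_space L"
  unfolding H1_space_def using has_weak_deriv_of_real by blast

lemma has_weak_deriv_weak_deriv: "f \<in> H1_space L \<Longrightarrow> has_weak_deriv L f (weak_deriv L f)"
  unfolding weak_deriv_def by (rule someI_ex[where P="has_weak_deriv L f"]) (simp add: H1_space_def)

text \<open>Two weak derivatives of the same function have the same Fourier coefficients, hence agree
  almost everywhere; so the norm does not depend on the choice made in \<open>weak_deriv\<close>.\<close>

lemma h1_norm_eq:
  fixes f :: "real \<Rightarrow> complex"
  assumes "0 < L" "has_weak_deriv L f g"
  shows "h1_norm L f = sqrt ((l2_norm L f)\<^sup>2 + (l2_norm L g)\<^sup>2)"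
proof -
  have "f \<in> H1_space L" using assms(2) by (auto simp: H1_space_def)
  note w = has_weak_deriv_weak_deriv[OF this]
  have L: "g \<in> L2_space L" "weak_deriv L f \<in> L2_space L" using w assms(2) by (auto simp: has_weak_deriv_def)
  have "AE x in interval_measure0 L. weak_deriv L f x = g x"
    by (rule fcoef_unique[OF assms(1) L(2,1)]) (simp add: fcoef_weak_deriv[OF assms(1) w] fcoef_weak_deriv[OF assms])
  from l2_norm_cong_AE[OF L(2,1)[THEN L2_measurable] this] show ?thesis by (simp add: h1_norm_def)
qed

lemma h1_norm_of_real:
  assumes "0 < L" "f \<in> H1_space L"
  shows "h1_norm L (\<lambda>x. complex_of_real (f x)) = h1_norm L f"
  using h1_norm_eq[OF assms(1) has_weak_deriv_of_real[OF has_weak_deriv_weak_deriv[OF assms(2)]]]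
  by (simp add: h1_norm_def)

lemma h1_norm_nonneg [simp]: "0 \<le> h1_norm L f"
  by (simp add: h1_norm_def)

lemma l2_norm_le_h1_norm: "l2_norm L f \<le> h1_norm L f"
  unfolding h1_norm_def by (rule real_le_rsqrt) simp

lemma h1_norm_triangle_abs:
  fixes f g :: "real \<Rightarrow> complex"
  assumes "0 < L" "f \<in> H1_space L" "g \<in> H1_space L"
  shows "\<bar>h1_norm L f - h1_norm L g\<bar> \<le> h1_norm L (\<lambda>x. f x - g x)"
proof -
  have *: "h1_norm L f \<le> h1_norm L g + h1_norm L (\<lambda>x. f x - g x)" if "f \<in> H1_space L" "g \<in> H1_space L" for f g :: "real \<Rightarrow> complex"
  proof -
    note w = that[THEN has_weak_deriv_weak_deriv]
    have L: "f \<in> L2_space L" "g \<in> L2_space L" "weak_deriv L f \<in> L2_space L" "weak_deriv L g \<in> L2_space L"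
      using w by (auto simp: has_weak_deriv_def)
    let ?a = "l2_norm L g" and ?b = "l2_norm L (weak_deriv L g)"
    let ?c = "l2_norm L (\<lambda>x. f x - g x)" and ?d = "l2_norm L (\<lambda>x. weak_deriv L f x - weak_deriv L g x)"
    have "l2_norm L f \<le> ?a + ?c" "l2_norm L (weak_deriv L f) \<le> ?b + ?d"
      using l2_norm_triangle_abs[OF L(1,2)] l2_norm_triangle_abs[OF L(3,4)] by linarith+
    then have "h1_norm L f \<le> sqrt ((?a + ?c)\<^sup>2 + (?b + ?d)\<^sup>2)"
      unfolding h1_norm_def by (intro real_sqrt_le_mono add_mono power_mono) auto
    also have "\<dots> \<le> sqrt (?a\<^sup>2 + ?b\<^sup>2) + sqrt (?c\<^sup>2 + ?d\<^sup>2)" by (rule real_sqrt_sum_squares_triangle_ineq)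
    also have "\<dots> = h1_norm L g + h1_norm L (\<lambda>x. f x - g x)"
      unfolding h1_norm_eq[OF assms(1) has_weak_deriv_diff[OF w]] by (simp add: h1_norm_def)
    finally show ?thesis .
  qed
  have "h1_norm L (\<lambda>x. g x - f x) = h1_norm L (\<lambda>x. f x - g x)"
    unfolding h1_norm_eq[OF assms(1) has_weak_deriv_diff[OF assms(2,3)[THEN has_weak_deriv_weak_deriv]]]
      h1_norm_eq[OF assms(1) has_weak_deriv_diff[OF assms(3,2)[THEN has_weak_deriv_weak_deriv]]]
    by (simp add: l2_norm_minus_commute[of L g f] l2_norm_minus_commute[of L "weak_deriv L g" "weak_deriv L f"])
  then show ?thesis using *[OF assms(2,3)] *[OF assms(3,2)] by linarith
qed

lemma h1_norm_triangle_abs_real: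
  fixes f g :: "real \<Rightarrow> real"
  assumes "0 < L" "f \<in> H1_space L" "g \<in> H1_space L"
  shows "\<bar>h1_norm L f - h1_norm L g\<bar> \<le> h1_norm L (\<lambda>x. f x - g x)"
  using h1_norm_triangle_abs[OF assms(1) assms(2,3)[THEN H1_of_real]]
  by (simp add: h1_norm_of_real assms H1_diff flip: of_real_diff)

lemma H1_zero: "(\<lambda>x. 0 :: 'a::euclidean_space) \<in> H1_space L"
  by (auto simp: H1_space_def has_weak_deriv_def pairing_def L2_zero intro!: exI[of _ "\<lambda>x. 0"])

lemma h1_norm_zero: "0 < L \<Longrightarrow> h1_norm L (\<lambda>x. 0 :: complex) = 0"
  using h1_norm_eq[of L "\<lambda>x. 0" "\<lambda>x. 0"] by (simp add: has_weak_deriv_def pairing_def L2_zero l2_norm_def)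

lemma h1_norm_zero_real: "0 < L \<Longrightarrow> h1_norm L (\<lambda>x. 0 :: real) = 0"
  using h1_norm_of_real[OF _ H1_zero] h1_norm_zero by simp

subsection \<open>Sobolev embedding\<close>

lemma sum_freq_bounded:
  assumes "0 < L"
  obtains S where "\<And>N. (\<Sum>k\<in>{-int N..int N}. 1 / (1 + (freq L k)\<^sup>2)) \<le> S"
proof -
  define a where "a = 2 * pi / L"
  have a: "0 < a" using assms by (simp add: a_def)
  define b where "b n = 2 / a\<^sup>2 * (1 / (real (Suc n))\<^sup>2)" for n
  have sm: "summable b"
  proof -
    have "summable (\<lambda>n. inverse ((real (Suc n))\<^sup>2))"
      using inverse_power_summable[of 2, where 'a=real] by (subst summable_Suc_iff) simp
    then show ?thesis unfolding b_def by (intro summable_mult) (simp add: divide_inverse)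
  qed
  have step: "(\<Sum>k\<in>{-int N..int N}. 1 / (1 + (freq L k)\<^sup>2)) \<le> 1 + (\<Sum>n<N. b n)" for N
  proof (induction N)
    case 0
    show ?case by (simp add: freq_def)
  next
    case (Suc N)
    have set: "{-int (Suc N)..int (Suc N)} = insert (int (Suc N)) (insert (- int (Suc N)) {-int N..int N})" by auto
    have "1 / (1 + (freq L (int (Suc N)))\<^sup>2) \<le> 1 / (a\<^sup>2 * (real (Suc N))\<^sup>2)"
    proof -
      have fr: "freq L (int (Suc N)) = a * real (Suc N)" by (simp add: freq_def a_def)
      have "0 < a\<^sup>2 * (real (Suc N))\<^sup>2" using a by simp
      then show ?thesis unfolding fr power_mult_distrib by (intro divide_left_mono mult_pos_pos) auto
    qed
    moreover have "freq L (- int (Suc N)) = - freq L (int (Suc N))"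
      by (simp only: freq_def of_int_minus mult_minus_right minus_divide_left)
    ultimately show ?case using Suc.IH unfolding set
      by (subst sum.insert, simp, simp, subst sum.insert) (auto simp: b_def)
  qed
  have le: "(\<Sum>n<N. b n) \<le> suminf b" for N
    by (rule sum_le_suminf[OF sm]) (auto simp: b_def)
  have "(\<Sum>k\<in>{-int N..int N}. 1 / (1 + (freq L k)\<^sup>2)) \<le> 1 + suminf b" for N
    using step[of N] le[of N] by linarith
  then show ?thesis using that by blast
qed

text \<open>By the Cauchy--Schwarz inequality with weights \<open>1 + freq^2\<close>, the partial sums of the Fourier
  series are bounded uniformly by the \<open>H^1\<close> norm, and a subsequence converges almost everywhere.\<close>

lemma Sobolev_embedding:
  assumes L: "0 < L"
  obtains C where "0 \<le> C" "\<And>f :: real \<Rightarrow> complex. f \<in> H1_space L \<Longrightarrow> AE x in interval_measure0 L. norm (f x) \<le> C * h1_norm L f"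
proof -
  obtain S where S: "\<And>N. (\<Sum>k\<in>{-int N..int N}. 1 / (1 + (freq L k)\<^sup>2)) \<le> S" using sum_freq_bounded[OF L] by blast
  define C where "C = sqrt S / sqrt L"
  have "0 \<le> S" using S[of 0] by (simp add: freq_def)
  then have C0: "0 \<le> C" using L by (simp add: C_def)
  have "AE x in interval_measure0 L. norm (f x) \<le> C * h1_norm L f" if f: "f \<in> H1_space L" for f :: "real \<Rightarrow> complex"
  proof -
    note w = has_weak_deriv_weak_deriv[OF f]
    have L2: "f \<in> L2_space L" "weak_deriv L f \<in> L2_space L" using w by (auto simp: has_weak_deriv_def)
    have P: "norm (fproj L N f x) \<le> C * h1_norm L f" for N x
    proof -
      let ?K = "{-int N..int N}"
      let ?s = "\<lambda>k. sqrt (1 + (freq L k)\<^sup>2)"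
      have sp: "0 < 1 + (freq L k)\<^sup>2" for k by (simp add: add_pos_nonneg)
      have "norm (fproj L N f x) \<le> (\<Sum>k\<in>?K. norm (fcoef L k f)) / sqrt L"
        unfolding fproj_def by (rule order_trans[OF norm_sum]) (simp add: norm_mult norm_fmode[OF L] sum_divide_distrib)
      also have "(\<Sum>k\<in>?K. norm (fcoef L k f)) = (\<Sum>k\<in>?K. (1 / ?s k) * (?s k * norm (fcoef L k f)))"
        by (intro sum.cong refl) (use sp in \<open>auto simp: less_imp_neq[THEN not_sym]\<close>)
      also have "\<dots> \<le> sqrt (\<Sum>k\<in>?K. (1 / ?s k)\<^sup>2) * sqrt (\<Sum>k\<in>?K. (?s k * norm (fcoef L k f))\<^sup>2)"
        using Cauchy_Schwarz_ineq_sum[of "\<lambda>k. 1 / ?s k" "\<lambda>k. ?s k * norm (fcoef L k f)" ?K]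
        by (simp only: real_sqrt_mult[symmetric] real_le_rsqrt)
      also have "\<dots> \<le> sqrt S * h1_norm L f"
      proof (intro mult_mono)
        show "sqrt (\<Sum>k\<in>?K. (1 / ?s k)\<^sup>2) \<le> sqrt S"
          using S[of N] sp by (simp add: power_divide less_imp_le)
        have "(\<Sum>k\<in>?K. (?s k * norm (fcoef L k f))\<^sup>2) = (\<Sum>k\<in>?K. (norm (fcoef L k f))\<^sup>2) + (\<Sum>k\<in>?K. (norm (fcoef L k (weak_deriv L f)))\<^sup>2)"
          unfolding sum.distrib[symmetric] fcoef_weak_deriv[OF L w]
          by (intro sum.cong refl) (use sp in \<open>simp add: power_mult_distrib less_imp_le norm_mult distrib_right\<close>)
        also have "\<dots> \<le> (l2_norm L f)\<^sup>2 + (l2_norm L (weak_deriv L f))\<^sup>2"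
          by (intro add_mono Bessel L L2)
        finally show "sqrt (\<Sum>k\<in>?K. (?s k * norm (fcoef L k f))\<^sup>2) \<le> h1_norm L f"
          unfolding h1_norm_def by (rule real_sqrt_le_mono)
      qed (auto simp: sum_nonneg \<open>0 \<le> S\<close>)
      finally show ?thesis using L by (simp add: C_def divide_right_mono mult.commute)
    qed
    define d where "d n x = (norm (f x - fproj L n f x))\<^sup>2" for n x
    have int: "integrable (interval_measure0 L) (d n)" for n
      unfolding d_def using L2_sq_integrable[OF L2_diff[OF L2(1) L2_fproj[OF L]]] .
    have "(\<lambda>n. (l2_norm L (\<lambda>x. f x - fproj L n f x))\<^sup>2) \<longlonglongrightarrow> 0\<^sup>2"
      by (intro tendsto_intros fproj_tendsto L L2)
    then have "(\<lambda>n. LINT x|interval_measure0 L. norm (d n x)) \<longlonglongrightarrow> 0"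
      by (simp add: l2_norm_sq d_def)
    from tendsto_L1_AE_subseq[OF int this]
    obtain r where "AE x in interval_measure0 L. (\<lambda>n. d (r n) x) \<longlonglongrightarrow> 0" by blast
    then show ?thesis
    proof eventually_elim
      case (elim x)
      then have "(\<lambda>n. sqrt (d (r n) x)) \<longlonglongrightarrow> sqrt 0" by (intro tendsto_intros)
      then have "(\<lambda>n. norm (f x - fproj L (r n) f x)) \<longlonglongrightarrow> 0" by (simp add: d_def)
      from tendsto_diff[OF tendsto_const[of "f x"] tendsto_norm_zero_cancel[OF this]]
      have "(\<lambda>n. fproj L (r n) f x) \<longlonglongrightarrow> f x" by simp
      then show ?case using P by (intro Lim_bounded[OF tendsto_norm]) auto
    qed
  qed
  then show ?thesis using that C0 by blast
qed

subsection \<open>Measurable functionals\<close>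

lemma H1_borel_measurable_continuous:
  fixes G :: "(real \<Rightarrow> 'a::euclidean_space) \<Rightarrow> 'b::metric_space"
  assumes "\<And>f e. f \<in> H1_space L \<Longrightarrow> 0 < e \<Longrightarrow>
    \<exists>r>0. \<forall>g\<in>H1_space L. h1_norm L (\<lambda>x. g x - f x) < r \<longrightarrow> dist (G g) (G f) < e"
  shows "G \<in> H1_borel L \<rightarrow>\<^sub>M borel"
proof (rule borel_measurableI)
  fix S :: "'b set" assume S: "open S"
  let ?U = "G -` S \<inter> H1_space L"
  have sp: "space (H1_borel L) = H1_space L"
    unfolding H1_borel_def by (rule space_measure_of) auto
  have "\<forall>f\<in>?U. \<exists>r>0. \<forall>g\<in>H1_space L. h1_norm L (\<lambda>x. g x - f x) < r \<longrightarrow> g \<in> ?U"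
  proof
    fix f assume f: "f \<in> ?U"
    then obtain e where e: "0 < e" "\<And>y. dist y (G f) < e \<Longrightarrow> y \<in> S"
      using S unfolding open_dist by blast
    then show "\<exists>r>0. \<forall>g\<in>H1_space L. h1_norm L (\<lambda>x. g x - f x) < r \<longrightarrow> g \<in> ?U"
      using assms[of f e] f by blast
  qed
  then have "?U \<in> sets (H1_borel L)"
    unfolding H1_borel_def by (subst sets_measure_of) (auto intro!: sigma_sets.Basic)
  then show "G -` S \<inter> space (H1_borel L) \<in> sets (H1_borel L)" by (simp add: sp)
qed

lemma H1_borel_measurable_Lipschitz:
  fixes G :: "(real \<Rightarrow> 'a::euclidean_space) \<Rightarrow> 'b::real_normed_vector"
  assumes "\<And>f g. f \<in> H1_space L \<Longrightarrow> g \<in> H1_space L \<Longrightarrow> norm (G g - G f) \<le> h1_norm L (\<lambda>x. g x - f x)"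
  shows "G \<in> H1_borel L \<rightarrow>\<^sub>M borel"
  by (rule H1_borel_measurable_continuous) (use assms in \<open>force simp: dist_norm\<close>)

lemma space_H1_borel: "space (H1_borel L) = H1_space L"
  unfolding H1_borel_def by (rule space_measure_of) auto

lemma fcoef_H1_measurable:
  assumes "0 < L" shows "fcoef L k \<in> H1_borel L \<rightarrow>\<^sub>M borel"
proof (rule H1_borel_measurable_Lipschitz)
  fix f g :: "real \<Rightarrow> complex" assume fg: "f \<in> H1_space L" "g \<in> H1_space L"
  then show "norm (fcoef L k g - fcoef L k f) \<le> h1_norm L (\<lambda>x. g x - f x)"
    unfolding fcoef_diff[OF assms H1_L2[OF fg(2)] H1_L2[OF fg(1)], symmetric]
    by (intro order_trans[OF norm_fcoef_le l2_norm_le_h1_norm] assms L2_diff H1_L2)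
qed

lemma fcoef_of_real_H1_measurable:
  assumes "0 < L" shows "(\<lambda>f. fcoef L k (\<lambda>x. of_real (f x))) \<in> H1_borel L \<rightarrow>\<^sub>M borel"
proof (rule H1_borel_measurable_Lipschitz)
  fix f g :: "real \<Rightarrow> real" assume fg: "f \<in> H1_space L" "g \<in> H1_space L"
  note fg' = fg[THEN H1_of_real]
  have "norm (fcoef L k (\<lambda>x. of_real (g x)) - fcoef L k (\<lambda>x. of_real (f x))) \<le> l2_norm L (\<lambda>x. complex_of_real (g x) - of_real (f x))"
    unfolding fcoef_diff[OF assms H1_L2[OF fg'(2)] H1_L2[OF fg'(1)], symmetric]
    by (intro norm_fcoef_le assms L2_diff H1_L2 fg')
  also have "\<dots> \<le> h1_norm L (\<lambda>x. g x - f x)"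
    using l2_norm_le_h1_norm[of L "\<lambda>x. g x - f x"] by (simp flip: of_real_diff)
  finally show "norm (fcoef L k (\<lambda>x. of_real (g x)) - fcoef L k (\<lambda>x. of_real (f x))) \<le> h1_norm L (\<lambda>x. g x - f x)" .
qed

lemma h1_norm_measurable:
  assumes "0 < L" shows "(h1_norm L :: (real \<Rightarrow> complex) \<Rightarrow> real) \<in> H1_borel L \<rightarrow>\<^sub>M borel"
  by (rule H1_borel_measurable_Lipschitz) (use h1_norm_triangle_abs[OF assms] in auto)

lemma h1_norm_measurable_real:
  assumes "0 < L" shows "(h1_norm L :: (real \<Rightarrow> real) \<Rightarrow> real) \<in> H1_borel L \<rightarrow>\<^sub>M borel"
  by (rule H1_borel_measurable_Lipschitz) (use h1_norm_triangle_abs_real[OF assms] in auto)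

lemma l2_norm_measurable:
  "(l2_norm L :: (real \<Rightarrow> complex) \<Rightarrow> real) \<in> H1_borel L \<rightarrow>\<^sub>M borel"
proof (rule H1_borel_measurable_Lipschitz)
  fix f g :: "real \<Rightarrow> complex" assume f: "f \<in> H1_space L" and g: "g \<in> H1_space L"
  show "norm (l2_norm L g - l2_norm L f) \<le> h1_norm L (\<lambda>x. g x - f x)"
    unfolding real_norm_def
    by (rule order_trans[OF l2_norm_triangle_abs[OF H1_L2[OF g] H1_L2[OF f]] l2_norm_le_h1_norm])
qed

section \<open>The nonlinear term\<close>

lemma borel_measurable_cnj [measurable (raw)]:
  "f \<in> borel_measurable M \<Longrightarrow> (\<lambda>x. cnj (f x)) \<in> borel_measurable M"
  by (rule borel_measurable_continuous_on[where f=cnj]) (intro continuous_intros)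

definition nonlin :: "real \<Rightarrow> real \<Rightarrow> (real \<Rightarrow> complex) \<Rightarrow> (real \<Rightarrow> real) \<Rightarrow> real \<Rightarrow> complex" where
  "nonlin \<gamma> \<beta> u v x = of_real (\<gamma> * v x + \<beta> * (cmod (u x))\<^sup>2) * u x"

text \<open>\<open>C\<close> is an embedding constant of \<open>H^1\<close> into the bounded functions.\<close>

locale sobolev_constant =
  fixes L C :: real
  assumes L: "0 < L" and C: "0 \<le> C"
    and Sobolev: "\<And>f :: real \<Rightarrow> complex. f \<in> H1_space L \<Longrightarrow> AE x in interval_measure0 L. norm (f x) \<le> C * h1_norm L f"
begin

lemma Sobolev_real:
  fixes f :: "real \<Rightarrow> real"
  assumes "f \<in> H1_space L" shows "AE x in interval_measure0 L. \<bar>f x\<bar> \<le> C * h1_norm L f"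
  using Sobolev[OF H1_of_real[OF assms]] by (simp add: h1_norm_of_real[OF L assms])

lemma nonlin_measurable:
  assumes "u \<in> H1_space L" "v \<in> H1_space L"
  shows "nonlin \<gamma> \<beta> u v \<in> borel_measurable (interval_measure0 L)"
proof -
  note [measurable] = assms[THEN H1_L2, THEN L2_measurable]
  show ?thesis unfolding nonlin_def[abs_def] by measurable
qed

lemma
  assumes u: "u \<in> H1_space L" and v: "v \<in> H1_space L"
  shows L2_nonlin: "nonlin \<gamma> \<beta> u v \<in> L2_space L"
    and l2_norm_nonlin: "l2_norm L (nonlin \<gamma> \<beta> u v) \<le> (\<bar>\<gamma>\<bar> * C * h1_norm L v + \<bar>\<beta>\<bar> * (C * h1_norm L u)\<^sup>2) * l2_norm L u"
proof -
  let ?A = "\<bar>\<gamma>\<bar> * C * h1_norm L v + \<bar>\<beta>\<bar> * (C * h1_norm L u)\<^sup>2"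
  have b: "AE x in interval_measure0 L. norm (nonlin \<gamma> \<beta> u v x) \<le> ?A * norm (u x)"
    using Sobolev[OF u] Sobolev_real[OF v]
  proof eventually_elim
    case (elim x)
    have "\<bar>\<gamma> * v x + \<beta> * (cmod (u x))\<^sup>2\<bar> \<le> \<bar>\<gamma>\<bar> * \<bar>v x\<bar> + \<bar>\<beta>\<bar> * (cmod (u x))\<^sup>2"
      by (rule order_trans[OF abs_triangle_ineq]) (simp add: abs_mult)
    also have "\<dots> \<le> \<bar>\<gamma>\<bar> * (C * h1_norm L v) + \<bar>\<beta>\<bar> * (C * h1_norm L u)\<^sup>2"
      using elim by (intro add_mono mult_left_mono power_mono) auto
    finally show ?case
      unfolding nonlin_def norm_mult norm_of_real by (intro mult_right_mono) (auto simp: mult.assoc)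
  qed
  show "nonlin \<gamma> \<beta> u v \<in> L2_space L"
    by (rule L2_boundI[OF H1_L2[OF u] nonlin_measurable[OF u v] b])
  show "l2_norm L (nonlin \<gamma> \<beta> u v) \<le> ?A * l2_norm L u"
    by (rule l2_norm_bound[OF H1_L2[OF u] nonlin_measurable[OF u v] b]) (use C in auto)
qed

text \<open>The nonlinearity is Lipschitz on bounded sets of \<open>H^1\<close>.  This makes its Fourier coefficients
  continuous in time and, for the cubic part, measurable.\<close>

lemma l2_norm_nonlin_diff:
  assumes H: "u \<in> H1_space L" "u' \<in> H1_space L" "v \<in> H1_space L" "v' \<in> H1_space L"
    and R: "h1_norm L u \<le> R" "h1_norm L u' \<le> R" "h1_norm L v \<le> R" "h1_norm L v' \<le> R"
  shows "l2_norm L (\<lambda>x. nonlin \<gamma> \<beta> u v x - nonlin \<gamma> \<beta> u' v' x)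
    \<le> (\<bar>\<gamma>\<bar> * (C * R) + 3 * \<bar>\<beta>\<bar> * (C * R)\<^sup>2) * (l2_norm L (\<lambda>x. u x - u' x) + l2_norm L (\<lambda>x. v x - v' x))"
proof -
  let ?r = "C * R"
  let ?K = "\<bar>\<gamma>\<bar> * ?r + 3 * \<bar>\<beta>\<bar> * ?r\<^sup>2"
  let ?g = "\<lambda>x. cmod (u x - u' x) + \<bar>v x - v' x\<bar>"
  have R0: "0 \<le> R" using R(1) h1_norm_nonneg[of L u] by linarith
  note H2 = H[THEN H1_L2]
  note [measurable] = H2[THEN L2_measurable]
  have d: "(\<lambda>x. cmod (u x - u' x)) \<in> L2_space L" "(\<lambda>x. \<bar>v x - v' x\<bar>) \<in> L2_space L"
    by (rule L2_boundI[OF L2_diff[OF H2(1,2)], of _ 1]; simp) (rule L2_boundI[OF L2_diff[OF H2(3,4)], of _ 1]; simp)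
  have CR: "C * h \<le> ?r" if "h \<le> R" for h using that C by (rule mult_left_mono)
  have "l2_norm L (\<lambda>x. nonlin \<gamma> \<beta> u v x - nonlin \<gamma> \<beta> u' v' x) \<le> ?K * l2_norm L ?g"
  proof (rule l2_norm_bound)
    show "?g \<in> L2_space L" by (rule L2_add[OF d])
    show "(\<lambda>x. nonlin \<gamma> \<beta> u v x - nonlin \<gamma> \<beta> u' v' x) \<in> borel_measurable (interval_measure0 L)"
      by (intro borel_measurable_diff nonlin_measurable H)
    show "AE x in interval_measure0 L. norm (nonlin \<gamma> \<beta> u v x - nonlin \<gamma> \<beta> u' v' x) \<le> ?K * norm (?g x)"
      using Sobolev[OF H(1)] Sobolev[OF H(2)] Sobolev_real[OF H(3)] Sobolev_real[OF H(4)]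
    proof eventually_elim
      case (elim x)
      define a b where "a = u x" and "b = u' x"
      have b4: "cmod a \<le> ?r" "cmod b \<le> ?r" "\<bar>v x\<bar> \<le> ?r" "\<bar>v' x\<bar> \<le> ?r"
        using elim CR[OF R(1)] CR[OF R(2)] CR[OF R(3)] CR[OF R(4)] unfolding a_def b_def by linarith+
      have r0: "0 \<le> ?r" using C R0 by simp
      have eq: "nonlin \<gamma> \<beta> u v x - nonlin \<gamma> \<beta> u' v' x =
        of_real \<gamma> * (of_real (v x - v' x) * a + of_real (v' x) * (a - b))
        + of_real \<beta> * (of_real ((cmod a)\<^sup>2) * (a - b) + of_real ((cmod a)\<^sup>2 - (cmod b)\<^sup>2) * b)"
        unfolding nonlin_def a_def b_def by (simp add: algebra_simps)
      have t1: "cmod (of_real (v x - v' x) * a + of_real (v' x) * (a - b)) \<le> ?r * ?g x"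
      proof -
        have "cmod (of_real (v x - v' x) * a + of_real (v' x) * (a - b)) \<le> \<bar>v x - v' x\<bar> * cmod a + \<bar>v' x\<bar> * cmod (a - b)"
          by (rule order_trans[OF norm_triangle_ineq]) (simp only: norm_mult norm_of_real order_refl)
        also have "\<dots> \<le> \<bar>v x - v' x\<bar> * ?r + ?r * cmod (a - b)"
          by (intro add_mono mult_left_mono mult_right_mono b4) auto
        finally show ?thesis by (simp add: a_def b_def algebra_simps)
      qed
      have t2: "cmod (of_real ((cmod a)\<^sup>2) * (a - b) + of_real ((cmod a)\<^sup>2 - (cmod b)\<^sup>2) * b) \<le> 3 * ?r\<^sup>2 * cmod (a - b)"
      proof -
        have "\<bar>(cmod a)\<^sup>2 - (cmod b)\<^sup>2\<bar> = \<bar>cmod a - cmod b\<bar> * (cmod a + cmod b)"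
          by (simp add: power2_eq_square square_diff_square_factored abs_mult mult.commute)
        also have "\<dots> \<le> cmod (a - b) * (2 * ?r)"
          using b4 by (intro mult_mono norm_triangle_ineq3) auto
        finally have sq: "\<bar>(cmod a)\<^sup>2 - (cmod b)\<^sup>2\<bar> \<le> cmod (a - b) * (2 * ?r)" .
        have "cmod (of_real ((cmod a)\<^sup>2) * (a - b) + of_real ((cmod a)\<^sup>2 - (cmod b)\<^sup>2) * b)
            \<le> \<bar>(cmod a)\<^sup>2\<bar> * cmod (a - b) + \<bar>(cmod a)\<^sup>2 - (cmod b)\<^sup>2\<bar> * cmod b"
          by (rule order_trans[OF norm_triangle_ineq]) (simp only: norm_mult norm_of_real order_refl)
        also have "\<dots> \<le> ?r\<^sup>2 * cmod (a - b) + (cmod (a - b) * (2 * ?r)) * ?r"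
          using b4 sq r0 by (intro add_mono mult_mono) (auto intro: power_mono)
        finally show ?thesis by (simp add: power2_eq_square algebra_simps)
      qed
      have "norm (nonlin \<gamma> \<beta> u v x - nonlin \<gamma> \<beta> u' v' x) \<le> \<bar>\<gamma>\<bar> * (?r * ?g x) + \<bar>\<beta>\<bar> * (3 * ?r\<^sup>2 * cmod (a - b))"
        unfolding eq by (rule order_trans[OF norm_triangle_ineq])
          (unfold norm_mult norm_of_real, intro add_mono mult_left_mono t1 t2; simp)
      also have "\<dots> \<le> \<bar>\<gamma>\<bar> * (?r * ?g x) + \<bar>\<beta>\<bar> * (3 * ?r\<^sup>2 * ?g x)"
        by (intro add_left_mono mult_left_mono) (auto simp: a_def b_def)
      also have "\<dots> = ?K * ?g x" by (simp add: algebra_simps)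
      finally show ?case by simp
    qed
    show "0 \<le> ?K" using C R0 by simp
  qed
  also have "l2_norm L ?g \<le> l2_norm L (\<lambda>x. cmod (u x - u' x)) + l2_norm L (\<lambda>x. \<bar>v x - v' x\<bar>)"
    by (rule l2_norm_triangle[OF d])
  also have "\<dots> = l2_norm L (\<lambda>x. u x - u' x) + l2_norm L (\<lambda>x. v x - v' x)"
    by (simp add: l2_norm_def)
  finally show ?thesis using C R0 by (simp add: mult_left_mono)
qed

lemma norm_fcoef_nonlin_diff:
  assumes H: "u \<in> H1_space L" "u' \<in> H1_space L" "v \<in> H1_space L" "v' \<in> H1_space L"
    and R: "h1_norm L u \<le> R" "h1_norm L u' \<le> R" "h1_norm L v \<le> R" "h1_norm L v' \<le> R"
  shows "norm (fcoef L k (nonlin \<gamma> \<beta> u v) - fcoef L k (nonlin \<gamma> \<beta> u' v'))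
    \<le> (\<bar>\<gamma>\<bar> * (C * R) + 3 * \<bar>\<beta>\<bar> * (C * R)\<^sup>2) * (h1_norm L (\<lambda>x. u x - u' x) + h1_norm L (\<lambda>x. v x - v' x))"
proof -
  have R0: "0 \<le> R" using R(1) h1_norm_nonneg[of L u] by linarith
  have "norm (fcoef L k (nonlin \<gamma> \<beta> u v) - fcoef L k (nonlin \<gamma> \<beta> u' v')) \<le> l2_norm L (\<lambda>x. nonlin \<gamma> \<beta> u v x - nonlin \<gamma> \<beta> u' v' x)"
    unfolding fcoef_diff[OF L L2_nonlin[OF H(1,3)] L2_nonlin[OF H(2,4)], symmetric]
    by (intro norm_fcoef_le L L2_diff L2_nonlin H)
  also note l2_norm_nonlin_diff[OF H R]
  also have "(\<bar>\<gamma>\<bar> * (C * R) + 3 * \<bar>\<beta>\<bar> * (C * R)\<^sup>2) * (l2_norm L (\<lambda>x. u x - u' x) + l2_norm L (\<lambda>x. v x - v' x))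
    \<le> (\<bar>\<gamma>\<bar> * (C * R) + 3 * \<bar>\<beta>\<bar> * (C * R)\<^sup>2) * (h1_norm L (\<lambda>x. u x - u' x) + h1_norm L (\<lambda>x. v x - v' x))"
    using C R0 by (intro mult_left_mono add_mono l2_norm_le_h1_norm) auto
  finally show ?thesis .
qed

lemma continuous_on_h1_bound:
  fixes G :: "real \<Rightarrow> 'b::real_normed_vector"
  assumes "\<And>s. s \<in> A \<Longrightarrow> (e s \<longlongrightarrow> (0::real)) (at s within A)"
    and "\<And>s. s \<in> A \<Longrightarrow> \<forall>\<^sub>F t in at s within A. norm (G t - G s) \<le> K s * e s t"
  shows "continuous_on A G"
  unfolding continuous_on_def
proof
  fix s assume s: "s \<in> A"
  have "((\<lambda>t. K s * e s t) \<longlongrightarrow> K s * 0) (at s within A)" by (intro tendsto_intros assms s)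
  then have "((\<lambda>t. G t - G s) \<longlongrightarrow> 0) (at s within A)"
    by (intro Lim_null_comparison[OF assms(2)[OF s]]) simp
  then show "(G \<longlongrightarrow> G s) (at s within A)" by (rule LIM_zero_cancel)
qed

lemma continuous_on_h1_norm:
  fixes f :: "real \<Rightarrow> real \<Rightarrow> complex"
  assumes "\<And>t. t \<in> A \<Longrightarrow> f t \<in> H1_space L"
    and "\<And>s. s \<in> A \<Longrightarrow> ((\<lambda>t. h1_norm L (\<lambda>x. f t x - f s x)) \<longlongrightarrow> 0) (at s within A)"
  shows "continuous_on A (\<lambda>t. h1_norm L (f t))"
  by (rule continuous_on_h1_bound[where K="\<lambda>s. 1", OF assms(2)])
    (use h1_norm_triangle_abs[OF L] assms(1) in \<open>auto simp: eventually_at_filter\<close>)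

lemma continuous_on_h1_norm_real:
  fixes f :: "real \<Rightarrow> real \<Rightarrow> real"
  assumes "\<And>t. t \<in> A \<Longrightarrow> f t \<in> H1_space L"
    and "\<And>s. s \<in> A \<Longrightarrow> ((\<lambda>t. h1_norm L (\<lambda>x. f t x - f s x)) \<longlongrightarrow> 0) (at s within A)"
  shows "continuous_on A (\<lambda>t. h1_norm L (f t))"
  by (rule continuous_on_h1_bound[where K="\<lambda>s. 1", OF assms(2)])
    (use h1_norm_triangle_abs_real[OF L] assms(1) in \<open>auto simp: eventually_at_filter\<close>)

lemma continuous_on_fcoef:
  fixes f :: "real \<Rightarrow> real \<Rightarrow> complex"
  assumes "\<And>t. t \<in> A \<Longrightarrow> f t \<in> H1_space L"
    and "\<And>s. s \<in> A \<Longrightarrow> ((\<lambda>t. h1_norm L (\<lambda>x. f t x - f s x)) \<longlongrightarrow> 0) (at s within A)"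
  shows "continuous_on A (\<lambda>t. fcoef L k (f t))"
proof (rule continuous_on_h1_bound[where K="\<lambda>s. 1", OF assms(2)])
  fix s assume s: "s \<in> A"
  have "norm (fcoef L k (f t) - fcoef L k (f s)) \<le> h1_norm L (\<lambda>x. f t x - f s x)" if "t \<in> A" for t
    unfolding fcoef_diff[OF L H1_L2[OF assms(1)[OF that]] H1_L2[OF assms(1)[OF s]], symmetric]
    by (intro order_trans[OF norm_fcoef_le l2_norm_le_h1_norm] L L2_diff H1_L2 assms(1) s that)
  then show "\<forall>\<^sub>F t in at s within A. norm (fcoef L k (f t) - fcoef L k (f s)) \<le> 1 * h1_norm L (\<lambda>x. f t x - f s x)"
    by (simp add: eventually_at_filter)
qed

lemma continuous_on_fcoef_nonlin:
  fixes u :: "real \<Rightarrow> real \<Rightarrow> complex" and v :: "real \<Rightarrow> real \<Rightarrow> real"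
  assumes u: "\<And>t. t \<in> A \<Longrightarrow> u t \<in> H1_space L" and v: "\<And>t. t \<in> A \<Longrightarrow> v t \<in> H1_space L"
    and uc: "\<And>s. s \<in> A \<Longrightarrow> ((\<lambda>t. h1_norm L (\<lambda>x. u t x - u s x)) \<longlongrightarrow> 0) (at s within A)"
    and vc: "\<And>s. s \<in> A \<Longrightarrow> ((\<lambda>t. h1_norm L (\<lambda>x. v t x - v s x)) \<longlongrightarrow> 0) (at s within A)"
  shows "continuous_on A (\<lambda>t. fcoef L k (nonlin \<gamma> \<beta> (u t) (v t)))"
proof (rule continuous_on_h1_bound[where
      e="\<lambda>s t. h1_norm L (\<lambda>x. u t x - u s x) + h1_norm L (\<lambda>x. v t x - v s x)"])
  fix s assume s: "s \<in> A"
  let ?R = "h1_norm L (u s) + h1_norm L (v s) + 1"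
  show "((\<lambda>t. h1_norm L (\<lambda>x. u t x - u s x) + h1_norm L (\<lambda>x. v t x - v s x)) \<longlongrightarrow> 0) (at s within A)"
    using tendsto_add[OF uc[OF s] vc[OF s]] by simp
  have cu: "((\<lambda>t. h1_norm L (u t)) \<longlongrightarrow> h1_norm L (u s)) (at s within A)"
    using continuous_on_h1_norm[OF u uc] s by (simp add: continuous_on_def)
  have cv: "((\<lambda>t. h1_norm L (v t)) \<longlongrightarrow> h1_norm L (v s)) (at s within A)"
    using continuous_on_h1_norm_real[OF v vc] s by (simp add: continuous_on_def)
  have "h1_norm L (u s) < ?R" "h1_norm L (v s) < ?R"
    using h1_norm_nonneg[of L "u s"] h1_norm_nonneg[of L "v s"] by linarith+
  then have "\<forall>\<^sub>F t in at s within A. h1_norm L (u t) < ?R" "\<forall>\<^sub>F t in at s within A. h1_norm L (v t) < ?R"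
    using order_tendstoD(2)[OF cu] order_tendstoD(2)[OF cv] by auto
  moreover have "\<forall>\<^sub>F t in at s within A. t \<in> A" by (simp add: eventually_at_filter)
  ultimately show "\<forall>\<^sub>F t in at s within A. norm (fcoef L k (nonlin \<gamma> \<beta> (u t) (v t)) - fcoef L k (nonlin \<gamma> \<beta> (u s) (v s)))
      \<le> (\<bar>\<gamma>\<bar> * (C * ?R) + 3 * \<bar>\<beta>\<bar> * (C * ?R)\<^sup>2) * (h1_norm L (\<lambda>x. u t x - u s x) + h1_norm L (\<lambda>x. v t x - v s x))"
  proof eventually_elim
    case (elim t)
    then show ?case
      using \<open>h1_norm L (u s) < ?R\<close> \<open>h1_norm L (v s) < ?R\<close>
      by (intro norm_fcoef_nonlin_diff u v s) auto
  qed
qed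

lemma fcoef_cubic_H1_measurable:
  "(\<lambda>f. fcoef L k (nonlin 0 \<beta> f (\<lambda>x. 0))) \<in> H1_borel L \<rightarrow>\<^sub>M borel"
proof (rule H1_borel_measurable_continuous)
  fix f :: "real \<Rightarrow> complex" and e :: real assume f: "f \<in> H1_space L" and e: "0 < e"
  define R where "R = h1_norm L f + 1"
  define K where "K = 3 * \<bar>\<beta>\<bar> * (C * R)\<^sup>2 + 1"
  have K: "0 < K" by (simp add: K_def add_nonneg_pos)
  note Z = H1_zero[where 'a=real, of L] and hz = h1_norm_zero_real[OF L]
  have "dist (fcoef L k (nonlin 0 \<beta> g (\<lambda>x. 0))) (fcoef L k (nonlin 0 \<beta> f (\<lambda>x. 0))) < e"
    if g: "g \<in> H1_space L" and d: "h1_norm L (\<lambda>x. g x - f x) < min 1 (e / K)" for g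
  proof -
    have "h1_norm L (\<lambda>x. g x - f x) < 1" using d by simp
    then have gR: "h1_norm L g \<le> R" using h1_norm_triangle_abs[OF L g f] unfolding R_def by linarith
    have "dist (fcoef L k (nonlin 0 \<beta> g (\<lambda>x. 0))) (fcoef L k (nonlin 0 \<beta> f (\<lambda>x. 0)))
       \<le> (\<bar>0\<bar> * (C * R) + 3 * \<bar>\<beta>\<bar> * (C * R)\<^sup>2) * (h1_norm L (\<lambda>x. g x - f x) + h1_norm L (\<lambda>x. 0 - 0 :: real))"
      unfolding dist_norm by (rule norm_fcoef_nonlin_diff[OF g f Z Z gR]) (auto simp: hz R_def)
    also have "\<dots> \<le> K * h1_norm L (\<lambda>x. g x - f x)"
      using h1_norm_nonneg[of L "\<lambda>x. g x - f x"] by (simp add: hz K_def distrib_right del: h1_norm_nonneg)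
    also have "\<dots> < K * (e / K)" using d K by (intro mult_strict_left_mono) auto
    finally show ?thesis using K by simp
  qed
  moreover have "0 < min 1 (e / K)" using e K by simp
  ultimately show "\<exists>r>0. \<forall>g\<in>H1_space L. h1_norm L (\<lambda>x. g x - f x) < r \<longrightarrow>
      dist (fcoef L k (nonlin 0 \<beta> g (\<lambda>x. 0))) (fcoef L k (nonlin 0 \<beta> f (\<lambda>x. 0))) < e"
    by blast
qed

text \<open>Parseval's identity expresses the coefficient of the product \<open>v u\<close> by the coefficients of the
  factors.  This reduces the measurability of a functional of the pair to that of functionals of \<open>u\<close>
  and of \<open>v\<close>.\<close>

lemma fcoef_product_tendsto:
  assumes u: "u \<in> H1_space L" and v: "v \<in> H1_space L"
  shows "(\<lambda>N. \<Sum>j\<in>{-int N..int N}. cnj (fcoef L j (\<lambda>x. of_real (v x))) * (fcoef L (j + k) u / of_real (sqrt L)))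
    \<longlonglongrightarrow> fcoef L k (\<lambda>x. of_real (v x) * u x)"
proof -
  have v2: "(\<lambda>x. complex_of_real (v x)) \<in> L2_space L" using H1_L2[OF H1_of_real[OF v]] .
  have m: "(\<lambda>x. cnj (fmode L k x) * u x) \<in> L2_space L"
    by (rule L2_boundI[OF H1_L2[OF u], of _ "1 / sqrt L"])
      (use L2_measurable[OF H1_L2[OF u]] norm_fmode[OF L] in \<open>auto simp: norm_mult\<close>)
  have "fcoef L j (\<lambda>x. cnj (fmode L k x) * u x) = fcoef L (j + k) u / of_real (sqrt L)" for j
  proof -
    have "cnj (fmode L j x) * (cnj (fmode L k x) * u x) = cnj (fmode L (j + k) x) * u x / of_real (sqrt L)" for x
      using fmode_mult[OF L, of j x k] by (simp flip: mult.assoc complex_cnj_mult)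
    then show ?thesis by (simp add: fcoef_def)
  qed
  moreover have "fcoef L k (\<lambda>x. of_real (v x) * u x) = (LINT x|interval_measure0 L. cnj (of_real (v x)) * (cnj (fmode L k x) * u x))"
    by (simp add: fcoef_def mult.left_commute)
  ultimately show ?thesis using Parseval_inner(1)[OF L v2 m] by simp
qed

lemma fcoef_nonlin_measurable:
  assumes u: "u \<in> M \<rightarrow>\<^sub>M H1_borel L" and v: "v \<in> M \<rightarrow>\<^sub>M H1_borel L"
  shows "(\<lambda>\<omega>. fcoef L k (nonlin \<gamma> \<beta> (u \<omega>) (v \<omega>))) \<in> borel_measurable M"
proof -
  have H: "u \<omega> \<in> H1_space L" "v \<omega> \<in> H1_space L" if "\<omega> \<in> space M" for \<omega>
    using measurable_space[OF u that] measurable_space[OF v that] by (auto simp: space_H1_borel)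
  have [measurable]: "(\<lambda>\<omega>. fcoef L j (\<lambda>x. of_real (v \<omega> x))) \<in> borel_measurable M" for j
    using measurable_compose[OF v fcoef_of_real_H1_measurable[OF L]] .
  have [measurable]: "(\<lambda>\<omega>. fcoef L j (u \<omega>)) \<in> borel_measurable M" for j
    using measurable_compose[OF u fcoef_H1_measurable[OF L]] .
  have [measurable]: "(\<lambda>\<omega>. fcoef L k (nonlin 0 \<beta> (u \<omega>) (\<lambda>x. 0))) \<in> borel_measurable M"
    using measurable_compose[OF u fcoef_cubic_H1_measurable] .
  have [measurable]: "(\<lambda>\<omega>. fcoef L k (\<lambda>x. of_real (v \<omega> x) * u \<omega> x)) \<in> borel_measurable M"
    by (rule borel_measurable_LIMSEQ_metric[OF _ fcoef_product_tendsto]) (auto simp: H)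
  have "fcoef L k (nonlin \<gamma> \<beta> (u \<omega>) (v \<omega>)) =
      of_real \<gamma> * fcoef L k (\<lambda>x. of_real (v \<omega> x) * u \<omega> x) + fcoef L k (nonlin 0 \<beta> (u \<omega>) (\<lambda>x. 0))" if "\<omega> \<in> space M" for \<omega>
  proof -
    note H = H[OF that]
    have uv: "(\<lambda>x. of_real (v \<omega> x) * u \<omega> x) \<in> L2_space L"
      using L2_nonlin[OF H, of 1 0] by (simp add: nonlin_def[abs_def])
    have "nonlin \<gamma> \<beta> (u \<omega>) (v \<omega>) = (\<lambda>x. of_real \<gamma> * (of_real (v \<omega> x) * u \<omega> x) + nonlin 0 \<beta> (u \<omega>) (\<lambda>x. 0) x)"
      by (simp add: nonlin_def fun_eq_iff algebra_simps)
    then show ?thesis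
      using fcoef_add[OF L L2_mult_left[OF uv] L2_nonlin[OF H(1) H1_zero]] by (simp add: fcoef_mult)
  qed
  then show ?thesis by (subst measurable_cong) auto
qed

text \<open>The coefficients \<open>- i freq^2\<close> are purely imaginary, so the second derivative contributes
  nothing to the real part.  The rest is the imaginary part of a partial Parseval sum for \<open><u, q u>\<close>,
  where \<open>q\<close> is real.\<close>

lemma nonlin_cancel:
  assumes u: "u \<in> H1_space L" and v: "v \<in> H1_space L"
  shows "(\<lambda>N. Re (\<Sum>k\<in>{-int N..int N}. cnj (fcoef L k u) * (- \<i> * (freq L k)\<^sup>2 * fcoef L k u - \<i> * fcoef L k (nonlin \<gamma> \<beta> u v)))) \<longlonglongrightarrow> 0"
    and "\<bar>Re (\<Sum>k\<in>{-int N..int N}. cnj (fcoef L k u) * (- \<i> * (freq L k)\<^sup>2 * fcoef L k u - \<i> * fcoef L k (nonlin \<gamma> \<beta> u v)))\<bar>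
      \<le> l2_norm L u * l2_norm L (nonlin \<gamma> \<beta> u v)"
proof -
  let ?n = "nonlin \<gamma> \<beta> u v"
  note L2 = H1_L2[OF u] L2_nonlin[OF u v, of \<gamma> \<beta>]
  have "Re (cnj (fcoef L k u) * (- \<i> * (freq L k)\<^sup>2 * fcoef L k u - \<i> * fcoef L k ?n)) = Im (cnj (fcoef L k u) * fcoef L k ?n)" for k
    by (simp add: algebra_simps power2_eq_square)
  then have eq: "Re (\<Sum>k\<in>{-int N..int N}. cnj (fcoef L k u) * (- \<i> * (freq L k)\<^sup>2 * fcoef L k u - \<i> * fcoef L k ?n))
      = Im (\<Sum>k\<in>{-int N..int N}. cnj (fcoef L k u) * fcoef L k ?n)" for N
    by (simp only: Re_sum Im_sum)
  have "(LINT x|interval_measure0 L. cnj (u x) * ?n x) = (LINT x|interval_measure0 L. of_real ((\<gamma> * v x + \<beta> * (cmod (u x))\<^sup>2) * (cmod (u x))\<^sup>2))"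
  proof (rule Bochner_Integration.integral_cong[OF refl])
    fix x
    have "complex_of_real ((cmod (u x))\<^sup>2) = u x * cnj (u x)" by (rule complex_norm_square)
    then show "cnj (u x) * ?n x = of_real ((\<gamma> * v x + \<beta> * (cmod (u x))\<^sup>2) * (cmod (u x))\<^sup>2)"
      unfolding nonlin_def of_real_mult[of "\<gamma> * v x + \<beta> * (cmod (u x))\<^sup>2"] by simp
  qed
  then have "Im (LINT x|interval_measure0 L. cnj (u x) * ?n x) = 0"
    by (simp only: integral_complex_of_real Im_complex_of_real)
  then show "(\<lambda>N. Re (\<Sum>k\<in>{-int N..int N}. cnj (fcoef L k u) * (- \<i> * (freq L k)\<^sup>2 * fcoef L k u - \<i> * fcoef L k ?n))) \<longlonglongrightarrow> 0"
    unfolding eq using tendsto_Im[OF Parseval_inner(1)[OF L L2]] by simp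
  show "\<bar>Re (\<Sum>k\<in>{-int N..int N}. cnj (fcoef L k u) * (- \<i> * (freq L k)\<^sup>2 * fcoef L k u - \<i> * fcoef L k ?n))\<bar>
      \<le> l2_norm L u * l2_norm L ?n"
    unfolding eq by (rule order_trans[OF abs_Im_le_cmod Parseval_inner(2)[OF L L2]])
qed

end

section \<open>Stochastic preliminaries\<close>

subsection \<open>Processes with continuous paths\<close>

text \<open>The process is the limit of its values at the last grid point before \<open>s\<close>.  For each grid this
  is a countable patchwork of functions of \<open>\<omega>\<close> alone.\<close>

lemma joint_measurable_continuous:
  fixes g :: "real \<Rightarrow> 'w \<Rightarrow> 'b::{banach,second_countable_topology}"
  assumes t: "0 \<le> t" and m: "\<And>s. s \<in> {0..t} \<Longrightarrow> g s \<in> borel_measurable M"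
    and c: "\<And>\<omega>. \<omega> \<in> space M \<Longrightarrow> continuous_on {0..t} (\<lambda>s. g s \<omega>)"
  shows "(\<lambda>p. g (fst p) (snd p)) \<in> borel_measurable (lebesgue_on {0..t} \<Otimes>\<^sub>M M)"
proof -
  define r where "r n i = max 0 (min t (real_of_int i / real (Suc n)))" for n i
  let ?Q = "lebesgue_on {0..t} \<Otimes>\<^sub>M M"
  have meas: "(\<lambda>p. g (r n \<lfloor>real (Suc n) * fst p\<rfloor>) (snd p)) \<in> borel_measurable ?Q" for n
  proof (rule measurable_compose_countable[where g="\<lambda>p. \<lfloor>real (Suc n) * fst p\<rfloor>" and f="\<lambda>i p. g (r n i) (snd p)"])
    show "(\<lambda>p. g (r n i) (snd p)) \<in> borel_measurable ?Q" for i
      by (intro measurable_compose[OF measurable_snd] m) (use t in \<open>auto simp: r_def\<close>)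
    have "id \<in> borel_measurable (lebesgue_on {0..t})" by (rule id_borel_measurable_lebesgue_on)
    from measurable_compose[OF measurable_fst this]
    have [measurable]: "fst \<in> borel_measurable ?Q" by simp
    show "(\<lambda>p. \<lfloor>real (Suc n) * fst p\<rfloor>) \<in> measurable ?Q (count_space UNIV)" by measurable
  qed
  show ?thesis
  proof (rule borel_measurable_LIMSEQ_metric[OF meas])
    fix p assume "p \<in> space ?Q"
    then obtain s \<omega> where p: "p = (s, \<omega>)" "s \<in> {0..t}" "\<omega> \<in> space M"
      by (auto simp: space_pair_measure)
    have eq: "r n \<lfloor>real (Suc n) * s\<rfloor> = real_of_int \<lfloor>real (Suc n) * s\<rfloor> / real (Suc n)" for n
    proof -
      have "real_of_int \<lfloor>real (Suc n) * s\<rfloor> / real (Suc n) \<le> s"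
        using of_int_floor_le[of "real (Suc n) * s"] by (simp add: divide_le_eq mult.commute)
      moreover have "0 \<le> real_of_int \<lfloor>real (Suc n) * s\<rfloor> / real (Suc n)" using p(2) by simp
      ultimately show ?thesis using p(2) by (simp add: r_def)
    qed
    have "(\<lambda>n. real_of_int \<lfloor>real (Suc n) * s\<rfloor> / real (Suc n)) \<longlonglongrightarrow> s"
    proof (rule real_tendsto_sandwich[of "\<lambda>n. s - 1 / real (Suc n)" _ _ "\<lambda>n. s"])
      have "s - 1 / real (Suc n) \<le> real_of_int \<lfloor>real (Suc n) * s\<rfloor> / real (Suc n)" for n
      proof -
        have "real (Suc n) * s - 1 \<le> real_of_int \<lfloor>real (Suc n) * s\<rfloor>" by linarith
        then have "(real (Suc n) * s - 1) / real (Suc n) \<le> real_of_int \<lfloor>real (Suc n) * s\<rfloor> / real (Suc n)"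
          by (rule divide_right_mono) simp
        then show ?thesis by (simp add: diff_divide_distrib)
      qed
      then show "\<forall>\<^sub>F n in sequentially. s - 1 / real (Suc n) \<le> real_of_int \<lfloor>real (Suc n) * s\<rfloor> / real (Suc n)" by simp
      show "\<forall>\<^sub>F n in sequentially. real_of_int \<lfloor>real (Suc n) * s\<rfloor> / real (Suc n) \<le> s"
        using of_int_floor_le[of "real (Suc _) * s"] by (simp add: divide_le_eq mult.commute)
      have "(\<lambda>n. s - 1 / real (Suc n)) \<longlonglongrightarrow> s - 0"
        by (intro tendsto_diff tendsto_const LIMSEQ_Suc[OF lim_1_over_n])
      then show "(\<lambda>n. s - 1 / real (Suc n)) \<longlonglongrightarrow> s" by simp
    qed simp
    then have "(\<lambda>n. r n \<lfloor>real (Suc n) * s\<rfloor>) \<longlonglongrightarrow> s" unfolding eq .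
    moreover have "\<And>n. r n i \<in> {0..t}" for i using t by (auto simp: r_def)
    ultimately have "(\<lambda>n. g (r n \<lfloor>real (Suc n) * s\<rfloor>) \<omega>) \<longlonglongrightarrow> g s \<omega>"
      using c[OF p(3)] p(2) unfolding continuous_on_sequentially by (auto simp: o_def)
    then show "(\<lambda>n. g (r n \<lfloor>real (Suc n) * fst p\<rfloor>) (snd p)) \<longlonglongrightarrow> g (fst p) (snd p)" by (simp add: p)
  qed
qed

subsection \<open>Augmentation by null sets\<close>

text \<open>The paths of the solution are continuous outside a null set only, and that null set need not
  belong to the filtration.  In the augmented algebra a process can be redefined on a null set and
  stays adapted, while the independence of the increments persists (\<open>indep_set_augment\<close>).\<close>

definition augment :: "'w measure \<Rightarrow> 'w measure \<Rightarrow> 'w measure" where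
  "augment M N = sigma (space M) {A \<in> sets M. \<exists>B\<in>sets N. AE \<omega> in M. \<omega> \<in> A \<longleftrightarrow> \<omega> \<in> B}"

lemma space_augment: "space (augment M N) = space M"
  unfolding augment_def by (rule space_measure_of) (auto dest: sets.sets_into_space)

lemma sets_augment:
  assumes "subalgebra M N"
  shows "sets (augment M N) = {A \<in> sets M. \<exists>B\<in>sets N. AE \<omega> in M. \<omega> \<in> A \<longleftrightarrow> \<omega> \<in> B}" (is "_ = ?S")
proof -
  have sp: "space N = space M" "sets N \<subseteq> sets M" using assms by (auto simp: subalgebra_def)
  have "sigma_algebra (space M) ?S"
    unfolding sigma_algebra_iff2
  proof (intro conjI ballI allI impI)
    show "?S \<subseteq> Pow (space M)" by (auto dest: sets.sets_into_space)
    show "{} \<in> ?S" by auto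
    fix A assume "A \<in> ?S"
    then obtain B where B: "A \<in> sets M" "B \<in> sets N" "AE \<omega> in M. \<omega> \<in> A \<longleftrightarrow> \<omega> \<in> B" by blast
    have "AE \<omega> in M. \<omega> \<in> space M - A \<longleftrightarrow> \<omega> \<in> space M - B" using B(3) by eventually_elim auto
    moreover have "space M - B \<in> sets N" using B(2) sp by (metis sets.compl_sets)
    ultimately show "space M - A \<in> ?S" using B(1) by blast
  next
    fix A :: "nat \<Rightarrow> 'a set" assume "range A \<subseteq> ?S"
    then have "\<forall>i. A i \<in> sets M \<and> (\<exists>B\<in>sets N. AE \<omega> in M. \<omega> \<in> A i \<longleftrightarrow> \<omega> \<in> B)" by blast
    then obtain B where B: "\<And>i. A i \<in> sets M" "\<And>i. B i \<in> sets N" "\<And>i. AE \<omega> in M. \<omega> \<in> A i \<longleftrightarrow> \<omega> \<in> B i"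
      by metis
    have "AE \<omega> in M. \<forall>i. \<omega> \<in> A i \<longleftrightarrow> \<omega> \<in> B i" using B(3) by (simp add: AE_all_countable)
    then have "AE \<omega> in M. \<omega> \<in> (\<Union>i. A i) \<longleftrightarrow> \<omega> \<in> (\<Union>i. B i)" by eventually_elim auto
    then show "(\<Union>i. A i) \<in> ?S" using B(1,2) by blast
  qed
  then show ?thesis unfolding augment_def by (rule sigma_algebra.sets_measure_of_eq)
qed

lemma subalgebra_augment: "subalgebra M N \<Longrightarrow> subalgebra M (augment M N)"
  by (auto simp: subalgebra_def[of _ "augment M N"] space_augment sets_augment)

lemma measurable_augment:
  assumes "subalgebra M N" "f \<in> measurable N K" shows "f \<in> measurable (augment M N) K"
proof (rule measurableI)
  show "f x \<in> space K" if "x \<in> space (augment M N)" for x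
    using measurable_space[OF assms(2)] that assms(1) by (simp add: space_augment subalgebra_def)
  fix A assume "A \<in> sets K"
  then have "f -` A \<inter> space M \<in> sets N"
    using measurable_sets[OF assms(2)] assms(1) by (simp add: subalgebra_def)
  then show "f -` A \<inter> space (augment M N) \<in> sets (augment M N)"
  proof -
    note \<open>f -` A \<inter> space M \<in> sets N\<close>
    moreover have "f -` A \<inter> space M \<in> sets M" using calculation assms(1) by (auto simp: subalgebra_def)
    moreover have "AE \<omega> in M. \<omega> \<in> f -` A \<inter> space M \<longleftrightarrow> \<omega> \<in> f -` A \<inter> space M" by simp
    ultimately show ?thesis unfolding sets_augment[OF assms(1)] space_augment by blast
  qed
qed

lemma augment_mono:
  assumes "subalgebra M N" "subalgebra M N'" "sets N \<subseteq> sets N'"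
  shows "sets (augment M N) \<subseteq> sets (augment M N')"
  using assms(3) unfolding sets_augment[OF assms(1)] sets_augment[OF assms(2)] by blast

lemma full_set_augment:
  assumes "subalgebra M N" "A \<in> sets M" "AE \<omega> in M. \<omega> \<in> A"
  shows "A \<in> sets (augment M N)"
proof -
  have "space M \<in> sets N" using assms(1) by (metis sets.top subalgebra_def)
  moreover have "AE \<omega> in M. \<omega> \<in> A \<longleftrightarrow> \<omega> \<in> space M" using assms(3) AE_space by eventually_elim auto
  ultimately show ?thesis unfolding sets_augment[OF assms(1)] using assms(2) by blast
qed

context prob_space
begin

lemma indep_set_augment:
  assumes "subalgebra M N" "indep_set (sets N) G"
  shows "indep_set (sets (augment M N)) G"
  unfolding indep_sets2_eq
proof (intro conjI ballI)
  have i: "G \<subseteq> events" "\<And>a b. a \<in> sets N \<Longrightarrow> b \<in> G \<Longrightarrow> prob (a \<inter> b) = prob a * prob b"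
    using assms(2) unfolding indep_sets2_eq by auto
  show "sets (augment M N) \<subseteq> events" unfolding sets_augment[OF assms(1)] by blast
  show "G \<subseteq> events" by (rule i)
  fix a b assume a: "a \<in> sets (augment M N)" and b: "b \<in> G"
  then obtain a' where a': "a \<in> events" "a' \<in> sets N" "AE \<omega> in M. \<omega> \<in> a \<longleftrightarrow> \<omega> \<in> a'"
    unfolding sets_augment[OF assms(1)] by blast
  have [measurable]: "a \<in> events" "a' \<in> events" "b \<in> events" using a' b i assms(1) by (auto simp: subalgebra_def)
  have "prob a = prob a'" by (rule measure_eq_AE) (use a'(3) in auto)
  moreover have "prob (a \<inter> b) = prob (a' \<inter> b)" by (rule measure_eq_AE) (use a'(3) in auto)
  ultimately show "prob (a \<inter> b) = prob a * prob b" using i(2)[OF a'(2) b] by simp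
qed

lemma indep_var_of_indep_set:
  assumes "indep_set (sets N) (sets G)" "subalgebra M N" "subalgebra M G"
    and "X \<in> borel_measurable N" "Y \<in> borel_measurable G"
  shows "indep_var borel X borel Y"
  unfolding indep_var_eq
proof (intro conjI)
  show "random_variable borel X" using assms(2,4) by (rule measurable_from_subalg)
  show "random_variable borel Y" using assms(3,5) by (rule measurable_from_subalg)
  have sp: "space N = space M" "space G = space M" using assms by (auto simp: subalgebra_def)
  have "sigma_sets (space M) {X -` A \<inter> space M |A. A \<in> sets borel} \<subseteq> sets N"
    using measurable_sets[OF assms(4)] unfolding sp(1)[symmetric] by (intro sets.sigma_sets_subset) auto
  moreover have "sigma_sets (space M) {Y -` A \<inter> space M |A. A \<in> sets borel} \<subseteq> sets G"
    using measurable_sets[OF assms(5)] unfolding sp(2)[symmetric] by (intro sets.sigma_sets_subset) auto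
  ultimately show "indep_set (sigma_sets (space M) {X -` A \<inter> space M |A. A \<in> sets borel}) (sigma_sets (space M) {Y -` A \<inter> space M |A. A \<in> sets borel})"
    using assms(1) unfolding indep_set_def by (elim indep_sets_mono_sets) (auto split: bool.split)
qed

end

subsection \<open>Increments of the Brownian motions\<close>

lemma brownian_increment:
  assumes "prob_space M" "brownian_family M F B" "0 \<le> s" "s < t"
  shows brownian_increment_integrable: "integrable M (\<lambda>\<omega>. B j t \<omega> - B j s \<omega>)"
    and brownian_increment_mean: "(\<integral>\<omega>. B j t \<omega> - B j s \<omega> \<partial>M) = 0"
    and brownian_increment_sq_integrable: "integrable M (\<lambda>\<omega>. (B j t \<omega> - B j s \<omega>)\<^sup>2)"
    and brownian_increment_sq: "(\<integral>\<omega>. (B j t \<omega> - B j s \<omega>)\<^sup>2 \<partial>M) = t - s"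
proof -
  interpret prob_space M by fact
  let ?X = "\<lambda>\<omega>. B j t \<omega> - B j s \<omega>"
  let ?d = "normal_density 0 (sqrt (t - s))"
  have sp: "0 < sqrt (t - s)" using assms by simp
  have D: "distributed M lborel ?X ?d" using assms unfolding brownian_family_def by blast
  have E: "expectation ?X = 0" by (rule normal_distributed_expectation[OF sp D])
  have V: "variance ?X = (sqrt (t - s))\<^sup>2" by (rule normal_distributed_variance[OF sp D])
  show "expectation ?X = 0" by (rule E)
  show "(\<integral>\<omega>. (?X \<omega>)\<^sup>2 \<partial>M) = t - s" using V assms unfolding E by simp
  have "integrable lborel (\<lambda>x. ?d x * (x - 0) ^ k)" for k by (rule integrable_normal_moment[OF sp])
  then have i: "integrable M (\<lambda>\<omega>. (?X \<omega>) ^ k)" for k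
    using distributed_integrable[OF D, of "\<lambda>x. x ^ k"] by simp
  show "integrable M ?X" using i[of 1] by simp
  show "integrable M (\<lambda>\<omega>. (?X \<omega>)\<^sup>2)" by (rule i)
qed

lemma brownian_increment_orthogonal:
  assumes "prob_space M" "brownian_family M F B" "0 \<le> s" "s < t" "i \<noteq> j"
  shows "integrable M (\<lambda>\<omega>. (B i t \<omega> - B i s \<omega>) * (B j t \<omega> - B j s \<omega>))"
    and "(\<integral>\<omega>. (B i t \<omega> - B i s \<omega>) * (B j t \<omega> - B j s \<omega>) \<partial>M) = 0"
proof -
  interpret prob_space M by fact
  have "indep_vars (\<lambda>_. Pi\<^sub>M {0..} (\<lambda>_. borel)) (\<lambda>j \<omega>. \<lambda>t\<in>{0..}. B j t \<omega>) UNIV"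
    using assms unfolding brownian_family_def by blast
  then have iv: "indep_var (Pi\<^sub>M {i} (\<lambda>_. Pi\<^sub>M {0..} (\<lambda>_. borel))) (\<lambda>\<omega>. \<lambda>k\<in>{i}. \<lambda>t\<in>{0..}. B k t \<omega>)
      (Pi\<^sub>M {j} (\<lambda>_. Pi\<^sub>M {0..} (\<lambda>_. borel))) (\<lambda>\<omega>. \<lambda>k\<in>{j}. \<lambda>t\<in>{0..}. B k t \<omega>)"
    by (rule indep_var_restrict) (use assms(5) in auto)
  have m: "(\<lambda>x. x k t - x k s) \<in> borel_measurable (Pi\<^sub>M {k} (\<lambda>_. Pi\<^sub>M {0..} (\<lambda>_. borel :: real measure)))" for k
    using assms
    by (intro borel_measurable_diff measurable_compose[OF measurable_component_singleton[of k] measurable_component_singleton]) auto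
  from indep_var_compose[OF iv m m] assms
  have "indep_var borel (\<lambda>\<omega>. B i t \<omega> - B i s \<omega>) borel (\<lambda>\<omega>. B j t \<omega> - B j s \<omega>)"
    by (simp add: o_def)
  note I = indep_var_lebesgue_integral[OF this] indep_var_integrable[OF this]
  note b = brownian_increment_integrable[OF assms(1-4)]
  show "integrable M (\<lambda>\<omega>. (B i t \<omega> - B i s \<omega>) * (B j t \<omega> - B j s \<omega>))" by (rule I(2)[OF b b])
  show "(\<integral>\<omega>. (B i t \<omega> - B i s \<omega>) * (B j t \<omega> - B j s \<omega>) \<partial>M) = 0"
    using I(1)[OF b b] brownian_increment_mean[OF assms(1-4)] by simp
qed

text \<open>The events that are determined by the increments of all Brownian motions between \<open>s\<close> and \<open>t\<close>.\<close>

definition increment_algebra :: "'w measure \<Rightarrow> ('i \<Rightarrow> real \<Rightarrow> 'w \<Rightarrow> real) \<Rightarrow> real \<Rightarrow> real \<Rightarrow> 'w measure" where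
  "increment_algebra M B s t = vimage_algebra (space M) (\<lambda>\<omega> j. B j t \<omega> - B j s \<omega>) (Pi\<^sub>M UNIV (\<lambda>_. borel))"

lemma brownian_increment_algebra:
  assumes "prob_space M" "brownian_family M F B" "0 \<le> s" "s < t"
  shows "prob_space.indep_set M (sets (F s)) (sets (increment_algebra M B s t))"
    and "subalgebra M (increment_algebra M B s t)"
    and "(\<lambda>\<omega>. B j t \<omega> - B j s \<omega>) \<in> borel_measurable (increment_algebra M B s t)"
proof -
  interpret prob_space M by fact
  show I: "indep_set (sets (F s)) (sets (increment_algebra M B s t))"
    using assms unfolding brownian_family_def increment_algebra_def by blast
  show "subalgebra M (increment_algebra M B s t)"
    using I unfolding indep_sets2_eq subalgebra_def by (simp add: increment_algebra_def)
  have "(\<lambda>\<omega> j. B j t \<omega> - B j s \<omega>) \<in> measurable (increment_algebra M B s t) (Pi\<^sub>M UNIV (\<lambda>_. borel))"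
    unfolding increment_algebra_def by (rule measurable_vimage_algebra1) (auto simp: space_PiM)
  from measurable_compose[OF this measurable_component_singleton[of j]]
  show "(\<lambda>\<omega>. B j t \<omega> - B j s \<omega>) \<in> borel_measurable (increment_algebra M B s t)" by simp
qed

subsection \<open>Increments of the noise\<close>

lemma norm_add_sq_le: "(norm (a + b :: 'a::real_normed_vector))\<^sup>2 \<le> 2 * (norm a)\<^sup>2 + 2 * (norm b)\<^sup>2"
proof -
  have "(norm (a + b))\<^sup>2 \<le> (norm a + norm b)\<^sup>2" by (intro power_mono norm_triangle_ineq) simp
  also have "\<dots> \<le> 2 * (norm a)\<^sup>2 + 2 * (norm b)\<^sup>2"
    using sum_squares_bound[of "norm a" "norm b"] by (simp add: power2_sum)
  finally show ?thesis .
qed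

text \<open>One Fourier mode \<open>Z\<close> of the noise, the mean square limit of \<open>\<Sum>i. c i B (\<iota> i)\<close>.  The map \<open>\<iota>\<close> picks
  the driving Brownian motions out of a larger independent family.\<close>

locale noise = prob_space M for M :: "'w measure" +
  fixes F :: "real \<Rightarrow> 'w measure" and B :: "'i \<Rightarrow> real \<Rightarrow> 'w \<Rightarrow> real" and \<iota> :: "nat \<Rightarrow> 'i"
    and c :: "nat \<Rightarrow> complex" and Z :: "real \<Rightarrow> 'w \<Rightarrow> complex"
  assumes sub: "\<And>t. subalgebra M (F t)"
    and bf: "brownian_family M F B" and inj: "inj \<iota>"
    and c: "summable (\<lambda>i. (norm (c i))\<^sup>2)"
    and Z_meas: "\<And>s. 0 \<le> s \<Longrightarrow> Z s \<in> borel_measurable M"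
    and Z_lim: "\<And>s. 0 \<le> s \<Longrightarrow> (\<lambda>n. \<integral>\<^sup>+\<omega>. ennreal ((norm (Z s \<omega> - (\<Sum>i<n. of_real (B (\<iota> i) s \<omega>) * c i)))\<^sup>2) \<partial>M) \<longlonglongrightarrow> 0"
begin

definition \<sigma> :: real where "\<sigma> = (\<Sum>i. (norm (c i))\<^sup>2)"

lemma \<sigma>_nonneg: "0 \<le> \<sigma>" unfolding \<sigma>_def by (rule suminf_nonneg[OF c]) simp

lemma B_meas: "0 \<le> s \<Longrightarrow> B j s \<in> borel_measurable M"
  using bf measurable_from_subalg[OF sub] unfolding brownian_family_def by blast

lemma of_real_B_meas: "0 \<le> s \<Longrightarrow> (\<lambda>\<omega>. complex_of_real (B j s \<omega>)) \<in> borel_measurable M"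
  using B_meas by measurable

definition D :: "nat \<Rightarrow> real \<Rightarrow> real \<Rightarrow> 'w \<Rightarrow> complex" where
  "D n s t \<omega> = (\<Sum>i<n. of_real (B (\<iota> i) t \<omega> - B (\<iota> i) s \<omega>) * c i)"

lemma D_increment_measurable:
  assumes "0 \<le> s" "s < t" shows "D n s t \<in> borel_measurable (increment_algebra M B s t)"
  unfolding D_def[abs_def]
proof -
  note [measurable] = brownian_increment_algebra(3)[OF prob_space_axioms bf assms]
  show "(\<lambda>\<omega>. \<Sum>i<n. of_real (B (\<iota> i) t \<omega> - B (\<iota> i) s \<omega>) * c i) \<in> borel_measurable (increment_algebra M B s t)"
    by (intro borel_measurable_sum borel_measurable_times borel_measurable_const borel_measurable_of_real) measurable
qed

lemma D_meas [measurable]: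
  assumes "0 \<le> s" "s < t" shows "D n s t \<in> borel_measurable M"
  by (rule measurable_from_subalg[OF brownian_increment_algebra(2)[OF prob_space_axioms bf assms] D_increment_measurable[OF assms]])

lemma D_sq:
  assumes st: "0 \<le> s" "s < t"
  shows "integrable M (\<lambda>\<omega>. (norm (D n s t \<omega>))\<^sup>2)"
    and "(\<integral>\<omega>. (norm (D n s t \<omega>))\<^sup>2 \<partial>M) = (t - s) * (\<Sum>i<n. (norm (c i))\<^sup>2)"
    and "integrable M (D n s t)" and "(\<integral>\<omega>. D n s t \<omega> \<partial>M) = 0"
proof -
  let ?d = "\<lambda>i \<omega>. B (\<iota> i) t \<omega> - B (\<iota> i) s \<omega>"
  note [measurable] = D_meas[OF st]
  have dd: "integrable M (\<lambda>\<omega>. ?d i \<omega> * ?d j \<omega>)" "(\<integral>\<omega>. ?d i \<omega> * ?d j \<omega> \<partial>M) = (if i = j then t - s else 0)" for i j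
  proof -
    have "\<iota> i \<noteq> \<iota> j" if "i \<noteq> j" using that inj by (simp add: inj_eq)
    then show "integrable M (\<lambda>\<omega>. ?d i \<omega> * ?d j \<omega>)" "(\<integral>\<omega>. ?d i \<omega> * ?d j \<omega> \<partial>M) = (if i = j then t - s else 0)"
      using brownian_increment_orthogonal[OF prob_space_axioms bf st, of "\<iota> i" "\<iota> j"]
        brownian_increment_sq_integrable[OF prob_space_axioms bf st, of "\<iota> i"] brownian_increment_sq[OF prob_space_axioms bf st, of "\<iota> i"]
      by (cases "i = j"; simp add: power2_eq_square)+
  qed
  have eq: "(norm (D n s t \<omega>))\<^sup>2 = (\<Sum>i<n. \<Sum>j<n. ?d i \<omega> * ?d j \<omega> * Re (c i * cnj (c j)))" for \<omega>
  proof -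
    have "(norm (D n s t \<omega>))\<^sup>2 = Re (D n s t \<omega> * cnj (D n s t \<omega>))"
      by (simp only: complex_norm_square[symmetric] Re_complex_of_real)
    also have "D n s t \<omega> * cnj (D n s t \<omega>) = (\<Sum>i<n. \<Sum>j<n. of_real (?d i \<omega> * ?d j \<omega>) * (c i * cnj (c j)))"
      unfolding D_def by (simp add: sum_product algebra_simps)
    also have "Re \<dots> = (\<Sum>i<n. \<Sum>j<n. ?d i \<omega> * ?d j \<omega> * Re (c i * cnj (c j)))"
      by (simp only: Re_sum mult.assoc Re_complex_of_real Im_complex_of_real times_complex.sel(1)) (simp add: mult.assoc)
    finally show ?thesis .
  qed
  show "integrable M (\<lambda>\<omega>. (norm (D n s t \<omega>))\<^sup>2)"
    unfolding eq by (intro Bochner_Integration.integrable_sum integrable_mult_left dd)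
  have "(\<integral>\<omega>. (norm (D n s t \<omega>))\<^sup>2 \<partial>M) = (\<Sum>i<n. \<Sum>j<n. (if i = j then t - s else 0) * Re (c i * cnj (c j)))"
    unfolding eq using dd by (simp add: Bochner_Integration.integral_sum Bochner_Integration.integrable_sum)
  also have "\<dots> = (\<Sum>i<n. (t - s) * (norm (c i))\<^sup>2)"
  proof (rule sum.cong[OF refl])
    fix i assume "i \<in> {..<n}"
    then have "(\<Sum>j<n. (if i = j then t - s else 0) * Re (c i * cnj (c j))) = (t - s) * Re (c i * cnj (c i))"
      by (simp add: if_distrib[where f="\<lambda>x. x * _"] cong: if_cong)
    also have "Re (c i * cnj (c i)) = (norm (c i))\<^sup>2"
      by (simp only: complex_norm_square[symmetric] Re_complex_of_real)
    finally show "(\<Sum>j<n. (if i = j then t - s else 0) * Re (c i * cnj (c j))) = (t - s) * (norm (c i))\<^sup>2" .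
  qed
  finally show "(\<integral>\<omega>. (norm (D n s t \<omega>))\<^sup>2 \<partial>M) = (t - s) * (\<Sum>i<n. (norm (c i))\<^sup>2)"
    by (simp add: sum_distrib_left)
  have i: "complex_integrable M (\<lambda>\<omega>. of_real (?d i \<omega>) * c i)" for i
    using brownian_increment_integrable[OF prob_space_axioms bf st]
    by (intro integrable_mult_left integrable_of_real)
  then show "integrable M (D n s t)" unfolding D_def[abs_def] by (intro Bochner_Integration.integrable_sum)
  have "(\<integral>\<omega>. of_real (?d i \<omega>) * c i \<partial>M) = 0" for i
    using brownian_increment_mean[OF prob_space_axioms bf st, of "\<iota> i"] brownian_increment_integrable[OF prob_space_axioms bf st, of "\<iota> i"]
    unfolding integral_mult_left_zero integral_complex_of_real by simp
  then show "(\<integral>\<omega>. D n s t \<omega> \<partial>M) = 0" unfolding D_def using i by (simp add: Bochner_Integration.integral_sum del: integral_mult_left_zero of_real_diff)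
qed

lemma increment_lim:
  assumes st: "0 \<le> s" "s < t"
  shows "(\<lambda>n. \<integral>\<^sup>+\<omega>. ennreal ((norm (Z t \<omega> - Z s \<omega> - D n s t \<omega>))\<^sup>2) \<partial>M) \<longlonglongrightarrow> 0"
proof -
  let ?e = "\<lambda>n s \<omega>. Z s \<omega> - (\<Sum>i<n. of_real (B (\<iota> i) s \<omega>) * c i)"
  have t: "0 \<le> t" using st by simp
  have [measurable]: "?e n s \<in> borel_measurable M" "?e n t \<in> borel_measurable M" for n
    using st by (auto intro!: borel_measurable_diff Z_meas borel_measurable_sum borel_measurable_times of_real_B_meas)
  have le: "(\<integral>\<^sup>+\<omega>. ennreal ((norm (Z t \<omega> - Z s \<omega> - D n s t \<omega>))\<^sup>2) \<partial>M)
     \<le> 2 * (\<integral>\<^sup>+\<omega>. ennreal ((norm (?e n t \<omega>))\<^sup>2) \<partial>M) + 2 * (\<integral>\<^sup>+\<omega>. ennreal ((norm (?e n s \<omega>))\<^sup>2) \<partial>M)" for n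
  proof -
    have "(norm (Z t \<omega> - Z s \<omega> - D n s t \<omega>))\<^sup>2 \<le> 2 * (norm (?e n t \<omega>))\<^sup>2 + 2 * (norm (?e n s \<omega>))\<^sup>2" for \<omega>
    proof -
      have "Z t \<omega> - Z s \<omega> - D n s t \<omega> = ?e n t \<omega> + (- ?e n s \<omega>)"
        by (simp add: D_def algebra_simps sum_subtractf)
      then show ?thesis using norm_add_sq_le[of "?e n t \<omega>" "- ?e n s \<omega>"] by (simp only: norm_minus_cancel)
    qed
    then have "(\<integral>\<^sup>+\<omega>. ennreal ((norm (Z t \<omega> - Z s \<omega> - D n s t \<omega>))\<^sup>2) \<partial>M)
      \<le> (\<integral>\<^sup>+\<omega>. 2 * ennreal ((norm (?e n t \<omega>))\<^sup>2) + 2 * ennreal ((norm (?e n s \<omega>))\<^sup>2) \<partial>M)"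
      by (intro nn_integral_mono) (simp add: ennreal_mult[symmetric] ennreal_plus[symmetric] ennreal_leI del: ennreal_plus flip: ennreal_numeral)
    also have "\<dots> = 2 * (\<integral>\<^sup>+\<omega>. ennreal ((norm (?e n t \<omega>))\<^sup>2) \<partial>M) + 2 * (\<integral>\<^sup>+\<omega>. ennreal ((norm (?e n s \<omega>))\<^sup>2) \<partial>M)"
      by (subst nn_integral_add) (simp_all add: nn_integral_cmult)
    finally show ?thesis .
  qed
  have "(\<lambda>n. 2 * (\<integral>\<^sup>+\<omega>. ennreal ((norm (?e n t \<omega>))\<^sup>2) \<partial>M) + 2 * (\<integral>\<^sup>+\<omega>. ennreal ((norm (?e n s \<omega>))\<^sup>2) \<partial>M)) \<longlonglongrightarrow> 2 * 0 + 2 * 0"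
    by (intro tendsto_add ennreal_tendsto_cmult Z_lim st t) auto
  then have L: "(\<lambda>n. 2 * (\<integral>\<^sup>+\<omega>. ennreal ((norm (?e n t \<omega>))\<^sup>2) \<partial>M) + 2 * (\<integral>\<^sup>+\<omega>. ennreal ((norm (?e n s \<omega>))\<^sup>2) \<partial>M)) \<longlonglongrightarrow> 0"
    by (simp only: mult_zero_right add_0_right)
  show ?thesis
    by (rule tendsto_sandwich[OF always_eventually[OF allI] always_eventually[OF allI] tendsto_const L]) (rule zero_le, rule le)
qed

text \<open>Everything is transported from the partial sums \<open>D\<close> to the limit, with error terms controlled
  by the Cauchy--Schwarz inequality.\<close>

lemma increment_sq:
  assumes st: "0 \<le> s" "s < t"
  shows increment_sq_integrable: "integrable M (\<lambda>\<omega>. (norm (Z t \<omega> - Z s \<omega>))\<^sup>2)"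
    and increment_sq_integral: "(\<integral>\<omega>. (norm (Z t \<omega> - Z s \<omega>))\<^sup>2 \<partial>M) = (t - s) * \<sigma>"
    and increment_integrable: "integrable M (\<lambda>\<omega>. Z t \<omega> - Z s \<omega>)"
    and increment_mean: "(\<integral>\<omega>. Z t \<omega> - Z s \<omega> \<partial>M) = 0"
    and increment_error_integrable: "\<And>n. integrable M (\<lambda>\<omega>. (norm (Z t \<omega> - Z s \<omega> - D n s t \<omega>))\<^sup>2)"
    and increment_error: "(\<lambda>n. \<integral>\<omega>. (norm (Z t \<omega> - Z s \<omega> - D n s t \<omega>))\<^sup>2 \<partial>M) \<longlonglongrightarrow> 0"
proof -
  let ?X = "\<lambda>\<omega>. Z t \<omega> - Z s \<omega>"
  let ?e = "\<lambda>n \<omega>. ?X \<omega> - D n s t \<omega>"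
  have [measurable]: "?X \<in> borel_measurable M" using st by (intro borel_measurable_diff Z_meas) auto
  note [measurable] = D_meas[OF st]
  obtain n where "(\<integral>\<^sup>+\<omega>. ennreal ((norm (?e n \<omega>))\<^sup>2) \<partial>M) < 1"
    using order_tendstoD(2)[OF increment_lim[OF st], of 1] by (auto simp: eventually_sequentially)
  then have "integrable M (\<lambda>\<omega>. (norm (?e n \<omega>))\<^sup>2)"
    by (intro integrableI_bounded) (auto intro: order.strict_trans)
  then have "integrable M (\<lambda>\<omega>. 2 * (norm (?e n \<omega>))\<^sup>2 + 2 * (norm (D n s t \<omega>))\<^sup>2)" using D_sq[OF st] by simp
  then show X2: "integrable M (\<lambda>\<omega>. (norm (?X \<omega>))\<^sup>2)"
  proof (rule Bochner_Integration.integrable_bound)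
    show "AE \<omega> in M. norm ((norm (?X \<omega>))\<^sup>2) \<le> norm (2 * (norm (?e n \<omega>))\<^sup>2 + 2 * (norm (D n s t \<omega>))\<^sup>2)"
    proof (rule AE_I2)
      show "norm ((norm (?X \<omega>))\<^sup>2) \<le> norm (2 * (norm (?e n \<omega>))\<^sup>2 + 2 * (norm (D n s t \<omega>))\<^sup>2)" for \<omega>
        using norm_add_sq_le[of "?e n \<omega>" "D n s t \<omega>"] by simp
    qed
  qed measurable
  show e2: "integrable M (\<lambda>\<omega>. (norm (?e n \<omega>))\<^sup>2)" for n
  proof (rule Bochner_Integration.integrable_bound)
    show "integrable M (\<lambda>\<omega>. 2 * (norm (?X \<omega>))\<^sup>2 + 2 * (norm (D n s t \<omega>))\<^sup>2)" using X2 D_sq[OF st] by simp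
    show "AE \<omega> in M. norm ((norm (?e n \<omega>))\<^sup>2) \<le> norm (2 * (norm (?X \<omega>))\<^sup>2 + 2 * (norm (D n s t \<omega>))\<^sup>2)"
    proof (rule AE_I2)
      show "norm ((norm (?e n \<omega>))\<^sup>2) \<le> norm (2 * (norm (?X \<omega>))\<^sup>2 + 2 * (norm (D n s t \<omega>))\<^sup>2)" for \<omega>
        using norm_add_sq_le[of "?X \<omega>" "- D n s t \<omega>"] by simp
    qed
  qed measurable
  have "(\<lambda>n. ennreal (\<integral>\<omega>. (norm (?e n \<omega>))\<^sup>2 \<partial>M)) \<longlonglongrightarrow> ennreal 0"
    using increment_lim[OF st] by (simp add: nn_integral_eq_integral[OF e2])
  then show lim: "(\<lambda>n. \<integral>\<omega>. (norm (?e n \<omega>))\<^sup>2 \<partial>M) \<longlonglongrightarrow> 0"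
    by (subst (asm) tendsto_ennreal_iff) auto
  have sqint: "(\<integral>\<omega>. norm (f \<omega>) \<partial>M)\<^sup>2 \<le> (\<integral>\<omega>. (norm (f \<omega>))\<^sup>2 \<partial>M)" "integrable M f"
    if "integrable M (\<lambda>\<omega>. (norm (f \<omega>))\<^sup>2)" and [measurable]: "f \<in> borel_measurable M" for f :: "'w \<Rightarrow> complex"
    using Cauchy_Schwarz_integral[of "\<lambda>\<omega>. norm (f \<omega>)" M "\<lambda>_. 1"] that by (auto simp: prob_space integrable_norm_iff)
  show X1: "integrable M ?X" by (rule sqint(2)[OF X2]) measurable
  have sq0: "(\<lambda>n. sqrt (\<integral>\<omega>. (norm (?e n \<omega>))\<^sup>2 \<partial>M)) \<longlonglongrightarrow> 0" using tendsto_real_sqrt[OF lim] by simp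
  have "norm (\<integral>\<omega>. ?X \<omega> \<partial>M) \<le> sqrt (\<integral>\<omega>. (norm (?e n \<omega>))\<^sup>2 \<partial>M)" for n
  proof -
    have "(\<integral>\<omega>. ?X \<omega> \<partial>M) = (\<integral>\<omega>. ?e n \<omega> \<partial>M)"
      using X1 D_sq(3,4)[OF st] by simp
    also have "norm \<dots> \<le> (\<integral>\<omega>. norm (?e n \<omega>) \<partial>M)" by (rule integral_norm_bound)
    also have "\<dots> \<le> sqrt (\<integral>\<omega>. (norm (?e n \<omega>))\<^sup>2 \<partial>M)"
      by (rule real_le_rsqrt, rule sqint(1)[OF e2]) measurable
    finally show ?thesis .
  qed
  then have "norm (\<integral>\<omega>. ?X \<omega> \<partial>M) \<le> 0" by (intro LIMSEQ_le_const[OF sq0]) auto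
  then show "(\<integral>\<omega>. ?X \<omega> \<partial>M) = 0" by simp
  define x where "x = sqrt (\<integral>\<omega>. (norm (?X \<omega>))\<^sup>2 \<partial>M)"
  have "\<bar>(\<integral>\<omega>. (norm (D n s t \<omega>))\<^sup>2 \<partial>M) - (\<integral>\<omega>. (norm (?X \<omega>))\<^sup>2 \<partial>M)\<bar> \<le> (\<integral>\<omega>. (norm (?e n \<omega>))\<^sup>2 \<partial>M) + 2 * (sqrt (\<integral>\<omega>. (norm (?e n \<omega>))\<^sup>2 \<partial>M) * x)" for n
  proof -
    have m: "(\<lambda>\<omega>. norm (?e n \<omega>)) \<in> borel_measurable M" "(\<lambda>\<omega>. norm (?X \<omega>)) \<in> borel_measurable M" by measurable
    note CS = Cauchy_Schwarz_integral[OF m e2 X2]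
    note ex = CS(1)
    have eqd: "(\<integral>\<omega>. (norm (D n s t \<omega>))\<^sup>2 \<partial>M) - (\<integral>\<omega>. (norm (?X \<omega>))\<^sup>2 \<partial>M) = (\<integral>\<omega>. (norm (D n s t \<omega>))\<^sup>2 - (norm (?X \<omega>))\<^sup>2 \<partial>M)"
      using X2 D_sq(1)[OF st] by simp
    have "\<bar>(\<integral>\<omega>. (norm (D n s t \<omega>))\<^sup>2 \<partial>M) - (\<integral>\<omega>. (norm (?X \<omega>))\<^sup>2 \<partial>M)\<bar>
      \<le> (\<integral>\<omega>. (norm (?e n \<omega>))\<^sup>2 + 2 * (norm (?e n \<omega>) * norm (?X \<omega>)) \<partial>M)"
      unfolding eqd
    proof (rule order_trans[OF integral_abs_bound], rule integral_mono)
      show "integrable M (\<lambda>\<omega>. \<bar>(norm (D n s t \<omega>))\<^sup>2 - (norm (?X \<omega>))\<^sup>2\<bar>)" using X2 D_sq(1)[OF st] by simp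
      show "integrable M (\<lambda>\<omega>. (norm (?e n \<omega>))\<^sup>2 + 2 * (norm (?e n \<omega>) * norm (?X \<omega>)))" using e2 ex by simp
      fix \<omega>
      define p q r where "p = norm (D n s t \<omega>)" and "q = norm (?X \<omega>)" and "r = norm (?e n \<omega>)"
      have "\<bar>p - q\<bar> \<le> r" unfolding p_def q_def r_def using norm_triangle_ineq3[of "D n s t \<omega>" "?X \<omega>"] by (simp add: norm_minus_commute)
      moreover have nn: "0 \<le> p" "0 \<le> q" "0 \<le> r" by (auto simp: p_def q_def r_def)
      moreover from calculation have "p + q \<le> r + 2 * q" by linarith
      ultimately have "\<bar>p - q\<bar> * (p + q) \<le> r * (r + 2 * q)" by (intro mult_mono) linarith+
      moreover have "\<bar>p\<^sup>2 - q\<^sup>2\<bar> = \<bar>p - q\<bar> * (p + q)"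
      proof -
        have "p\<^sup>2 - q\<^sup>2 = (p - q) * (p + q)" by (simp add: power2_eq_square square_diff_square_factored mult.commute)
        moreover have "\<bar>p + q\<bar> = p + q" using nn by simp
        ultimately show ?thesis by (simp only: abs_mult)
      qed
      ultimately show "\<bar>(norm (D n s t \<omega>))\<^sup>2 - (norm (?X \<omega>))\<^sup>2\<bar> \<le> (norm (?e n \<omega>))\<^sup>2 + 2 * (norm (?e n \<omega>) * norm (?X \<omega>))"
        unfolding p_def[symmetric] q_def[symmetric] r_def[symmetric] by (simp add: power2_eq_square algebra_simps)
    qed
    also have "\<dots> = (\<integral>\<omega>. (norm (?e n \<omega>))\<^sup>2 \<partial>M) + 2 * (\<integral>\<omega>. norm (?e n \<omega>) * norm (?X \<omega>) \<partial>M)"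
      using Bochner_Integration.integral_add[OF e2 integrable_mult_right[OF ex, of 2], of n] unfolding integral_mult_right_zero .
    also have "(\<integral>\<omega>. norm (?e n \<omega>) * norm (?X \<omega>) \<partial>M) \<le> sqrt (\<integral>\<omega>. (norm (?e n \<omega>))\<^sup>2 \<partial>M) * x"
      unfolding x_def real_sqrt_mult[symmetric] by (rule real_le_rsqrt, rule CS(2))
    finally show ?thesis by simp
  qed
  note le = this
  have "(\<lambda>n. (\<integral>\<omega>. (norm (?e n \<omega>))\<^sup>2 \<partial>M) + 2 * (sqrt (\<integral>\<omega>. (norm (?e n \<omega>))\<^sup>2 \<partial>M) * x)) \<longlonglongrightarrow> 0 + 2 * (0 * x)"
    by (intro tendsto_intros lim sq0)
  then have "(\<lambda>n. (\<integral>\<omega>. (norm (?e n \<omega>))\<^sup>2 \<partial>M) + 2 * (sqrt (\<integral>\<omega>. (norm (?e n \<omega>))\<^sup>2 \<partial>M) * x)) \<longlonglongrightarrow> 0" by simp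
  from Lim_null_comparison[OF always_eventually[OF allI] this, of "\<lambda>n. (\<integral>\<omega>. (norm (D n s t \<omega>))\<^sup>2 \<partial>M) - (\<integral>\<omega>. (norm (?X \<omega>))\<^sup>2 \<partial>M)"]
  have "(\<lambda>n. (\<integral>\<omega>. (norm (D n s t \<omega>))\<^sup>2 \<partial>M) - (\<integral>\<omega>. (norm (?X \<omega>))\<^sup>2 \<partial>M)) \<longlonglongrightarrow> 0"
    using le unfolding real_norm_def .
  then have "(\<lambda>n. \<integral>\<omega>. (norm (D n s t \<omega>))\<^sup>2 \<partial>M) \<longlonglongrightarrow> (\<integral>\<omega>. (norm (?X \<omega>))\<^sup>2 \<partial>M)" by (rule LIM_zero_cancel)
  moreover have "(\<lambda>n. \<integral>\<omega>. (norm (D n s t \<omega>))\<^sup>2 \<partial>M) \<longlonglongrightarrow> (t - s) * \<sigma>"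
    unfolding D_sq(2)[OF st] \<sigma>_def by (intro tendsto_intros summable_LIMSEQ c)
  ultimately show "(\<integral>\<omega>. (norm (?X \<omega>))\<^sup>2 \<partial>M) = (t - s) * \<sigma>" by (rule LIMSEQ_unique)
qed

text \<open>A mean square limit is an almost sure limit along a subsequence.  The limit of that
  subsequence is determined by the Brownian increments, which \<open>Z t - Z s\<close> itself is only up to a null
  set; independence is a statement about the former.\<close>

lemma increment_version:
  assumes st: "0 \<le> s" "s < t"
  obtains Y where "Y \<in> borel_measurable (increment_algebra M B s t)" "AE \<omega> in M. Z t \<omega> - Z s \<omega> = Y \<omega>"
proof -
  have "(\<lambda>n. \<integral>\<omega>. norm ((norm (Z t \<omega> - Z s \<omega> - D n s t \<omega>))\<^sup>2) \<partial>M) \<longlonglongrightarrow> 0"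
    using increment_error[OF st] by (simp only: real_norm_def abs_power2)
  note sub = tendsto_L1_AE_subseq[where u="\<lambda>n \<omega>. (norm (Z t \<omega> - Z s \<omega> - D n s t \<omega>))\<^sup>2", OF increment_error_integrable[OF st] this]
  obtain r where r: "AE \<omega> in M. (\<lambda>n. (norm (Z t \<omega> - Z s \<omega> - D (r n) s t \<omega>))\<^sup>2) \<longlonglongrightarrow> 0"
    using sub by (elim exE conjE)
  define Y where "Y \<omega> = lim (\<lambda>n. D (r n) s t \<omega>)" for \<omega>
  have "Y \<in> borel_measurable (increment_algebra M B s t)"
    unfolding Y_def[abs_def] by (intro borel_measurable_lim_metric D_increment_measurable st)
  moreover have "AE \<omega> in M. Z t \<omega> - Z s \<omega> = Y \<omega>"
    using r
  proof eventually_elim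
    case (elim \<omega>)
    have "(\<lambda>n. norm (Z t \<omega> - Z s \<omega> - D (r n) s t \<omega>)) \<longlonglongrightarrow> 0"
      using tendsto_real_sqrt[OF elim] by simp
    from tendsto_diff[OF tendsto_const[of "Z t \<omega> - Z s \<omega>"] tendsto_norm_zero_cancel[OF this]]
    have "(\<lambda>n. D (r n) s t \<omega>) \<longlonglongrightarrow> Z t \<omega> - Z s \<omega>" by simp
    then show ?case unfolding Y_def by (simp add: limI)
  qed
  ultimately show ?thesis using that by blast
qed

lemma
  fixes X :: "'w \<Rightarrow> 'b::{real_normed_field,banach,second_countable_topology}" and g :: "complex \<Rightarrow> 'b"
  assumes st: "0 \<le> s" "s < t" and X: "X \<in> borel_measurable (augment M (F s))" "integrable M X"
    and g: "g \<in> borel_measurable borel" "integrable M (\<lambda>\<omega>. g (Z t \<omega> - Z s \<omega>))"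
  shows indep_increment_integrable: "integrable M (\<lambda>\<omega>. X \<omega> * g (Z t \<omega> - Z s \<omega>))"
    and indep_increment_integral: "(\<integral>\<omega>. X \<omega> * g (Z t \<omega> - Z s \<omega>) \<partial>M) = (\<integral>\<omega>. X \<omega> \<partial>M) * (\<integral>\<omega>. g (Z t \<omega> - Z s \<omega>) \<partial>M)"
proof -
  note IA = brownian_increment_algebra[OF prob_space_axioms bf st]
  obtain Y where Y: "Y \<in> borel_measurable (increment_algebra M B s t)" "AE \<omega> in M. Z t \<omega> - Z s \<omega> = Y \<omega>"
    using increment_version[OF st] by blast
  have gY: "(\<lambda>\<omega>. g (Y \<omega>)) \<in> borel_measurable (increment_algebra M B s t)" by (rule measurable_compose[OF Y(1) g(1)])
  have m: "(\<lambda>\<omega>. g (Z t \<omega> - Z s \<omega>)) \<in> borel_measurable M" "(\<lambda>\<omega>. g (Y \<omega>)) \<in> borel_measurable M"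
    using borel_measurable_integrable[OF g(2)] measurable_from_subalg[OF IA(2) gY] by auto
  have Xm: "X \<in> borel_measurable M" by (rule measurable_from_subalg[OF subalgebra_augment[OF sub] X(1)])
  have ae: "AE \<omega> in M. g (Z t \<omega> - Z s \<omega>) = g (Y \<omega>)" using Y(2) by eventually_elim simp
  have iY: "integrable M (\<lambda>\<omega>. g (Y \<omega>))" using g(2) integrable_cong_AE[OF m ae] by simp
  have iv: "indep_var borel X borel (\<lambda>\<omega>. g (Y \<omega>))"
    by (rule indep_var_of_indep_set[OF indep_set_augment[OF sub IA(1)] subalgebra_augment[OF sub] IA(2) X(1) gY])
  have mX: "(\<lambda>\<omega>. X \<omega> * g (Z t \<omega> - Z s \<omega>)) \<in> borel_measurable M" "(\<lambda>\<omega>. X \<omega> * g (Y \<omega>)) \<in> borel_measurable M"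
    by (rule borel_measurable_times[OF Xm m(1)], rule borel_measurable_times[OF Xm m(2)])
  have aeX: "AE \<omega> in M. X \<omega> * g (Z t \<omega> - Z s \<omega>) = X \<omega> * g (Y \<omega>)" using Y(2) by eventually_elim simp
  show "integrable M (\<lambda>\<omega>. X \<omega> * g (Z t \<omega> - Z s \<omega>))"
    using indep_var_integrable[OF iv X(2) iY] integrable_cong_AE[OF mX aeX] by simp
  show "(\<integral>\<omega>. X \<omega> * g (Z t \<omega> - Z s \<omega>) \<partial>M) = (\<integral>\<omega>. X \<omega> \<partial>M) * (\<integral>\<omega>. g (Z t \<omega> - Z s \<omega>) \<partial>M)"
    unfolding integral_cong_AE[OF mX aeX] integral_cong_AE[OF m ae] by (rule indep_var_lebesgue_integral[OF iv X(2) iY])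
qed

lemma
  assumes st: "0 \<le> s" "s \<le> t" and X: "X \<in> borel_measurable (augment M (F s))" "integrable M X"
  shows noise_mult_integrable: "integrable M (\<lambda>\<omega>. X \<omega> * (Z t \<omega> - Z s \<omega>))"
    and noise_mult_mean: "(\<integral>\<omega>. X \<omega> * (Z t \<omega> - Z s \<omega>) \<partial>M) = 0"
proof -
  have "integrable M (\<lambda>\<omega>. X \<omega> * (Z t \<omega> - Z s \<omega>)) \<and> (\<integral>\<omega>. X \<omega> * (Z t \<omega> - Z s \<omega>) \<partial>M) = 0"
  proof (cases "s = t")
    case False
    with st have st: "0 \<le> s" "s < t" by auto
    have m: "(\<lambda>z :: complex. z) \<in> borel_measurable borel" by measurable
    note I = m increment_integrable[OF st]
    show ?thesis
      using indep_increment_integrable[OF st X I] indep_increment_integral[OF st X I] increment_mean[OF st] by simp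
  qed simp
  then show "integrable M (\<lambda>\<omega>. X \<omega> * (Z t \<omega> - Z s \<omega>))" "(\<integral>\<omega>. X \<omega> * (Z t \<omega> - Z s \<omega>) \<partial>M) = 0" by auto
qed

lemma
  fixes X :: "'w \<Rightarrow> real"
  assumes st: "0 \<le> s" "s \<le> t" and X: "X \<in> borel_measurable (augment M (F s))" "integrable M X"
  shows noise_sq_mult_integrable: "integrable M (\<lambda>\<omega>. X \<omega> * (norm (Z t \<omega> - Z s \<omega>))\<^sup>2)"
    and noise_sq_mult_mean: "(\<integral>\<omega>. X \<omega> * (norm (Z t \<omega> - Z s \<omega>))\<^sup>2 \<partial>M) = (\<integral>\<omega>. X \<omega> \<partial>M) * ((t - s) * \<sigma>)"
proof -
  have "integrable M (\<lambda>\<omega>. X \<omega> * (norm (Z t \<omega> - Z s \<omega>))\<^sup>2) \<and>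
    (\<integral>\<omega>. X \<omega> * (norm (Z t \<omega> - Z s \<omega>))\<^sup>2 \<partial>M) = (\<integral>\<omega>. X \<omega> \<partial>M) * ((t - s) * \<sigma>)"
  proof (cases "s = t")
    case False
    with st have st: "0 \<le> s" "s < t" by auto
    have m: "(\<lambda>z :: complex. (norm z)\<^sup>2) \<in> borel_measurable borel" by measurable
    note I = m increment_sq_integrable[OF st]
    show ?thesis
      using indep_increment_integrable[OF st X I] indep_increment_integral[OF st X I] increment_sq_integral[OF st] by simp
  qed simp
  then show "integrable M (\<lambda>\<omega>. X \<omega> * (norm (Z t \<omega> - Z s \<omega>))\<^sup>2)"
    "(\<integral>\<omega>. X \<omega> * (norm (Z t \<omega> - Z s \<omega>))\<^sup>2 \<partial>M) = (\<integral>\<omega>. X \<omega> \<partial>M) * ((t - s) * \<sigma>)" by auto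
qed

lemma Z_0: "AE \<omega> in M. Z 0 \<omega> = 0"
proof -
  have [measurable]: "Z 0 \<in> borel_measurable M" by (rule Z_meas) simp
  have "\<forall>j. AE \<omega> in M. B j 0 \<omega> = 0" using bf unfolding brownian_family_def by blast
  then have "AE \<omega> in M. B (\<iota> i) 0 \<omega> = 0" for i by blast
  then have "AE \<omega> in M. \<forall>i. B (\<iota> i) 0 \<omega> = 0" by (simp add: AE_all_countable)
  then have "(\<integral>\<^sup>+\<omega>. ennreal ((norm (Z 0 \<omega> - (\<Sum>i<n. of_real (B (\<iota> i) 0 \<omega>) * c i)))\<^sup>2) \<partial>M) = (\<integral>\<^sup>+\<omega>. ennreal ((norm (Z 0 \<omega>))\<^sup>2) \<partial>M)" for n
    by (intro nn_integral_cong_AE) (elim eventually_mono, simp)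
  note eq = this
  have "(\<lambda>n :: nat. \<integral>\<^sup>+\<omega>. ennreal ((norm (Z 0 \<omega>))\<^sup>2) \<partial>M) \<longlonglongrightarrow> 0"
    using Z_lim[of 0] unfolding eq by simp
  from LIMSEQ_unique[OF tendsto_const this] have "(\<integral>\<^sup>+\<omega>. ennreal ((norm (Z 0 \<omega>))\<^sup>2) \<partial>M) = 0" .
  then have "AE \<omega> in M. ennreal ((norm (Z 0 \<omega>))\<^sup>2) = 0" by (subst (asm) nn_integral_0_iff_AE) auto
  then show ?thesis by eventually_elim (simp add: ennreal_eq_0_iff)
qed

end

section \<open>The energy identity for one Fourier mode\<close>

lemma integrable_lebesgue_on_Icc:
  fixes f :: "real \<Rightarrow> 'b::euclidean_space"
  assumes "continuous_on {a..b} f"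
  shows "integrable (lebesgue_on {a..b}) f" "(LINT x|lebesgue_on {a..b}. f x) = integral {a..b} f"
proof -
  show i: "integrable (lebesgue_on {a..b}) f"
    by (intro absolutely_integrable_imp_integrable absolutely_integrable_continuous_real assms) simp
  show "(LINT x|lebesgue_on {a..b}. f x) = integral {a..b} f"
    by (rule lebesgue_integral_eq_integral[OF i]) simp
qed

text \<open>The process \<open>h\<close> will dominate all terms of the equation, and \<open>\<theta>\<close> is the weight that it
  generates.  The names \<open>integrable_Q\<close> and \<open>integral_Q\<close> refer to the product of time and probability.\<close>

locale weight = prob_space M for M :: "'w measure" +
  fixes F :: "real \<Rightarrow> 'w measure" and h :: "real \<Rightarrow> 'w \<Rightarrow> real" and t \<epsilon> :: real
  assumes sub: "\<And>t. subalgebra M (F t)" and mono: "\<And>s r. s \<le> r \<Longrightarrow> sets (F s) \<subseteq> sets (F r)"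
    and t: "0 < t" and \<epsilon>: "0 < \<epsilon>"
    and h_meas: "\<And>s. s \<in> {0..t} \<Longrightarrow> h s \<in> borel_measurable (augment M (F s))"
    and h_cont: "\<And>\<omega>. \<omega> \<in> space M \<Longrightarrow> continuous_on {0..t} (\<lambda>s. h s \<omega>)"
    and h_nonneg: "\<And>s \<omega>. s \<in> {0..t} \<Longrightarrow> \<omega> \<in> space M \<Longrightarrow> 0 \<le> h s \<omega>"
begin

definition \<theta> :: "real \<Rightarrow> 'w \<Rightarrow> real" where
  "\<theta> s \<omega> = exp (- \<epsilon> * integral {0..s} (\<lambda>r. h r \<omega>))"

definition H :: "real \<Rightarrow> 'w \<Rightarrow> real" where "H s \<omega> = h s \<omega> * \<theta> s \<omega>"

abbreviation Q :: "(real \<times> 'w) measure" where "Q \<equiv> lebesgue_on {0..t} \<Otimes>\<^sub>M M"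

abbreviation integrable_Q :: "(real \<Rightarrow> 'w \<Rightarrow> real) \<Rightarrow> bool"
  where "integrable_Q g \<equiv> integrable Q (\<lambda>p. g (fst p) (snd p))"

abbreviation integral_Q :: "(real \<Rightarrow> 'w \<Rightarrow> real) \<Rightarrow> real"
  where "integral_Q g \<equiv> (\<integral>p. g (fst p) (snd p) \<partial>Q)"

sublocale P: pair_sigma_finite "lebesgue_on {0..t}" M
proof -
  have "finite_measure (lebesgue_on {0..t})" by (rule finite_measure_lebesgue_on) simp
  then show "pair_sigma_finite (lebesgue_on {0..t}) M"
    unfolding pair_sigma_finite_def using finite_measure.axioms(1) sigma_finite_measure_axioms by blast
qed

lemma augment_meas: "f \<in> borel_measurable (augment M (F s)) \<Longrightarrow> f \<in> borel_measurable M"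
  by (rule measurable_from_subalg[OF subalgebra_augment[OF sub]])

lemma augment_mono_meas:
  assumes "s \<le> r" "f \<in> borel_measurable (augment M (F s))"
  shows "f \<in> borel_measurable (augment M (F r))"
  by (rule measurable_from_subalg[OF _ assms(2)])
    (simp add: subalgebra_def space_augment augment_mono[OF sub sub mono[OF assms(1)]])

lemma \<theta>_pos: "0 < \<theta> s \<omega>" by (simp add: \<theta>_def)

lemma \<theta>_le_1: assumes "s \<in> {0..t}" "\<omega> \<in> space M" shows "\<theta> s \<omega> \<le> 1"
proof -
  have "0 \<le> integral {0..s} (\<lambda>r. h r \<omega>)" using assms by (intro integral_nonneg integrable_continuous_real continuous_on_subset[OF h_cont] h_nonneg) auto
  then show ?thesis using \<epsilon> by (simp add: \<theta>_def)
qed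

lemma \<theta>_0: "\<theta> 0 \<omega> = 1" by (simp add: \<theta>_def)

lemma \<theta>_deriv:
  assumes "\<omega> \<in> space M" "s \<in> {0..t}"
  shows "((\<lambda>s. \<theta> s \<omega>) has_real_derivative - \<epsilon> * H s \<omega>) (at s within {0..t})"
proof -
  have "((\<lambda>s. integral {0..s} (\<lambda>r. h r \<omega>)) has_real_derivative h s \<omega>) (at s within {0..t})"
    using integral_has_vector_derivative[OF h_cont[OF assms(1)] assms(2)] by (simp add: has_real_derivative_iff_has_vector_derivative)
  then show ?thesis unfolding \<theta>_def[abs_def] H_def
    by (auto intro!: derivative_eq_intros simp: \<theta>_def)
qed

lemma \<theta>_cont: "\<omega> \<in> space M \<Longrightarrow> continuous_on {0..t} (\<lambda>s. \<theta> s \<omega>)"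
  by (rule DERIV_continuous_on[OF \<theta>_deriv])

lemma H_cont: "\<omega> \<in> space M \<Longrightarrow> continuous_on {0..t} (\<lambda>s. H s \<omega>)"
  unfolding H_def by (intro continuous_intros h_cont \<theta>_cont)

lemma H_nonneg: "s \<in> {0..t} \<Longrightarrow> \<omega> \<in> space M \<Longrightarrow> 0 \<le> H s \<omega>"
  unfolding H_def using h_nonneg \<theta>_pos by (intro mult_nonneg_nonneg) (auto intro: less_imp_le)

lemma \<theta>_meas:
  assumes s: "s \<in> {0..t}" shows "\<theta> s \<in> borel_measurable (augment M (F s))"
proof -
  let ?N = "augment M (F s)"
  have "(\<lambda>p. h (fst p) (snd p)) \<in> borel_measurable (lebesgue_on {0..s} \<Otimes>\<^sub>M ?N)"
    using s by (intro joint_measurable_continuous augment_mono_meas[OF _ h_meas] continuous_on_subset[OF h_cont]) (auto simp: space_augment)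
  from measurable_compose[OF measurable_pair_swap' this]
  have "(\<lambda>(\<omega>, r). h r \<omega>) \<in> borel_measurable (?N \<Otimes>\<^sub>M lebesgue_on {0..s})" by (simp add: case_prod_unfold)
  moreover have "sigma_finite_measure (lebesgue_on {0..s})"
    by (rule finite_measure.axioms(1), rule finite_measure_lebesgue_on) simp
  ultimately have "(\<lambda>\<omega>. LINT r|lebesgue_on {0..s}. h r \<omega>) \<in> borel_measurable ?N"
    by (intro sigma_finite_measure.borel_measurable_lebesgue_integral)
  then have "(\<lambda>\<omega>. integral {0..s} (\<lambda>r. h r \<omega>)) \<in> borel_measurable ?N"
  proof (rule measurable_cong[THEN iffD1, rotated])
    fix \<omega> assume "\<omega> \<in> space ?N"
    then show "(LINT r|lebesgue_on {0..s}. h r \<omega>) = integral {0..s} (\<lambda>r. h r \<omega>)"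
      using s by (intro integrable_lebesgue_on_Icc(2) continuous_on_subset[OF h_cont]) (auto simp: space_augment)
  qed
  then show ?thesis unfolding \<theta>_def[abs_def] by measurable
qed

lemma H_meas: "s \<in> {0..t} \<Longrightarrow> H s \<in> borel_measurable (augment M (F s))"
  unfolding H_def[abs_def] by (intro borel_measurable_times h_meas \<theta>_meas)

text \<open>\<open>H = h \<theta>\<close> is the derivative of \<open>- \<theta> / \<epsilon>\<close>.  This is the source of all integrability: the
  time integral of \<open>H\<close> is bounded on every path, independently of \<open>h\<close>.\<close>

lemma H_integral:
  assumes "\<omega> \<in> space M"
  shows "(LINT s|lebesgue_on {0..t}. H s \<omega>) = (1 - \<theta> t \<omega>) / \<epsilon>"
proof -
  have "((\<lambda>s. - \<epsilon> * H s \<omega>) has_integral (\<theta> t \<omega> - \<theta> 0 \<omega>)) {0..t}"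
  proof (rule fundamental_theorem_of_calculus)
    fix s assume "s \<in> {0..t}"
    from \<theta>_deriv[OF assms this]
    show "((\<lambda>s. \<theta> s \<omega>) has_vector_derivative - \<epsilon> * H s \<omega>) (at s within {0..t})"
      by (simp only: has_real_derivative_iff_has_vector_derivative)
  qed (use t in simp)
  then have "integral {0..t} (\<lambda>s. - \<epsilon> * H s \<omega>) = \<theta> t \<omega> - \<theta> 0 \<omega>" by (rule integral_unique)
  then have "- \<epsilon> * integral {0..t} (\<lambda>s. H s \<omega>) = \<theta> t \<omega> - 1" unfolding integral_mult_right \<theta>_0 .
  then show ?thesis using \<epsilon> unfolding integrable_lebesgue_on_Icc(2)[OF H_cont[OF assms]] by (simp add: field_simps)
qed

lemma process_meas:
  fixes g :: "real \<Rightarrow> 'w \<Rightarrow> 'b::{banach,second_countable_topology}"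
  assumes "\<And>s. s \<in> {0..t} \<Longrightarrow> g s \<in> borel_measurable M"
    and "\<And>\<omega>. \<omega> \<in> space M \<Longrightarrow> continuous_on {0..t} (\<lambda>s. g s \<omega>)"
  shows "(\<lambda>p. g (fst p) (snd p)) \<in> borel_measurable Q"
  using t assms by (intro joint_measurable_continuous) auto

lemma H_joint: "(\<lambda>p. H (fst p) (snd p)) \<in> borel_measurable Q"
  by (intro process_meas augment_meas[OF H_meas] H_cont)

lemma space_Q: "p \<in> space Q \<longleftrightarrow> fst p \<in> {0..t} \<and> snd p \<in> space M"
  by (cases p) (auto simp: space_pair_measure)

lemma H_mult:
  fixes Y :: "'w \<Rightarrow> real"
  assumes Y: "integrable M Y" "\<And>\<omega>. \<omega> \<in> space M \<Longrightarrow> 0 \<le> Y \<omega>"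
  shows H_mult_integrable: "integrable_Q (\<lambda>s \<omega>. H s \<omega> * Y \<omega>)"
    and H_mult_integral: "integral_Q (\<lambda>s \<omega>. H s \<omega> * Y \<omega>) = (\<integral>\<omega>. (1 - \<theta> t \<omega>) * Y \<omega> \<partial>M) / \<epsilon>"
proof -
  have Ym [measurable]: "Y \<in> borel_measurable M" using Y(1) by simp
  have tt: "t \<in> {0..t}" using t by simp
  have [measurable]: "\<theta> t \<in> borel_measurable M" by (rule augment_meas[OF \<theta>_meas[OF tt]])
  have m: "(\<lambda>p. H (fst p) (snd p) * Y (snd p)) \<in> borel_measurable Q"
    by (intro borel_measurable_times H_joint measurable_compose[OF measurable_snd Ym])
  have in_int: "integrable (lebesgue_on {0..t}) (\<lambda>s. H s \<omega> * Y \<omega>)" if "\<omega> \<in> space M" for \<omega>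
    using integrable_lebesgue_on_Icc(1)[OF H_cont[OF that]] by simp
  have inner: "(LINT s|lebesgue_on {0..t}. H s \<omega> * Y \<omega>) = (1 - \<theta> t \<omega>) * Y \<omega> / \<epsilon>" if "\<omega> \<in> space M" for \<omega>
    using H_integral[OF that] by simp
  have oi: "integrable M (\<lambda>\<omega>. (1 - \<theta> t \<omega>) * Y \<omega> / \<epsilon>)"
  proof (intro integrable_divide Bochner_Integration.integrable_bound[OF Y(1)] AE_I2)
    fix \<omega> assume w: "\<omega> \<in> space M"
    have "\<bar>1 - \<theta> t \<omega>\<bar> \<le> 1" using \<theta>_le_1[OF tt w] \<theta>_pos[of t \<omega>] by simp
    then show "norm ((1 - \<theta> t \<omega>) * Y \<omega>) \<le> norm (Y \<omega>)" by (simp add: abs_mult mult_left_le_one_le)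
  qed measurable
  show int: "integrable_Q (\<lambda>s \<omega>. H s \<omega> * Y \<omega>)"
  proof (rule integrableI_nonneg[OF m])
    show "AE p in Q. 0 \<le> H (fst p) (snd p) * Y (snd p)"
      by (rule AE_I2) (auto simp: space_Q intro!: mult_nonneg_nonneg H_nonneg Y(2))
    have "(\<integral>\<^sup>+p. ennreal (H (fst p) (snd p) * Y (snd p)) \<partial>Q) = (\<integral>\<^sup>+\<omega>. (\<integral>\<^sup>+s. ennreal (H s \<omega> * Y \<omega>) \<partial>lebesgue_on {0..t}) \<partial>M)"
      using P.nn_integral_snd[of "\<lambda>p. ennreal (H (fst p) (snd p) * Y (snd p))"] m by simp
    also have "\<dots> = (\<integral>\<^sup>+\<omega>. ennreal ((1 - \<theta> t \<omega>) * Y \<omega> / \<epsilon>) \<partial>M)"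
    proof (rule nn_integral_cong)
      fix \<omega> assume w: "\<omega> \<in> space M"
      show "(\<integral>\<^sup>+s. ennreal (H s \<omega> * Y \<omega>) \<partial>lebesgue_on {0..t}) = ennreal ((1 - \<theta> t \<omega>) * Y \<omega> / \<epsilon>)"
        unfolding inner[OF w, symmetric]
        by (rule nn_integral_eq_integral[OF in_int[OF w]]) (auto intro!: AE_I2 mult_nonneg_nonneg H_nonneg Y(2) w)
    qed
    also have "\<dots> < \<infinity>" using oi by (subst nn_integral_eq_integral[OF oi]) (auto intro!: AE_I2 divide_nonneg_pos mult_nonneg_nonneg Y(2) \<epsilon> \<theta>_le_1 tt)
    finally show "(\<integral>\<^sup>+p. ennreal (H (fst p) (snd p) * Y (snd p)) \<partial>Q) < \<infinity>" .
  qed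
  have "integral_Q (\<lambda>s \<omega>. H s \<omega> * Y \<omega>) = (\<integral>\<omega>. (LINT s|lebesgue_on {0..t}. H s \<omega> * Y \<omega>) \<partial>M)"
    using P.integral_snd[of "\<lambda>s \<omega>. H s \<omega> * Y \<omega>"] int by (simp add: case_prod_unfold)
  also have "\<dots> = (\<integral>\<omega>. (1 - \<theta> t \<omega>) * Y \<omega> / \<epsilon> \<partial>M)"
    by (rule Bochner_Integration.integral_cong[OF refl inner])
  finally show "integral_Q (\<lambda>s \<omega>. H s \<omega> * Y \<omega>) = (\<integral>\<omega>. (1 - \<theta> t \<omega>) * Y \<omega> \<partial>M) / \<epsilon>" by simp
qed

end

text \<open>One Fourier mode \<open>a\<close> of the solution, with drift \<open>b\<close> and noise \<open>Z\<close>.\<close>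

locale energy_mode = weight M F h t \<epsilon> + noise M F B \<iota> c Z
  for M :: "'w measure" and F h t \<epsilon> and B :: "'i \<Rightarrow> real \<Rightarrow> 'w \<Rightarrow> real" and \<iota> c Z +
  fixes a b :: "real \<Rightarrow> 'w \<Rightarrow> complex" and S :: "'w \<Rightarrow> real" and K :: real and a0 :: complex
  assumes a_meas: "\<And>s. s \<in> {0..t} \<Longrightarrow> a s \<in> borel_measurable (augment M (F s))"
    and b_meas: "\<And>s. s \<in> {0..t} \<Longrightarrow> b s \<in> borel_measurable (augment M (F s))"
    and a_cont: "\<And>\<omega>. \<omega> \<in> space M \<Longrightarrow> continuous_on {0..t} (\<lambda>s. a s \<omega>)"
    and b_cont: "\<And>\<omega>. \<omega> \<in> space M \<Longrightarrow> continuous_on {0..t} (\<lambda>s. b s \<omega>)"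
    and K: "0 \<le> K"
    and b_le: "\<And>s \<omega>. s \<in> {0..t} \<Longrightarrow> \<omega> \<in> space M \<Longrightarrow> norm (b s \<omega>) \<le> K * h s \<omega>"
    and ab_le: "\<And>s \<omega>. s \<in> {0..t} \<Longrightarrow> \<omega> \<in> space M \<Longrightarrow> norm (a s \<omega>) * norm (b s \<omega>) \<le> K * h s \<omega>"
    and a_le: "\<And>s \<omega>. s \<in> {0..t} \<Longrightarrow> \<omega> \<in> space M \<Longrightarrow> (norm (a s \<omega>))\<^sup>2 \<le> S \<omega>"
    and S: "integrable M S"
    and eq: "\<And>s. s \<in> {0..t} \<Longrightarrow> AE \<omega> in M. a s \<omega> = a0 + integral {0..s} (\<lambda>r. b r \<omega>) + Z s \<omega>"
begin

text \<open>The path with the noise frozen at its final value.\<close>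

definition y :: "real \<Rightarrow> 'w \<Rightarrow> complex" where "y s \<omega> = a0 + integral {0..s} (\<lambda>r. b r \<omega>) + Z t \<omega>"

text \<open>The time derivative of \<open>\<theta> |y|^2\<close>.\<close>

definition G :: "real \<Rightarrow> 'w \<Rightarrow> real" where
  "G s \<omega> = \<theta> s \<omega> * (2 * Re (cnj (y s \<omega>) * b s \<omega>)) - \<epsilon> * (H s \<omega> * (norm (y s \<omega>))\<^sup>2)"

text \<open>What is left of the mean of \<open>G\<close> once the increment between \<open>s\<close> and \<open>t\<close> has been averaged out.\<close>

definition E where
  "E s \<omega> = \<theta> s \<omega> * (2 * Re (cnj (a s \<omega>) * b s \<omega>)) - \<epsilon> * (H s \<omega> * (norm (a s \<omega>))\<^sup>2) - \<epsilon> * (H s \<omega> * ((t - s) * \<sigma>))"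

lemma y_deriv:
  assumes "\<omega> \<in> space M" "s \<in> {0..t}"
  shows "((\<lambda>s. y s \<omega>) has_vector_derivative b s \<omega>) (at s within {0..t})"
  unfolding y_def using integral_has_vector_derivative[OF b_cont[OF assms(1)] assms(2)]
  by (auto intro!: derivative_eq_intros)

lemma y_cont: "\<omega> \<in> space M \<Longrightarrow> continuous_on {0..t} (\<lambda>s. y s \<omega>)"
  using y_deriv by (intro continuous_on_vector_derivative) auto

lemma y_meas: assumes s: "s \<in> {0..t}" shows "y s \<in> borel_measurable M"
proof -
  have "(\<lambda>p. b (fst p) (snd p)) \<in> borel_measurable (lebesgue_on {0..s} \<Otimes>\<^sub>M M)"
    using s by (intro joint_measurable_continuous augment_meas[OF b_meas] continuous_on_subset[OF b_cont]) auto
  from measurable_compose[OF measurable_pair_swap' this]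
  have "(\<lambda>(\<omega>, r). b r \<omega>) \<in> borel_measurable (M \<Otimes>\<^sub>M lebesgue_on {0..s})" by (simp add: case_prod_unfold)
  moreover have "sigma_finite_measure (lebesgue_on {0..s})"
    by (rule finite_measure.axioms(1), rule finite_measure_lebesgue_on) simp
  ultimately have "(\<lambda>\<omega>. LINT r|lebesgue_on {0..s}. b r \<omega>) \<in> borel_measurable M"
    by (intro sigma_finite_measure.borel_measurable_lebesgue_integral)
  then have [measurable]: "(\<lambda>\<omega>. integral {0..s} (\<lambda>r. b r \<omega>)) \<in> borel_measurable M"
  proof (rule measurable_cong[THEN iffD1, rotated])
    fix \<omega> assume "\<omega> \<in> space M"
    then show "(LINT r|lebesgue_on {0..s}. b r \<omega>) = integral {0..s} (\<lambda>r. b r \<omega>)"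
      using s by (intro integrable_lebesgue_on_Icc(2) continuous_on_subset[OF b_cont]) auto
  qed
  have [measurable]: "Z t \<in> borel_measurable M" using t by (intro Z_meas) simp
  show ?thesis unfolding y_def[abs_def] by measurable
qed

lemma y_eq:
  assumes "s \<in> {0..t}" shows "AE \<omega> in M. y s \<omega> = a s \<omega> + (Z t \<omega> - Z s \<omega>)"
  using eq[OF assms] by eventually_elim (simp add: y_def)

lemma G_integral:
  assumes w: "\<omega> \<in> space M"
  shows "(LINT s|lebesgue_on {0..t}. G s \<omega>) = \<theta> t \<omega> * (norm (y t \<omega>))\<^sup>2 - (norm (y 0 \<omega>))\<^sup>2"
proof -
  have c: "continuous_on {0..t} (\<lambda>s. G s \<omega>)"
    unfolding G_def by (intro continuous_intros \<theta>_cont H_cont y_cont b_cont w)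
  have "((\<lambda>s. G s \<omega>) has_integral (\<theta> t \<omega> * (norm (y t \<omega>))\<^sup>2 - \<theta> 0 \<omega> * (norm (y 0 \<omega>))\<^sup>2)) {0..t}"
  proof (rule fundamental_theorem_of_calculus)
    fix s assume s: "s \<in> {0..t}"
    note yd = y_deriv[OF w s]
    have re: "((\<lambda>s. Re (y s \<omega>)) has_real_derivative Re (b s \<omega>)) (at s within {0..t})"
      and im: "((\<lambda>s. Im (y s \<omega>)) has_real_derivative Im (b s \<omega>)) (at s within {0..t})"
      using bounded_linear.has_vector_derivative[OF bounded_linear_Re yd] bounded_linear.has_vector_derivative[OF bounded_linear_Im yd]
      by (simp_all only: has_real_derivative_iff_has_vector_derivative)
    have "((\<lambda>s. \<theta> s \<omega> * ((Re (y s \<omega>))\<^sup>2 + (Im (y s \<omega>))\<^sup>2)) has_real_derivative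
       (- \<epsilon> * H s \<omega>) * ((Re (y s \<omega>))\<^sup>2 + (Im (y s \<omega>))\<^sup>2)
        + (2 * Re (y s \<omega>) * Re (b s \<omega>) + 2 * Im (y s \<omega>) * Im (b s \<omega>)) * \<theta> s \<omega>) (at s within {0..t})"
    proof (rule DERIV_mult[OF \<theta>_deriv[OF w s]])
      show "((\<lambda>s. (Re (y s \<omega>))\<^sup>2 + (Im (y s \<omega>))\<^sup>2) has_real_derivative
          2 * Re (y s \<omega>) * Re (b s \<omega>) + 2 * Im (y s \<omega>) * Im (b s \<omega>)) (at s within {0..t})"
        by (rule DERIV_cong[OF DERIV_add[OF DERIV_power[OF re, of 2] DERIV_power[OF im, of 2]]]) simp
    qed
    moreover have "(- \<epsilon> * H s \<omega>) * ((Re (y s \<omega>))\<^sup>2 + (Im (y s \<omega>))\<^sup>2)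
        + (2 * Re (y s \<omega>) * Re (b s \<omega>) + 2 * Im (y s \<omega>) * Im (b s \<omega>)) * \<theta> s \<omega> = G s \<omega>"
      by (simp add: G_def cmod_power2 algebra_simps)
    ultimately show "((\<lambda>s. \<theta> s \<omega> * (norm (y s \<omega>))\<^sup>2) has_vector_derivative G s \<omega>) (at s within {0..t})"
      by (simp only: cmod_power2 has_real_derivative_iff_has_vector_derivative)
  qed (use t in simp)
  then show ?thesis unfolding integrable_lebesgue_on_Icc(2)[OF c] by (simp add: integral_unique \<theta>_0)
qed

lemma S_nonneg: "\<omega> \<in> space M \<Longrightarrow> 0 \<le> S \<omega>"
  by (rule order_trans[OF zero_le_power2 a_le[of 0]]) (use t in auto)

lemma \<theta>b_le: "s \<in> {0..t} \<Longrightarrow> \<omega> \<in> space M \<Longrightarrow> \<theta> s \<omega> * norm (b s \<omega>) \<le> K * H s \<omega>"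
  using mult_left_mono[OF b_le less_imp_le[OF \<theta>_pos]] by (simp add: H_def algebra_simps)

lemma \<theta>ab_le: "s \<in> {0..t} \<Longrightarrow> \<omega> \<in> space M \<Longrightarrow> \<theta> s \<omega> * (norm (a s \<omega>) * norm (b s \<omega>)) \<le> K * H s \<omega>"
  using mult_left_mono[OF ab_le less_imp_le[OF \<theta>_pos]] by (simp add: H_def algebra_simps)

lemma H_le_HS:
  assumes "s \<in> {0..t}" "\<omega> \<in> space M"
  shows "H s \<omega> \<le> H s \<omega> * (1 + S \<omega>)" "H s \<omega> * S \<omega> \<le> H s \<omega> * (1 + S \<omega>)"
  using H_nonneg[OF assms] S_nonneg[OF assms(2)] by (auto simp: distrib_left)

lemma U_le:
  assumes s: "s \<in> {0..t}" "\<omega> \<in> space M"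
  shows "\<bar>\<theta> s \<omega> * (2 * Re (cnj (a s \<omega>) * b s \<omega>))\<bar> \<le> 2 * K * (H s \<omega> * (1 + S \<omega>))"
proof -
  have "\<bar>Re (cnj (a s \<omega>) * b s \<omega>)\<bar> \<le> norm (a s \<omega>) * norm (b s \<omega>)"
    using abs_Re_le_cmod[of "cnj (a s \<omega>) * b s \<omega>"] by (simp add: norm_mult)
  then have "\<theta> s \<omega> * \<bar>Re (cnj (a s \<omega>) * b s \<omega>)\<bar> \<le> \<theta> s \<omega> * (norm (a s \<omega>) * norm (b s \<omega>))"
    by (intro mult_left_mono less_imp_le[OF \<theta>_pos])
  also have "\<dots> \<le> K * H s \<omega>" by (rule \<theta>ab_le[OF s])
  also have "\<dots> \<le> K * (H s \<omega> * (1 + S \<omega>))" by (intro mult_left_mono H_le_HS s K)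
  finally show ?thesis using \<theta>_pos[of s \<omega>] by (simp add: abs_mult del: times_complex.sel)
qed

lemma Ha_le:
  assumes s: "s \<in> {0..t}" "\<omega> \<in> space M"
  shows "\<bar>H s \<omega> * (norm (a s \<omega>))\<^sup>2\<bar> \<le> 1 * (H s \<omega> * (1 + S \<omega>))"
proof -
  have "H s \<omega> * (norm (a s \<omega>))\<^sup>2 \<le> H s \<omega> * S \<omega>" by (intro mult_left_mono a_le s H_nonneg)
  then show ?thesis using H_le_HS(2)[OF s] H_nonneg[OF s] by (simp add: abs_mult)
qed

text \<open>With \<open>y = a + (Z t - Z s)\<close>, the terms of \<open>G\<close> that are linear in the increment have mean zero
  and the quadratic one has mean \<open>(t - s) \<sigma>\<close>, both by independence from the past.\<close>

lemma G_fixed_time: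
  assumes s: "s \<in> {0..t}" and HS: "integrable M (\<lambda>\<omega>. H s \<omega> * (1 + S \<omega>))"
  shows "integrable M (G s)" and "(\<integral>\<omega>. G s \<omega> \<partial>M) = (\<integral>\<omega>. E s \<omega> \<partial>M)"
    and "(\<integral>\<omega>. norm (G s \<omega>) \<partial>M) \<le> ((4 * K + 2 * \<epsilon>) + (2 * K + 2 * \<epsilon>) * (t * \<sigma>)) * (\<integral>\<omega>. H s \<omega> * (1 + S \<omega>) \<partial>M)"
proof -
  have s0: "0 \<le> s" "s \<le> t" using s by auto
  let ?D = "\<lambda>\<omega>. Z t \<omega> - Z s \<omega>"
  have [measurable]: "Z t \<in> borel_measurable M" "Z s \<in> borel_measurable M" using s by (auto intro: Z_meas)
  have am: "a s \<in> borel_measurable (augment M (F s))" and bm: "b s \<in> borel_measurable (augment M (F s))"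
    and \<theta>m: "\<theta> s \<in> borel_measurable (augment M (F s))" and Hm: "H s \<in> borel_measurable (augment M (F s))"
    using s by (auto intro: a_meas b_meas \<theta>_meas H_meas)
  note [measurable] = am[THEN augment_meas] bm[THEN augment_meas] \<theta>m[THEN augment_meas] Hm[THEN augment_meas] y_meas[OF s]
  note HSle = H_le_HS[OF s]
  have dom: "integrable M f" if [measurable]: "f \<in> borel_measurable M" and "\<And>\<omega>. \<omega> \<in> space M \<Longrightarrow> norm (f \<omega>) \<le> C * (H s \<omega> * (1 + S \<omega>))" for f :: "'w \<Rightarrow> 'b::{banach,second_countable_topology}" and C
    by (rule Bochner_Integration.integrable_bound[OF integrable_mult_right[OF HS, of C]])
      (use that(2) in \<open>auto intro!: AE_I2 intro: order_trans[OF _ abs_ge_self]\<close>)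
  have iH: "integrable M (H s)" by (rule dom[of _ 1]) (use HSle H_nonneg[OF s] in auto)
  have iU: "integrable M (\<lambda>\<omega>. \<theta> s \<omega> * (2 * Re (cnj (a s \<omega>) * b s \<omega>)))"
    by (rule dom[of _ "2 * K"], measurable) (unfold real_norm_def, rule U_le[OF s])
  have iHa: "integrable M (\<lambda>\<omega>. H s \<omega> * (norm (a s \<omega>))\<^sup>2)"
    by (rule dom[of _ 1], measurable) (unfold real_norm_def, rule Ha_le[OF s])
  \<comment> \<open>all factors that multiply the increment linearly\<close>
  define X where "X \<omega> = 2 * (of_real (\<theta> s \<omega>) * cnj (b s \<omega>)) - 2 * of_real \<epsilon> * (of_real (H s \<omega>) * cnj (a s \<omega>))" for \<omega>
  have Xm: "X \<in> borel_measurable (augment M (F s))"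
    unfolding X_def[abs_def] using am bm \<theta>m Hm by measurable
  have iX: "integrable M X"
  proof (rule dom[of _ "2 * K + 2 * \<epsilon>"])
    show "X \<in> borel_measurable M" by (rule augment_meas[OF Xm])
    fix \<omega> assume w: "\<omega> \<in> space M"
    have "norm (a s \<omega>) \<le> 1 + (norm (a s \<omega>))\<^sup>2"
    proof -
      have "0 \<le> (norm (a s \<omega>) - 1 / 2)\<^sup>2" by simp
      then show ?thesis by (simp add: power2_eq_square algebra_simps)
    qed
    also have "\<dots> \<le> 1 + S \<omega>" using a_le[OF s w] by simp
    finally have "H s \<omega> * norm (a s \<omega>) \<le> H s \<omega> * (1 + S \<omega>)" by (intro mult_left_mono H_nonneg s w)
    moreover have "\<theta> s \<omega> * norm (b s \<omega>) \<le> K * (H s \<omega> * (1 + S \<omega>))"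
      by (rule order_trans[OF \<theta>b_le[OF s w]]) (intro mult_left_mono HSle w K)
    moreover have "norm (X \<omega>) \<le> 2 * (\<theta> s \<omega> * norm (b s \<omega>)) + 2 * \<epsilon> * (H s \<omega> * norm (a s \<omega>))"
      unfolding X_def using \<theta>_pos[of s \<omega>] H_nonneg[OF s w] \<epsilon>
      by (intro order_trans[OF norm_triangle_ineq4]) (simp add: norm_mult)
    moreover have "2 * \<epsilon> * (H s \<omega> * norm (a s \<omega>)) \<le> 2 * \<epsilon> * (H s \<omega> * (1 + S \<omega>))"
      by (rule mult_left_mono[OF calculation(1)]) (use \<epsilon> in simp)
    ultimately show "norm (X \<omega>) \<le> (2 * K + 2 * \<epsilon>) * (H s \<omega> * (1 + S \<omega>))"
      by (simp add: distrib_right)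
  qed
  note iXD = noise_mult_integrable[OF s0 Xm iX] and eXD = noise_mult_mean[OF s0 Xm iX]
  note iHD = noise_sq_mult_integrable[OF s0 Hm iH] and eHD = noise_sq_mult_mean[OF s0 Hm iH]
  have iRe: "integrable M (\<lambda>\<omega>. Re (X \<omega> * ?D \<omega>))" and eRe: "(\<integral>\<omega>. Re (X \<omega> * ?D \<omega>) \<partial>M) = 0"
    using integrable_Re[OF iXD] integral_Re[OF iXD] eXD by (simp_all only: zero_complex.sel)
  have Geq: "AE \<omega> in M. G s \<omega> = \<theta> s \<omega> * (2 * Re (cnj (a s \<omega>) * b s \<omega>)) - \<epsilon> * (H s \<omega> * (norm (a s \<omega>))\<^sup>2)
      + Re (X \<omega> * ?D \<omega>) - \<epsilon> * (H s \<omega> * (norm (?D \<omega>))\<^sup>2)"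
    using y_eq[OF s]
  proof eventually_elim
    case (elim \<omega>)
    show ?case unfolding G_def elim X_def cmod_power2 by (simp add: power2_eq_square algebra_simps)
  qed
  have Gm [measurable]: "G s \<in> borel_measurable M" unfolding G_def[abs_def] by measurable
  have i3: "integrable M (\<lambda>\<omega>. \<theta> s \<omega> * (2 * Re (cnj (a s \<omega>) * b s \<omega>)) - \<epsilon> * (H s \<omega> * (norm (a s \<omega>))\<^sup>2)
      + Re (X \<omega> * ?D \<omega>) - \<epsilon> * (H s \<omega> * (norm (?D \<omega>))\<^sup>2))"
    by (intro Bochner_Integration.integrable_diff Bochner_Integration.integrable_add integrable_mult_right iU iHa iRe iHD)
  have Xb: "X \<in> borel_measurable M" by (rule augment_meas[OF Xm])
  note [measurable] = Xb
  show iG: "integrable M (G s)"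
    using integrable_cong_AE[OF Gm borel_measurable_integrable[OF i3] Geq] i3 by simp
  have "(\<integral>\<omega>. G s \<omega> \<partial>M) = (\<integral>\<omega>. \<theta> s \<omega> * (2 * Re (cnj (a s \<omega>) * b s \<omega>)) - \<epsilon> * (H s \<omega> * (norm (a s \<omega>))\<^sup>2)
      + Re (X \<omega> * ?D \<omega>) - \<epsilon> * (H s \<omega> * (norm (?D \<omega>))\<^sup>2) \<partial>M)"
    by (rule integral_cong_AE[OF Gm borel_measurable_integrable[OF i3] Geq])
  also have "\<dots> = (\<integral>\<omega>. \<theta> s \<omega> * (2 * Re (cnj (a s \<omega>) * b s \<omega>)) \<partial>M) - \<epsilon> * (\<integral>\<omega>. H s \<omega> * (norm (a s \<omega>))\<^sup>2 \<partial>M)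
      - \<epsilon> * ((\<integral>\<omega>. H s \<omega> \<partial>M) * ((t - s) * \<sigma>))"
    by (subst Bochner_Integration.integral_diff, (intro Bochner_Integration.integrable_diff Bochner_Integration.integrable_add integrable_mult_right iU iHa iRe iHD)+,
        subst Bochner_Integration.integral_add, (intro Bochner_Integration.integrable_diff integrable_mult_right iU iHa iRe)+,
        subst Bochner_Integration.integral_diff, (intro integrable_mult_right iU iHa)+)
      (simp only: integral_mult_right_zero eHD eRe add_0_right)
  also have "\<dots> = (\<integral>\<omega>. E s \<omega> \<partial>M)"
    unfolding E_def
    by (subst Bochner_Integration.integral_diff, (intro Bochner_Integration.integrable_diff integrable_mult_right integrable_mult_left iU iHa iH)+,
        subst Bochner_Integration.integral_diff, (intro integrable_mult_right iU iHa)+)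
      (simp only: integral_mult_right_zero integral_mult_left_zero)
  finally show "(\<integral>\<omega>. G s \<omega> \<partial>M) = (\<integral>\<omega>. E s \<omega> \<partial>M)" .
  let ?c1 = "4 * K + 2 * \<epsilon>" and ?c2 = "2 * K + 2 * \<epsilon>"
  have bound: "AE \<omega> in M. norm (G s \<omega>) \<le> ?c1 * (H s \<omega> * (1 + S \<omega>)) + ?c2 * (H s \<omega> * (norm (?D \<omega>))\<^sup>2)"
    using y_eq[OF s] AE_space
  proof eventually_elim
    case (elim \<omega>)
    note w = elim(2)
    define A d \<beta> where "A = norm (a s \<omega>)" and "d = norm (?D \<omega>)" and "\<beta> = norm (b s \<omega>)"
    have nn: "0 \<le> A" "0 \<le> d" "0 \<le> \<beta>" "0 \<le> H s \<omega>" "0 < \<theta> s \<omega>" using H_nonneg[OF s w] \<theta>_pos by (auto simp: A_def d_def \<beta>_def)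
    have d1: "d \<le> 1 + d\<^sup>2"
    proof -
      have "0 \<le> (d - 1 / 2)\<^sup>2" by simp
      then show ?thesis using nn by (simp add: power2_eq_square algebra_simps)
    qed
    have ny: "norm (y s \<omega>) \<le> A + d" unfolding elim(1) A_def d_def by (rule norm_triangle_ineq)
    have "\<bar>\<theta> s \<omega> * (2 * Re (cnj (y s \<omega>) * b s \<omega>))\<bar> \<le> 2 * (\<theta> s \<omega> * (norm (y s \<omega>) * \<beta>))"
      using abs_Re_le_cmod[of "cnj (y s \<omega>) * b s \<omega>"] nn by (simp add: abs_mult norm_mult \<beta>_def del: times_complex.sel)
    also have "\<dots> \<le> 2 * (\<theta> s \<omega> * ((A + d) * \<beta>))" using ny nn by (intro mult_left_mono mult_right_mono) auto
    also have "\<dots> = 2 * (\<theta> s \<omega> * (A * \<beta>)) + 2 * (\<theta> s \<omega> * \<beta> * d)" by (simp add: algebra_simps)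
    also have "\<dots> \<le> 2 * (K * H s \<omega>) + 2 * (K * H s \<omega> * (1 + d\<^sup>2))"
    proof -
      have 1: "\<theta> s \<omega> * (A * \<beta>) \<le> K * H s \<omega>" unfolding A_def \<beta>_def by (rule \<theta>ab_le[OF s w])
      have "\<theta> s \<omega> * \<beta> \<le> K * H s \<omega>" unfolding \<beta>_def by (rule \<theta>b_le[OF s w])
      then have "\<theta> s \<omega> * \<beta> * d \<le> K * H s \<omega> * (1 + d\<^sup>2)"
        by (rule mult_mono[OF _ d1]) (use nn K in auto)
      with 1 show ?thesis by linarith
    qed
    also have "\<dots> = 4 * K * H s \<omega> + 2 * K * (H s \<omega> * d\<^sup>2)" by (simp add: algebra_simps)
    finally have b1: "\<bar>\<theta> s \<omega> * (2 * Re (cnj (y s \<omega>) * b s \<omega>))\<bar> \<le> 4 * K * H s \<omega> + 2 * K * (H s \<omega> * d\<^sup>2)" .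
    have "(norm (y s \<omega>))\<^sup>2 \<le> 2 * A\<^sup>2 + 2 * d\<^sup>2" unfolding elim(1) A_def d_def by (rule norm_add_sq_le)
    also have "\<dots> \<le> 2 * S \<omega> + 2 * d\<^sup>2" using a_le[OF s w] by (simp add: A_def)
    finally have "\<epsilon> * (H s \<omega> * (norm (y s \<omega>))\<^sup>2) \<le> \<epsilon> * (H s \<omega> * (2 * S \<omega> + 2 * d\<^sup>2))" using nn \<epsilon> by (intro mult_left_mono) auto
    then have b2: "\<bar>\<epsilon> * (H s \<omega> * (norm (y s \<omega>))\<^sup>2)\<bar> \<le> 2 * \<epsilon> * (H s \<omega> * S \<omega>) + 2 * \<epsilon> * (H s \<omega> * d\<^sup>2)"
      using nn \<epsilon> by (simp add: algebra_simps)
    have "norm (G s \<omega>) \<le> \<bar>\<theta> s \<omega> * (2 * Re (cnj (y s \<omega>) * b s \<omega>))\<bar> + \<bar>\<epsilon> * (H s \<omega> * (norm (y s \<omega>))\<^sup>2)\<bar>"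
      unfolding G_def real_norm_def by (rule abs_triangle_ineq4)
    also have "\<dots> \<le> 4 * K * H s \<omega> + 2 * \<epsilon> * (H s \<omega> * S \<omega>) + ?c2 * (H s \<omega> * d\<^sup>2)"
      using b1 b2 by (simp add: distrib_right)
    also have "4 * K * H s \<omega> + 2 * \<epsilon> * (H s \<omega> * S \<omega>) \<le> ?c1 * (H s \<omega> * (1 + S \<omega>))"
      unfolding distrib_right[of "4 * K"] using HSle[OF w] K \<epsilon> nn(4) by (intro add_mono mult_left_mono) auto
    finally show ?case unfolding d_def by simp
  qed
  have "(\<integral>\<omega>. norm (G s \<omega>) \<partial>M) \<le> (\<integral>\<omega>. ?c1 * (H s \<omega> * (1 + S \<omega>)) + ?c2 * (H s \<omega> * (norm (?D \<omega>))\<^sup>2) \<partial>M)"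
    by (rule integral_mono_AE[OF integrable_norm[OF iG] _ bound])
      (intro Bochner_Integration.integrable_add integrable_mult_right HS iHD)
  also have "\<dots> = ?c1 * (\<integral>\<omega>. H s \<omega> * (1 + S \<omega>) \<partial>M) + ?c2 * ((\<integral>\<omega>. H s \<omega> \<partial>M) * ((t - s) * \<sigma>))"
    by (subst Bochner_Integration.integral_add, (intro integrable_mult_right HS iHD)+) (simp only: integral_mult_right_zero eHD)
  also have "\<dots> \<le> ?c1 * (\<integral>\<omega>. H s \<omega> * (1 + S \<omega>) \<partial>M) + ?c2 * ((\<integral>\<omega>. H s \<omega> * (1 + S \<omega>) \<partial>M) * (t * \<sigma>))"
  proof (intro add_left_mono mult_left_mono mult_mono)
    show "(\<integral>\<omega>. H s \<omega> \<partial>M) \<le> (\<integral>\<omega>. H s \<omega> * (1 + S \<omega>) \<partial>M)" by (intro integral_mono iH HS HSle)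
    show "0 \<le> (\<integral>\<omega>. H s \<omega> * (1 + S \<omega>) \<partial>M)"
      by (intro Bochner_Integration.integral_nonneg mult_nonneg_nonneg H_nonneg s add_nonneg_nonneg S_nonneg) auto
  qed (use s0 \<sigma>_nonneg K \<epsilon> in auto)
  also have "\<dots> = (?c1 + ?c2 * (t * \<sigma>)) * (\<integral>\<omega>. H s \<omega> * (1 + S \<omega>) \<partial>M)"
  proof -
    have "p * J + q * (J * x) = (p + q * x) * J" for p q J x :: real by (simp add: algebra_simps)
    then show ?thesis .
  qed
  finally show "(\<integral>\<omega>. norm (G s \<omega>) \<partial>M) \<le> (?c1 + ?c2 * (t * \<sigma>)) * (\<integral>\<omega>. H s \<omega> * (1 + S \<omega>) \<partial>M)" .
qed

lemma Q_dominated: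
  fixes g :: "real \<Rightarrow> 'w \<Rightarrow> real"
  assumes "\<And>s. s \<in> {0..t} \<Longrightarrow> g s \<in> borel_measurable M"
    and "\<And>\<omega>. \<omega> \<in> space M \<Longrightarrow> continuous_on {0..t} (\<lambda>s. g s \<omega>)"
    and "\<And>s \<omega>. s \<in> {0..t} \<Longrightarrow> \<omega> \<in> space M \<Longrightarrow> \<bar>g s \<omega>\<bar> \<le> C * (H s \<omega> * (1 + S \<omega>))"
  shows "integrable_Q g"
proof (rule Bochner_Integration.integrable_bound)
  have "integrable_Q (\<lambda>s \<omega>. H s \<omega> * (1 + S \<omega>))"
    by (rule H_mult_integrable) (use S S_nonneg in auto)
  then show "integrable_Q (\<lambda>s \<omega>. C * (H s \<omega> * (1 + S \<omega>)))" by (rule integrable_mult_right)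
  show "(\<lambda>p. g (fst p) (snd p)) \<in> borel_measurable Q" by (rule process_meas[OF assms(1,2)])
  show "AE p in Q. norm (g (fst p) (snd p)) \<le> norm (C * (H (fst p) (snd p) * (1 + S (snd p))))"
    by (rule AE_I2) (use assms(3) in \<open>auto simp only: space_Q real_norm_def intro: order_trans[OF _ abs_ge_self]\<close>)
qed

lemma Q_integrable:
  shows U_integrable: "integrable_Q (\<lambda>s \<omega>. \<theta> s \<omega> * (2 * Re (cnj (a s \<omega>) * b s \<omega>)))"
    and Ha_integrable: "integrable_Q (\<lambda>s \<omega>. H s \<omega> * (norm (a s \<omega>))\<^sup>2)"
    and H\<sigma>_integrable: "integrable_Q (\<lambda>s \<omega>. H s \<omega> * ((t - s) * \<sigma>))"
proof -
  have m: "a s \<in> borel_measurable M" "b s \<in> borel_measurable M" "\<theta> s \<in> borel_measurable M" "H s \<in> borel_measurable M" if "s \<in> {0..t}" for s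
    using augment_meas[OF a_meas[OF that]] augment_meas[OF b_meas[OF that]] augment_meas[OF \<theta>_meas[OF that]] augment_meas[OF H_meas[OF that]] by auto
  show "integrable_Q (\<lambda>s \<omega>. \<theta> s \<omega> * (2 * Re (cnj (a s \<omega>) * b s \<omega>)))"
  proof (rule Q_dominated[where g="\<lambda>s \<omega>. \<theta> s \<omega> * (2 * Re (cnj (a s \<omega>) * b s \<omega>))" and C="2 * K"])
    fix s assume s: "s \<in> {0..t}"
    note [measurable] = m[OF s]
    show "(\<lambda>\<omega>. \<theta> s \<omega> * (2 * Re (cnj (a s \<omega>) * b s \<omega>))) \<in> borel_measurable M" by measurable
    show "\<bar>\<theta> s \<omega> * (2 * Re (cnj (a s \<omega>) * b s \<omega>))\<bar> \<le> 2 * K * (H s \<omega> * (1 + S \<omega>))" if "\<omega> \<in> space M" for \<omega>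
      by (rule U_le[OF s that])
  qed (intro continuous_intros \<theta>_cont a_cont b_cont)
  show "integrable_Q (\<lambda>s \<omega>. H s \<omega> * (norm (a s \<omega>))\<^sup>2)"
  proof (rule Q_dominated[where g="\<lambda>s \<omega>. H s \<omega> * (norm (a s \<omega>))\<^sup>2" and C=1])
    fix s assume s: "s \<in> {0..t}"
    note [measurable] = m[OF s]
    show "(\<lambda>\<omega>. H s \<omega> * (norm (a s \<omega>))\<^sup>2) \<in> borel_measurable M" by measurable
    show "\<bar>H s \<omega> * (norm (a s \<omega>))\<^sup>2\<bar> \<le> 1 * (H s \<omega> * (1 + S \<omega>))" if "\<omega> \<in> space M" for \<omega>
      by (rule Ha_le[OF s that])
  qed (intro continuous_intros H_cont a_cont)
  show "integrable_Q (\<lambda>s \<omega>. H s \<omega> * ((t - s) * \<sigma>))"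
  proof (rule Q_dominated[where g="\<lambda>s \<omega>. H s \<omega> * ((t - s) * \<sigma>)" and C="t * \<sigma>"])
    fix s assume s: "s \<in> {0..t}"
    note [measurable] = m[OF s]
    show "(\<lambda>\<omega>. H s \<omega> * ((t - s) * \<sigma>)) \<in> borel_measurable M" by measurable
    fix \<omega> assume w: "\<omega> \<in> space M"
    have "H s \<omega> * ((t - s) * \<sigma>) \<le> (H s \<omega> * (1 + S \<omega>)) * (t * \<sigma>)"
      using s \<sigma>_nonneg H_nonneg[OF s w] S_nonneg[OF w] by (intro mult_mono H_le_HS s w mult_nonneg_nonneg) auto
    then show "\<bar>H s \<omega> * ((t - s) * \<sigma>)\<bar> \<le> t * \<sigma> * (H s \<omega> * (1 + S \<omega>))"
      using s \<sigma>_nonneg H_nonneg[OF s w] by (simp add: abs_mult mult.commute)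
  qed (intro continuous_intros H_cont)
qed

lemma E_integrable: "integrable_Q E"
  unfolding E_def
  by (intro Bochner_Integration.integrable_diff integrable_mult_right U_integrable Ha_integrable H\<sigma>_integrable)

lemma G_integrable: "integrable_Q G"
  and G_eq_E: "integral_Q G = integral_Q E"
proof -
  have HSi: "integrable Q (\<lambda>(s, \<omega>). H s \<omega> * (1 + S \<omega>))"
    using H_mult_integrable[of "\<lambda>\<omega>. 1 + S \<omega>"] S S_nonneg by (simp add: case_prod_unfold)
  have ae: "AE s in lebesgue_on {0..t}. integrable M (\<lambda>\<omega>. H s \<omega> * (1 + S \<omega>))"
    by (rule P.AE_integrable_fst[OF HSi])
  have outer: "integrable (lebesgue_on {0..t}) (\<lambda>s. \<integral>\<omega>. H s \<omega> * (1 + S \<omega>) \<partial>M)"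
    by (rule P.integrable_fst[OF HSi])
  have Gs: "G s \<in> borel_measurable M" if s: "s \<in> {0..t}" for s
  proof -
    note [measurable] = y_meas[OF s] augment_meas[OF b_meas[OF s]] augment_meas[OF \<theta>_meas[OF s]] augment_meas[OF H_meas[OF s]]
    show ?thesis unfolding G_def[abs_def] by measurable
  qed
  have Gm: "(\<lambda>p. G (fst p) (snd p)) \<in> borel_measurable Q"
  proof (rule process_meas)
    show "continuous_on {0..t} (\<lambda>s. G s \<omega>)" if "\<omega> \<in> space M" for \<omega>
      unfolding G_def by (intro continuous_intros \<theta>_cont H_cont y_cont b_cont that)
  qed (rule Gs)
  let ?C = "(4 * K + 2 * \<epsilon>) + (2 * K + 2 * \<epsilon>) * (t * \<sigma>)"
  show iG: "integrable_Q G"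
  proof (rule P.Fubini_integrable[OF Gm])
    have m: "(\<lambda>s. \<integral>\<omega>. norm (G s \<omega>) \<partial>M) \<in> borel_measurable (lebesgue_on {0..t})"
      by (rule borel_measurable_lebesgue_integral) (use Gm in \<open>simp add: case_prod_unfold\<close>)
    have "integrable (lebesgue_on {0..t}) (\<lambda>s. \<integral>\<omega>. norm (G s \<omega>) \<partial>M)"
    proof (rule Bochner_Integration.integrable_bound[OF integrable_mult_right[OF outer, of ?C] m])
      show "AE s in lebesgue_on {0..t}. norm (\<integral>\<omega>. norm (G s \<omega>) \<partial>M) \<le> norm (?C * (\<integral>\<omega>. H s \<omega> * (1 + S \<omega>) \<partial>M))"
        using ae AE_space
      proof eventually_elim
        case (elim s)
        have "norm (\<integral>\<omega>. norm (G s \<omega>) \<partial>M) = (\<integral>\<omega>. norm (G s \<omega>) \<partial>M)" by simp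
        also have "\<dots> \<le> ?C * (\<integral>\<omega>. H s \<omega> * (1 + S \<omega>) \<partial>M)"
          by (rule G_fixed_time(3)) (use elim in auto)
        finally show ?case unfolding real_norm_def by (rule order_trans[OF _ abs_ge_self])
      qed
    qed
    then show "integrable (lebesgue_on {0..t}) (\<lambda>x. \<integral>y. norm (G (fst (x, y)) (snd (x, y))) \<partial>M)" by simp
    show "AE x in lebesgue_on {0..t}. integrable M (\<lambda>y. G (fst (x, y)) (snd (x, y)))"
      using ae AE_space by eventually_elim (simp add: G_fixed_time(1))
  qed
  have "integral_Q G = (LINT s|lebesgue_on {0..t}. (\<integral>\<omega>. G s \<omega> \<partial>M))"
    using P.integral_fst[of G] iG by (simp add: case_prod_unfold)
  also have "\<dots> = (LINT s|lebesgue_on {0..t}. (\<integral>\<omega>. E s \<omega> \<partial>M))"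
  proof (rule integral_cong_AE)
    show "(\<lambda>s. \<integral>\<omega>. G s \<omega> \<partial>M) \<in> borel_measurable (lebesgue_on {0..t})"
      by (rule borel_measurable_lebesgue_integral) (use Gm in \<open>simp add: case_prod_unfold\<close>)
    show "(\<lambda>s. \<integral>\<omega>. E s \<omega> \<partial>M) \<in> borel_measurable (lebesgue_on {0..t})"
      by (rule borel_measurable_lebesgue_integral) (use borel_measurable_integrable[OF E_integrable] in \<open>simp add: case_prod_unfold\<close>)
    show "AE s in lebesgue_on {0..t}. (\<integral>\<omega>. G s \<omega> \<partial>M) = (\<integral>\<omega>. E s \<omega> \<partial>M)"
      using ae AE_space by eventually_elim (simp add: G_fixed_time(2))
  qed
  also have "\<dots> = integral_Q E"
    using P.integral_fst[of E] E_integrable by (simp add: case_prod_unfold)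
  finally show "integral_Q G = integral_Q E" .
qed

text \<open>The integral of \<open>G\<close> over time and probability is computed in both orders: time first, it is an
  increment of \<open>\<theta> |y|^2\<close>; probability first, \<open>G\<close> may be replaced by \<open>E\<close>.\<close>

theorem energy_identity:
  "(\<integral>\<omega>. \<theta> t \<omega> * (norm (a t \<omega>))\<^sup>2 \<partial>M) = (norm a0)\<^sup>2 + t * \<sigma> + integral_Q E"
proof -
  have tt: "t \<in> {0..t}" "0 \<in> {0..t}" using t by auto
  have [measurable]: "Z t \<in> borel_measurable M" "Z 0 \<in> borel_measurable M" using t by (auto intro: Z_meas)
  note [measurable] = y_meas[OF tt(1)] y_meas[OF tt(2)] augment_meas[OF a_meas[OF tt(1)]] augment_meas[OF \<theta>_meas[OF tt(1)]]
  note inc = increment_sq_integrable[OF order_refl t] increment_sq_integral[OF order_refl t]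
    increment_integrable[OF order_refl t] increment_mean[OF order_refl t]
  let ?D = "\<lambda>\<omega>. Z t \<omega> - Z 0 \<omega>"
  have i1: "integrable M (\<lambda>\<omega>. \<theta> t \<omega> * (norm (a t \<omega>))\<^sup>2)"
  proof (rule Bochner_Integration.integrable_bound[OF S])
    show "AE \<omega> in M. norm (\<theta> t \<omega> * (norm (a t \<omega>))\<^sup>2) \<le> norm (S \<omega>)"
    proof (rule AE_I2)
      fix \<omega> assume w: "\<omega> \<in> space M"
      have "\<theta> t \<omega> * (norm (a t \<omega>))\<^sup>2 \<le> 1 * S \<omega>"
        using \<theta>_le_1[OF tt(1) w] a_le[OF tt(1) w] \<theta>_pos[of t \<omega>] by (intro mult_mono) auto
      then show "norm (\<theta> t \<omega> * (norm (a t \<omega>))\<^sup>2) \<le> norm (S \<omega>)"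
        using \<theta>_pos[of t \<omega>] S_nonneg[OF w] by (simp add: abs_mult)
    qed
  qed measurable
  have e1: "AE \<omega> in M. \<theta> t \<omega> * (norm (y t \<omega>))\<^sup>2 = \<theta> t \<omega> * (norm (a t \<omega>))\<^sup>2"
    using y_eq[OF tt(1)] by eventually_elim simp
  have e0: "AE \<omega> in M. (norm (y 0 \<omega>))\<^sup>2 = (norm a0)\<^sup>2 + 2 * Re (cnj a0 * ?D \<omega>) + (norm (?D \<omega>))\<^sup>2"
    using Z_0
  proof eventually_elim
    case (elim \<omega>)
    then have y0: "y 0 \<omega> = a0 + ?D \<omega>" by (simp add: y_def)
    show ?case unfolding y0 cmod_power2 by (simp add: power2_eq_square algebra_simps)
  qed
  have iRe: "integrable M (\<lambda>\<omega>. Re (cnj a0 * ?D \<omega>))" and eRe: "(\<integral>\<omega>. Re (cnj a0 * ?D \<omega>) \<partial>M) = 0"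
    using integrable_Re[OF integrable_mult_right[OF inc(3), of "cnj a0"]] integral_Re[OF integrable_mult_right[OF inc(3), of "cnj a0"]] inc(4)
    by (simp_all only: integral_mult_right_zero mult_zero_right zero_complex.sel)
  have i0: "integrable M (\<lambda>\<omega>. (norm a0)\<^sup>2 + 2 * Re (cnj a0 * ?D \<omega>) + (norm (?D \<omega>))\<^sup>2)"
    by (intro Bochner_Integration.integrable_add integrable_mult_right integrable_const iRe inc(1))
  have m1: "(\<lambda>\<omega>. \<theta> t \<omega> * (norm (y t \<omega>))\<^sup>2) \<in> borel_measurable M" and m0: "(\<lambda>\<omega>. (norm (y 0 \<omega>))\<^sup>2) \<in> borel_measurable M"
    by measurable
  have i1': "integrable M (\<lambda>\<omega>. \<theta> t \<omega> * (norm (y t \<omega>))\<^sup>2)"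
    using integrable_cong_AE[OF m1 borel_measurable_integrable[OF i1] e1] i1 by simp
  have i0': "integrable M (\<lambda>\<omega>. (norm (y 0 \<omega>))\<^sup>2)"
    using integrable_cong_AE[OF m0 borel_measurable_integrable[OF i0] e0] i0 by simp
  have "integral_Q E = integral_Q G" by (rule G_eq_E[symmetric])
  also have "\<dots> = (\<integral>\<omega>. (LINT s|lebesgue_on {0..t}. G s \<omega>) \<partial>M)"
    using P.integral_snd[of G] G_integrable by (simp add: case_prod_unfold)
  also have "\<dots> = (\<integral>\<omega>. \<theta> t \<omega> * (norm (y t \<omega>))\<^sup>2 - (norm (y 0 \<omega>))\<^sup>2 \<partial>M)"
    by (rule Bochner_Integration.integral_cong[OF refl G_integral])
  also have "\<dots> = (\<integral>\<omega>. \<theta> t \<omega> * (norm (y t \<omega>))\<^sup>2 \<partial>M) - (\<integral>\<omega>. (norm (y 0 \<omega>))\<^sup>2 \<partial>M)"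
    by (rule Bochner_Integration.integral_diff[OF i1' i0'])
  also have "(\<integral>\<omega>. \<theta> t \<omega> * (norm (y t \<omega>))\<^sup>2 \<partial>M) = (\<integral>\<omega>. \<theta> t \<omega> * (norm (a t \<omega>))\<^sup>2 \<partial>M)"
    by (rule integral_cong_AE[OF m1 borel_measurable_integrable[OF i1] e1])
  also have "(\<integral>\<omega>. (norm (y 0 \<omega>))\<^sup>2 \<partial>M) = (\<integral>\<omega>. (norm a0)\<^sup>2 + 2 * Re (cnj a0 * ?D \<omega>) + (norm (?D \<omega>))\<^sup>2 \<partial>M)"
    by (rule integral_cong_AE[OF m0 borel_measurable_integrable[OF i0] e0])
  also have "\<dots> = (\<integral>\<omega>. (norm a0)\<^sup>2 + 2 * Re (cnj a0 * ?D \<omega>) \<partial>M) + (\<integral>\<omega>. (norm (?D \<omega>))\<^sup>2 \<partial>M)"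
    by (intro Bochner_Integration.integral_add Bochner_Integration.integrable_add integrable_mult_right integrable_const iRe inc(1))
  also have "(\<integral>\<omega>. (norm a0)\<^sup>2 + 2 * Re (cnj a0 * ?D \<omega>) \<partial>M) = (\<integral>\<omega>. (norm a0)\<^sup>2 \<partial>M) + (\<integral>\<omega>. 2 * Re (cnj a0 * ?D \<omega>) \<partial>M)"
    by (intro Bochner_Integration.integral_add integrable_mult_right integrable_const iRe)
  also have "(\<integral>\<omega>. 2 * Re (cnj a0 * ?D \<omega>) \<partial>M) = 0" unfolding integral_mult_right_zero eRe by simp
  finally show ?thesis using inc(2) by (simp add: prob_space)
qed

end

section \<open>Summation over the modes\<close>

text \<open>The data that the energy balance depends on: processes in \<open>H^1\<close> with continuous paths, the
  equation for every Fourier mode, and an integrable bound for the squared norm.  \<open>\<Sigma>\<close> is the total intensity of the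
  noise.\<close>

locale energy_system = sobolev_constant L C + prob_space M
  for L C :: real and M :: "'w measure" +
  fixes F :: "real \<Rightarrow> 'w measure" and B :: "'i \<Rightarrow> real \<Rightarrow> 'w \<Rightarrow> real" and \<iota> :: "nat \<Rightarrow> 'i"
    and c :: "int \<Rightarrow> nat \<Rightarrow> complex" and Z :: "int \<Rightarrow> real \<Rightarrow> 'w \<Rightarrow> complex"
    and u :: "real \<Rightarrow> 'w \<Rightarrow> real \<Rightarrow> complex" and v :: "real \<Rightarrow> 'w \<Rightarrow> real \<Rightarrow> real"
    and u0 :: "real \<Rightarrow> complex" and S :: "'w \<Rightarrow> real" and \<gamma> \<beta> t \<Sigma> :: real
  assumes sub: "\<And>s. subalgebra M (F s)" and mono: "\<And>s r. s \<le> r \<Longrightarrow> sets (F s) \<subseteq> sets (F r)"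
    and t: "0 < t"
    and noise: "\<And>k. noise M F B \<iota> (c k) (Z k)"
    and u_meas: "\<And>s. s \<in> {0..t} \<Longrightarrow> u s \<in> augment M (F s) \<rightarrow>\<^sub>M H1_borel L"
    and v_meas: "\<And>s. s \<in> {0..t} \<Longrightarrow> v s \<in> augment M (F s) \<rightarrow>\<^sub>M H1_borel L"
    and u_cont: "\<And>\<omega> s. \<omega> \<in> space M \<Longrightarrow> s \<in> {0..t} \<Longrightarrow>
      ((\<lambda>r. h1_norm L (\<lambda>x. u r \<omega> x - u s \<omega> x)) \<longlongrightarrow> 0) (at s within {0..t})"
    and v_cont: "\<And>\<omega> s. \<omega> \<in> space M \<Longrightarrow> s \<in> {0..t} \<Longrightarrow>
      ((\<lambda>r. h1_norm L (\<lambda>x. v r \<omega> x - v s \<omega> x)) \<longlongrightarrow> 0) (at s within {0..t})"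
    and S: "integrable M S"
    and u_le: "\<And>s \<omega>. s \<in> {0..t} \<Longrightarrow> \<omega> \<in> space M \<Longrightarrow> (h1_norm L (u s \<omega>))\<^sup>2 \<le> S \<omega>"
    and u0: "u0 \<in> L2_space L"
    and eq: "\<And>k s. s \<in> {0..t} \<Longrightarrow> AE \<omega> in M. fcoef L k (u s \<omega>) = fcoef L k u0
      + integral {0..s} (\<lambda>r. - \<i> * (freq L k)\<^sup>2 * fcoef L k (u r \<omega>) - \<i> * fcoef L k (nonlin \<gamma> \<beta> (u r \<omega>) (v r \<omega>)))
      + Z k s \<omega>"
    and \<Sigma>: "(\<lambda>N. \<Sum>k\<in>{-int N..int N}. noise.\<sigma> (c k)) \<longlonglongrightarrow> \<Sigma>"
begin

definition a :: "int \<Rightarrow> real \<Rightarrow> 'w \<Rightarrow> complex" where "a k s \<omega> = fcoef L k (u s \<omega>)"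

definition b :: "int \<Rightarrow> real \<Rightarrow> 'w \<Rightarrow> complex" where
  "b k s \<omega> = - \<i> * (freq L k)\<^sup>2 * fcoef L k (u s \<omega>) - \<i> * fcoef L k (nonlin \<gamma> \<beta> (u s \<omega>) (v s \<omega>))"

definition A :: "nat \<Rightarrow> real \<Rightarrow> 'w \<Rightarrow> real" where
  "A N s \<omega> = (\<Sum>k\<in>{-int N..int N}. (norm (a k s \<omega>))\<^sup>2)"

definition R :: "nat \<Rightarrow> real \<Rightarrow> 'w \<Rightarrow> real" where
  "R N s \<omega> = Re (\<Sum>k\<in>{-int N..int N}. cnj (a k s \<omega>) * b k s \<omega>)"

text \<open>The drift is of degree three in the solution and is multiplied by the solution once more.\<close>

definition h :: "real \<Rightarrow> 'w \<Rightarrow> real" where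
  "h s \<omega> = (1 + h1_norm L (u s \<omega>) + h1_norm L (v s \<omega>)) ^ 4"

definition K :: "int \<Rightarrow> real" where "K k = (freq L k)\<^sup>2 + \<bar>\<gamma>\<bar> * C + \<bar>\<beta>\<bar> * C\<^sup>2"

lemma uH: "s \<in> {0..t} \<Longrightarrow> \<omega> \<in> space M \<Longrightarrow> u s \<omega> \<in> H1_space L"
  and vH: "s \<in> {0..t} \<Longrightarrow> \<omega> \<in> space M \<Longrightarrow> v s \<omega> \<in> H1_space L"
  using measurable_space[OF u_meas] measurable_space[OF v_meas] by (auto simp: space_H1_borel space_augment)

lemma a_meas: "s \<in> {0..t} \<Longrightarrow> a k s \<in> borel_measurable (augment M (F s))"
  unfolding a_def[abs_def] by (rule measurable_compose[OF u_meas fcoef_H1_measurable[OF L]])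

lemma b_meas:
  assumes s: "s \<in> {0..t}" shows "b k s \<in> borel_measurable (augment M (F s))"
proof -
  have [measurable]: "(\<lambda>\<omega>. fcoef L k (u s \<omega>)) \<in> borel_measurable (augment M (F s))"
    by (rule measurable_compose[OF u_meas[OF s] fcoef_H1_measurable[OF L]])
  have [measurable]: "(\<lambda>\<omega>. fcoef L k (nonlin \<gamma> \<beta> (u s \<omega>) (v s \<omega>))) \<in> borel_measurable (augment M (F s))"
    by (rule fcoef_nonlin_measurable[OF u_meas[OF s] v_meas[OF s]])
  show ?thesis unfolding b_def[abs_def] by measurable
qed

lemma h_meas:
  assumes s: "s \<in> {0..t}" shows "h s \<in> borel_measurable (augment M (F s))"
proof -
  have [measurable]: "(\<lambda>\<omega>. h1_norm L (u s \<omega>)) \<in> borel_measurable (augment M (F s))"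
    by (rule measurable_compose[OF u_meas[OF s] h1_norm_measurable[OF L]])
  have [measurable]: "(\<lambda>\<omega>. h1_norm L (v s \<omega>)) \<in> borel_measurable (augment M (F s))"
    by (rule measurable_compose[OF v_meas[OF s] h1_norm_measurable_real[OF L]])
  show ?thesis unfolding h_def[abs_def] by measurable
qed

lemma a_cont: "\<omega> \<in> space M \<Longrightarrow> continuous_on {0..t} (\<lambda>s. a k s \<omega>)"
  unfolding a_def by (rule continuous_on_fcoef[OF uH u_cont])

lemma b_cont: "\<omega> \<in> space M \<Longrightarrow> continuous_on {0..t} (\<lambda>s. b k s \<omega>)"
  unfolding b_def
  by (intro continuous_intros continuous_on_fcoef[OF uH u_cont] continuous_on_fcoef_nonlin[OF uH vH u_cont v_cont])

lemma h_cont: "\<omega> \<in> space M \<Longrightarrow> continuous_on {0..t} (\<lambda>s. h s \<omega>)"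
  unfolding h_def
  by (intro continuous_intros continuous_on_h1_norm[OF uH u_cont] continuous_on_h1_norm_real[OF vH v_cont])

lemma nonlin_le_h:
  assumes s: "s \<in> {0..t}" "\<omega> \<in> space M"
  defines "r \<equiv> 1 + h1_norm L (u s \<omega>) + h1_norm L (v s \<omega>)"
  shows "l2_norm L (nonlin \<gamma> \<beta> (u s \<omega>) (v s \<omega>)) \<le> (\<bar>\<gamma>\<bar> * C + \<bar>\<beta>\<bar> * C\<^sup>2) * r ^ 3"
    and "l2_norm L (u s \<omega>) \<le> r" and "1 \<le> r"
proof -
  let ?x = "h1_norm L (u s \<omega>)" and ?y = "h1_norm L (v s \<omega>)"
  have x: "0 \<le> ?x" "?x \<le> r" "0 \<le> ?y" "?y \<le> r" "1 \<le> r"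
    using h1_norm_nonneg[of L "u s \<omega>"] h1_norm_nonneg[of L "v s \<omega>"] unfolding r_def by linarith+
  show "1 \<le> r" by (rule x)
  show l: "l2_norm L (u s \<omega>) \<le> r" using l2_norm_le_h1_norm[of L "u s \<omega>"] x by linarith
  have "\<bar>\<gamma>\<bar> * C * ?y + \<bar>\<beta>\<bar> * (C * ?x)\<^sup>2 \<le> \<bar>\<gamma>\<bar> * C * r\<^sup>2 + \<bar>\<beta>\<bar> * (C * r)\<^sup>2"
  proof (intro add_mono mult_left_mono power_mono)
    have "?y \<le> r * 1" using x by simp
    also have "\<dots> \<le> r * r" using x by (intro mult_left_mono) auto
    finally show "?y \<le> r\<^sup>2" by (simp add: power2_eq_square)
  qed (use x C in auto)
  also have "\<dots> = (\<bar>\<gamma>\<bar> * C + \<bar>\<beta>\<bar> * C\<^sup>2) * r\<^sup>2" by (simp add: power_mult_distrib algebra_simps)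
  finally have "l2_norm L (nonlin \<gamma> \<beta> (u s \<omega>) (v s \<omega>)) \<le> (\<bar>\<gamma>\<bar> * C + \<bar>\<beta>\<bar> * C\<^sup>2) * r\<^sup>2 * r"
    using C x by (intro order_trans[OF l2_norm_nonlin[OF uH[OF s] vH[OF s]]] mult_mono l) auto
  then show "l2_norm L (nonlin \<gamma> \<beta> (u s \<omega>) (v s \<omega>)) \<le> (\<bar>\<gamma>\<bar> * C + \<bar>\<beta>\<bar> * C\<^sup>2) * r ^ 3"
    by (simp add: power2_eq_square power3_eq_cube mult.assoc)
qed

lemma K_nonneg: "0 \<le> K k" using C by (simp add: K_def)

lemma b_le:
  assumes s: "s \<in> {0..t}" "\<omega> \<in> space M"
  shows "norm (b k s \<omega>) \<le> K k * h s \<omega>" "norm (a k s \<omega>) * norm (b k s \<omega>) \<le> K k * h s \<omega>"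
proof -
  define r where "r = 1 + h1_norm L (u s \<omega>) + h1_norm L (v s \<omega>)"
  note n = nonlin_le_h[OF s, folded r_def]
  have a: "norm (fcoef L k (u s \<omega>)) \<le> r"
    using norm_fcoef_le[OF L H1_L2[OF uH[OF s]]] n(2) by (rule order_trans)
  have nl: "norm (fcoef L k (nonlin \<gamma> \<beta> (u s \<omega>) (v s \<omega>))) \<le> (\<bar>\<gamma>\<bar> * C + \<bar>\<beta>\<bar> * C\<^sup>2) * r ^ 3"
    using norm_fcoef_le[OF L L2_nonlin[OF uH[OF s] vH[OF s]]] n(1) by (rule order_trans)
  have r3: "r \<le> r ^ 3" "r ^ 3 \<le> r ^ 4" using n(3) power_increasing[of 1 3 r] power_increasing[of 3 4 r] by auto
  have "norm (b k s \<omega>) \<le> (freq L k)\<^sup>2 * norm (fcoef L k (u s \<omega>)) + norm (fcoef L k (nonlin \<gamma> \<beta> (u s \<omega>) (v s \<omega>)))"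
    unfolding b_def by (rule order_trans[OF norm_triangle_ineq4]) (simp add: norm_mult norm_power)
  also have "\<dots> \<le> (freq L k)\<^sup>2 * r ^ 3 + (\<bar>\<gamma>\<bar> * C + \<bar>\<beta>\<bar> * C\<^sup>2) * r ^ 3"
    by (intro add_mono nl mult_left_mono order_trans[OF a r3(1)]) auto
  also have "\<dots> = K k * r ^ 3" by (simp add: K_def algebra_simps)
  finally have b3: "norm (b k s \<omega>) \<le> K k * r ^ 3" .
  also have "\<dots> \<le> K k * r ^ 4" by (intro mult_left_mono r3 K_nonneg)
  finally show "norm (b k s \<omega>) \<le> K k * h s \<omega>" by (simp add: h_def r_def)
  have "norm (a k s \<omega>) * norm (b k s \<omega>) \<le> r * (K k * r ^ 3)"
    using a b3 n(3) unfolding a_def by (intro mult_mono) auto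
  also have "\<dots> = K k * r ^ 4" by (simp add: power_numeral_reduce)
  finally show "norm (a k s \<omega>) * norm (b k s \<omega>) \<le> K k * h s \<omega>" by (simp add: h_def r_def)
qed

lemma sum_a_le:
  assumes s: "s \<in> {0..t}" "\<omega> \<in> space M"
  shows "A N s \<omega> \<le> S \<omega>"
proof -
  have "A N s \<omega> \<le> (l2_norm L (u s \<omega>))\<^sup>2"
    unfolding A_def a_def by (rule Bessel[OF L H1_L2[OF uH[OF s]]])
  also have "\<dots> \<le> (h1_norm L (u s \<omega>))\<^sup>2" by (intro power_mono l2_norm_le_h1_norm) simp
  also note u_le[OF s]
  finally show ?thesis .
qed

lemma A_nonneg: "0 \<le> A N s \<omega>"
  by (simp add: A_def sum_nonneg)

lemma A_tendsto:
  assumes "s \<in> {0..t}" "\<omega> \<in> space M"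
  shows "(\<lambda>N. A N s \<omega>) \<longlonglongrightarrow> (l2_norm L (u s \<omega>))\<^sup>2"
  unfolding A_def a_def by (rule Parseval[OF L H1_L2[OF uH[OF assms]]])

lemma S_nonneg: "\<omega> \<in> space M \<Longrightarrow> 0 \<le> S \<omega>"
  by (rule order_trans[OF zero_le_power2 u_le[of 0]]) (use t in auto)

lemma a_le:
  assumes s: "s \<in> {0..t}" "\<omega> \<in> space M"
  shows "(norm (a k s \<omega>))\<^sup>2 \<le> S \<omega>"
proof -
  have "norm (a k s \<omega>) \<le> h1_norm L (u s \<omega>)"
    unfolding a_def by (rule order_trans[OF norm_fcoef_le[OF L H1_L2[OF uH[OF s]]] l2_norm_le_h1_norm])
  then have "(norm (a k s \<omega>))\<^sup>2 \<le> (h1_norm L (u s \<omega>))\<^sup>2" by (rule power_mono) simp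
  also note u_le[OF s]
  finally show ?thesis .
qed

lemma l2_meas: "(\<lambda>\<omega>. (l2_norm L (u t \<omega>))\<^sup>2) \<in> borel_measurable M"
proof -
  have "t \<in> {0..t}" using t by simp
  from measurable_compose[OF measurable_from_subalg[OF subalgebra_augment[OF sub] u_meas[OF this]] l2_norm_measurable]
  show ?thesis by measurable
qed

lemma weight: "0 < \<epsilon> \<Longrightarrow> weight M F h t \<epsilon>"
  by (intro weight.intro weight_axioms.intro prob_space_axioms sub mono t h_meas h_cont) (auto simp: h_def)

lemma energy_mode: "0 < \<epsilon> \<Longrightarrow> energy_mode M F h t \<epsilon> B \<iota> (c k) (Z k) (a k) (b k) S (K k) (fcoef L k u0)"
  by (intro energy_mode.intro energy_mode_axioms.intro weight noise a_meas b_meas a_cont b_cont K_nonneg b_le a_le S eq[folded a_def b_def])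

lemma \<sigma>_sum: "0 \<le> (\<Sum>k\<in>{-int N..int N}. noise.\<sigma> (c k))" "(\<Sum>k\<in>{-int N..int N}. noise.\<sigma> (c k)) \<le> \<Sigma>"
proof -
  show "0 \<le> (\<Sum>k\<in>{-int N..int N}. noise.\<sigma> (c k))" by (intro sum_nonneg noise.\<sigma>_nonneg[OF noise])
  have "incseq (\<lambda>N. \<Sum>k\<in>{-int N..int N}. noise.\<sigma> (c k))"
    by (intro monoI sum_mono2 noise.\<sigma>_nonneg[OF noise]) auto
  then show "(\<Sum>k\<in>{-int N..int N}. noise.\<sigma> (c k)) \<le> \<Sigma>" by (rule incseq_le[OF _ \<Sigma>])
qed

lemma \<Sigma>_nonneg: "0 \<le> \<Sigma>" using \<sigma>_sum[of 0] by linarith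

text \<open>In the sum of the energy identities the two terms created by the weight have the same sign.
  The bound for them depends neither on \<open>N\<close> nor, apart from \<open>\<theta>\<close>, on \<open>\<epsilon>\<close>.\<close>

lemma truncated_energy:
  assumes \<epsilon>: "0 < \<epsilon>"
  shows "\<bar>(\<integral>\<omega>. weight.\<theta> h \<epsilon> t \<omega> * A N t \<omega> \<partial>M)
      - (\<Sum>k\<in>{-int N..int N}. (norm (fcoef L k u0))\<^sup>2) - t * (\<Sum>k\<in>{-int N..int N}. noise.\<sigma> (c k))
      - 2 * (\<integral>p. weight.\<theta> h \<epsilon> (fst p) (snd p) * R N (fst p) (snd p) \<partial>(lebesgue_on {0..t} \<Otimes>\<^sub>M M))\<bar>
    \<le> (\<integral>\<omega>. (1 - weight.\<theta> h \<epsilon> t \<omega>) * (S \<omega> + t * \<Sigma>) \<partial>M)"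
proof -
  interpret W: weight M F h t \<epsilon> by (rule weight[OF \<epsilon>])
  let ?K = "{-int N..int N}"
  let ?s = "\<Sum>k\<in>?K. noise.\<sigma> (c k)"
  have tt: "t \<in> {0..t}" using t by simp
  note EM = energy_mode[OF \<epsilon>]
  have iU: "W.integrable_Q (\<lambda>s \<omega>. W.\<theta> s \<omega> * (2 * Re (cnj (a k s \<omega>) * b k s \<omega>)))"
    and iHa: "W.integrable_Q (\<lambda>s \<omega>. W.H s \<omega> * (norm (a k s \<omega>))\<^sup>2)"
    and iH\<sigma>: "W.integrable_Q (\<lambda>s \<omega>. W.H s \<omega> * ((t - s) * noise.\<sigma> (c k)))" for k
    using energy_mode.Q_integrable[OF EM, of k] by auto
  have id: "(\<integral>\<omega>. W.\<theta> t \<omega> * (norm (a k t \<omega>))\<^sup>2 \<partial>M) = (norm (fcoef L k u0))\<^sup>2 + t * noise.\<sigma> (c k)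
     + (W.integral_Q (\<lambda>s \<omega>. W.\<theta> s \<omega> * (2 * Re (cnj (a k s \<omega>) * b k s \<omega>)))
        - \<epsilon> * W.integral_Q (\<lambda>s \<omega>. W.H s \<omega> * (norm (a k s \<omega>))\<^sup>2)
        - \<epsilon> * W.integral_Q (\<lambda>s \<omega>. W.H s \<omega> * ((t - s) * noise.\<sigma> (c k))))" for k
    unfolding energy_mode.energy_identity[OF EM] energy_mode.E_def[OF EM]
    using iU iHa iH\<sigma> by (simp del: times_complex.sel)
  have am: "a k t \<in> borel_measurable M" for k by (rule W.augment_meas[OF a_meas[OF tt]])
  have \<theta>m: "W.\<theta> t \<in> borel_measurable M" by (rule W.augment_meas[OF W.\<theta>_meas[OF tt]])
  note [measurable] = am \<theta>m
  have i1: "integrable M (\<lambda>\<omega>. W.\<theta> t \<omega> * (norm (a k t \<omega>))\<^sup>2)" for k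
  proof (rule Bochner_Integration.integrable_bound[OF S])
    show "AE \<omega> in M. norm (W.\<theta> t \<omega> * (norm (a k t \<omega>))\<^sup>2) \<le> norm (S \<omega>)"
    proof (rule AE_I2)
      fix \<omega> assume w: "\<omega> \<in> space M"
      have "W.\<theta> t \<omega> * (norm (a k t \<omega>))\<^sup>2 \<le> 1 * S \<omega>"
        using W.\<theta>_le_1[OF tt w] a_le[OF tt w] W.\<theta>_pos[of t \<omega>] by (intro mult_mono) auto
      then show "norm (W.\<theta> t \<omega> * (norm (a k t \<omega>))\<^sup>2) \<le> norm (S \<omega>)"
        using W.\<theta>_pos[of t \<omega>] S_nonneg[OF w] by (simp add: abs_mult)
    qed
  qed measurable
  let ?X = "\<integral>\<omega>. W.\<theta> t \<omega> * A N t \<omega> \<partial>M"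
  let ?R = "W.integral_Q (\<lambda>s \<omega>. W.\<theta> s \<omega> * R N s \<omega>)"
  let ?HA = "W.integral_Q (\<lambda>s \<omega>. W.H s \<omega> * A N s \<omega>)"
  let ?HS = "W.integral_Q (\<lambda>s \<omega>. W.H s \<omega> * ((t - s) * ?s))"
  have X: "?X = (\<Sum>k\<in>?K. \<integral>\<omega>. W.\<theta> t \<omega> * (norm (a k t \<omega>))\<^sup>2 \<partial>M)"
    unfolding A_def sum_distrib_left by (rule Bochner_Integration.integral_sum[OF i1])
  have R: "2 * ?R = (\<Sum>k\<in>?K. W.integral_Q (\<lambda>s \<omega>. W.\<theta> s \<omega> * (2 * Re (cnj (a k s \<omega>) * b k s \<omega>))))"
  proof -
    have "2 * ?R = (\<integral>p. 2 * (W.\<theta> (fst p) (snd p) * R N (fst p) (snd p)) \<partial>W.Q)"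
      by (rule integral_mult_right_zero[symmetric])
    also have "\<dots> = (\<integral>p. (\<Sum>k\<in>?K. W.\<theta> (fst p) (snd p) * (2 * Re (cnj (a k (fst p) (snd p)) * b k (fst p) (snd p)))) \<partial>W.Q)"
      by (simp only: R_def Re_sum sum_distrib_left mult.left_commute)
    also have "\<dots> = (\<Sum>k\<in>?K. W.integral_Q (\<lambda>s \<omega>. W.\<theta> s \<omega> * (2 * Re (cnj (a k s \<omega>) * b k s \<omega>))))"
      by (rule Bochner_Integration.integral_sum[OF iU])
    finally show ?thesis .
  qed
  have HA: "?HA = (\<Sum>k\<in>?K. W.integral_Q (\<lambda>s \<omega>. W.H s \<omega> * (norm (a k s \<omega>))\<^sup>2))"
    unfolding A_def sum_distrib_left by (rule Bochner_Integration.integral_sum[OF iHa])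
  have HAi: "W.integrable_Q (\<lambda>s \<omega>. W.H s \<omega> * A N s \<omega>)"
    unfolding A_def sum_distrib_left by (intro Bochner_Integration.integrable_sum iHa)
  have HS: "?HS = (\<Sum>k\<in>?K. W.integral_Q (\<lambda>s \<omega>. W.H s \<omega> * ((t - s) * noise.\<sigma> (c k))))"
    unfolding A_def sum_distrib_left by (rule Bochner_Integration.integral_sum[OF iH\<sigma>])
  have HSi: "W.integrable_Q (\<lambda>s \<omega>. W.H s \<omega> * ((t - s) * ?s))"
    unfolding A_def sum_distrib_left by (intro Bochner_Integration.integrable_sum iH\<sigma>)
  have total: "?X - (\<Sum>k\<in>?K. (norm (fcoef L k u0))\<^sup>2) - t * ?s - 2 * ?R = - (\<epsilon> * ?HA + \<epsilon> * ?HS)"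
    unfolding X R HA HS id by (simp only: sum.distrib sum_subtractf sum_distrib_left[symmetric])
  have nonneg: "0 \<le> ?HA" "0 \<le> ?HS"
    using \<sigma>_sum(1)[of N]
    by (auto intro!: integral_nonneg_AE AE_I2 mult_nonneg_nonneg W.H_nonneg A_nonneg simp: W.space_Q)
  have upper: "\<epsilon> * ?HA + \<epsilon> * ?HS \<le> (\<integral>\<omega>. (1 - W.\<theta> t \<omega>) * (S \<omega> + t * \<Sigma>) \<partial>M)"
  proof -
    have iS: "integrable M (\<lambda>\<omega>. S \<omega> + t * \<Sigma>)" using S by simp
    have pS: "0 \<le> S \<omega> + t * \<Sigma>" if "\<omega> \<in> space M" for \<omega> using S_nonneg[OF that] \<Sigma>_nonneg t by simp
    have "?HA + ?HS = (\<integral>p. W.H (fst p) (snd p) * A N (fst p) (snd p) + W.H (fst p) (snd p) * ((t - fst p) * ?s) \<partial>W.Q)"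
      by (rule Bochner_Integration.integral_add[OF HAi HSi, symmetric])
    also have "\<dots> \<le> W.integral_Q (\<lambda>s \<omega>. W.H s \<omega> * (S \<omega> + t * \<Sigma>))"
    proof (rule integral_mono[OF Bochner_Integration.integrable_add[OF HAi HSi] W.H_mult_integrable[OF iS pS]])
      fix p assume "p \<in> space W.Q"
      then have p: "fst p \<in> {0..t}" "snd p \<in> space M" by (auto simp only: W.space_Q)
      have "(t - fst p) * ?s \<le> t * \<Sigma>" using p t \<sigma>_sum[of N] by (intro mult_mono) auto
      then show "W.H (fst p) (snd p) * A N (fst p) (snd p) + W.H (fst p) (snd p) * ((t - fst p) * ?s)
          \<le> W.H (fst p) (snd p) * (S (snd p) + t * \<Sigma>)"
        unfolding distrib_left[symmetric] using sum_a_le[OF p]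
        by (intro mult_left_mono add_mono W.H_nonneg p)
    qed
    also have "\<dots> = (\<integral>\<omega>. (1 - W.\<theta> t \<omega>) * (S \<omega> + t * \<Sigma>) \<partial>M) / \<epsilon>" by (rule W.H_mult_integral[OF iS pS])
    finally have "(?HA + ?HS) * \<epsilon> \<le> (\<integral>\<omega>. (1 - W.\<theta> t \<omega>) * (S \<omega> + t * \<Sigma>) \<partial>M)" using \<epsilon> by (simp only: pos_le_divide_eq)
    moreover have "(p + q) * e = e * p + e * q" for p q e :: real by (simp add: algebra_simps)
    ultimately show ?thesis by (simp only:)
  qed
  have abs_le: "\<bar>- (p + q)\<bar> \<le> r" if "0 \<le> p" "0 \<le> q" "p + q \<le> r" for p q r :: real using that by simp
  show ?thesis
    unfolding total by (intro abs_le mult_nonneg_nonneg nonneg upper less_imp_le[OF \<epsilon>])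
qed

lemma weighted_energy:
  assumes \<epsilon>: "0 < \<epsilon>"
  shows "\<bar>(\<integral>\<omega>. weight.\<theta> h \<epsilon> t \<omega> * (l2_norm L (u t \<omega>))\<^sup>2 \<partial>M) - (l2_norm L u0)\<^sup>2 - t * \<Sigma>\<bar>
    \<le> (\<integral>\<omega>. (1 - weight.\<theta> h \<epsilon> t \<omega>) * (S \<omega> + t * \<Sigma>) \<partial>M)"
proof -
  interpret W: weight M F h t \<epsilon> by (rule weight[OF \<epsilon>])
  have tt: "t \<in> {0..t}" using t by simp
  have am: "a k s \<in> borel_measurable M" "b k s \<in> borel_measurable M" "W.\<theta> s \<in> borel_measurable M" if "s \<in> {0..t}" for k s
    using W.augment_meas[OF a_meas[OF that]] W.augment_meas[OF b_meas[OF that]] W.augment_meas[OF W.\<theta>_meas[OF that]] by auto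
  note [measurable] = am[OF tt]
  have lim1: "(\<lambda>N. \<integral>\<omega>. W.\<theta> t \<omega> * A N t \<omega> \<partial>M) \<longlonglongrightarrow> (\<integral>\<omega>. W.\<theta> t \<omega> * (l2_norm L (u t \<omega>))\<^sup>2 \<partial>M)"
  proof (rule integral_dominated_convergence[OF _ _ S])
    show "AE \<omega> in M. (\<lambda>N. W.\<theta> t \<omega> * A N t \<omega>) \<longlonglongrightarrow> W.\<theta> t \<omega> * (l2_norm L (u t \<omega>))\<^sup>2"
      by (intro AE_I2 tendsto_mult_left A_tendsto tt)
    show "(\<lambda>\<omega>. W.\<theta> t \<omega> * (l2_norm L (u t \<omega>))\<^sup>2) \<in> borel_measurable M"
      using l2_meas by measurable
    show "(\<lambda>\<omega>. W.\<theta> t \<omega> * A N t \<omega>) \<in> borel_measurable M" for N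
      unfolding A_def by measurable
    show "AE \<omega> in M. norm (W.\<theta> t \<omega> * A N t \<omega>) \<le> S \<omega>" for N
    proof (rule AE_I2)
      fix \<omega> assume w: "\<omega> \<in> space M"
      note nn = A_nonneg[of N t \<omega>]
      have "W.\<theta> t \<omega> * A N t \<omega> \<le> 1 * S \<omega>"
        using W.\<theta>_le_1[OF tt w] nn by (intro mult_mono sum_a_le[OF tt w]) auto
      then show "norm (W.\<theta> t \<omega> * A N t \<omega>) \<le> S \<omega>"
        using nn W.\<theta>_pos[of t \<omega>] by (simp add: abs_mult)
    qed
  qed
  let ?C = "\<bar>\<gamma>\<bar> * C + \<bar>\<beta>\<bar> * C\<^sup>2"
  have lim2: "(\<lambda>N. W.integral_Q (\<lambda>s \<omega>. W.\<theta> s \<omega> * R N s \<omega>)) \<longlonglongrightarrow> (\<integral>p. 0 \<partial>W.Q)"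
  proof (rule integral_dominated_convergence[where w="\<lambda>p. ?C * (W.H (fst p) (snd p) * 1)"])
    show "integrable W.Q (\<lambda>p. ?C * (W.H (fst p) (snd p) * 1))"
      by (intro integrable_mult_right W.H_mult_integrable) auto
    show "(\<lambda>p. W.\<theta> (fst p) (snd p) * R N (fst p) (snd p)) \<in> borel_measurable W.Q" for N
    proof (rule W.process_meas[where g="\<lambda>s \<omega>. W.\<theta> s \<omega> * R N s \<omega>"])
      fix s assume s: "s \<in> {0..t}"
      note [measurable] = am[OF s]
      show "(\<lambda>\<omega>. W.\<theta> s \<omega> * R N s \<omega>) \<in> borel_measurable M" unfolding R_def by measurable
    qed (unfold R_def, intro continuous_intros W.\<theta>_cont a_cont b_cont)
    show "AE p in W.Q. (\<lambda>N. W.\<theta> (fst p) (snd p) * R N (fst p) (snd p)) \<longlonglongrightarrow> 0"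
    proof (rule AE_I2)
      fix p assume "p \<in> space W.Q"
      then have p: "fst p \<in> {0..t}" "snd p \<in> space M" by (auto simp only: W.space_Q)
      show "(\<lambda>N. W.\<theta> (fst p) (snd p) * R N (fst p) (snd p)) \<longlonglongrightarrow> 0"
        unfolding R_def a_def b_def by (rule tendsto_mult_right_zero[OF nonlin_cancel(1)[OF uH[OF p] vH[OF p]]])
    qed
    show "AE p in W.Q. norm (W.\<theta> (fst p) (snd p) * R N (fst p) (snd p)) \<le> ?C * (W.H (fst p) (snd p) * 1)" for N
    proof (rule AE_I2)
      fix p assume "p \<in> space W.Q"
      then have p: "fst p \<in> {0..t}" "snd p \<in> space M" by (auto simp only: W.space_Q)
      obtain s \<omega> where s\<omega>: "p = (s, \<omega>)" by (cases p)
      define r where "r = 1 + h1_norm L (u s \<omega>) + h1_norm L (v s \<omega>)"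
      have s: "s \<in> {0..t}" "\<omega> \<in> space M" using p s\<omega> by auto
      note n = nonlin_le_h[OF s, folded r_def]
      have "\<bar>R N s \<omega>\<bar> \<le> l2_norm L (u s \<omega>) * l2_norm L (nonlin \<gamma> \<beta> (u s \<omega>) (v s \<omega>))"
        unfolding R_def a_def b_def by (rule nonlin_cancel(2)[OF uH[OF s] vH[OF s]])
      also have "\<dots> \<le> r * (?C * r ^ 3)" using n C by (intro mult_mono) auto
      also have "\<dots> = ?C * h s \<omega>" unfolding h_def r_def[symmetric] by (simp add: power_numeral_reduce)
      finally have "W.\<theta> s \<omega> * \<bar>R N s \<omega>\<bar> \<le> W.\<theta> s \<omega> * (?C * h s \<omega>)"
        by (rule mult_left_mono[OF _ less_imp_le[OF W.\<theta>_pos]])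
      moreover have "W.\<theta> s \<omega> * (?C * h s \<omega>) = ?C * (W.H s \<omega> * 1)"
        unfolding W.H_def mult_1_right by (simp only: ac_simps)
      moreover have "norm (W.\<theta> s \<omega> * R N s \<omega>) = W.\<theta> s \<omega> * \<bar>R N s \<omega>\<bar>"
        unfolding real_norm_def abs_mult using W.\<theta>_pos[of s \<omega>] by simp
      ultimately show "norm (W.\<theta> (fst p) (snd p) * R N (fst p) (snd p)) \<le> ?C * (W.H (fst p) (snd p) * 1)"
        unfolding s\<omega> fst_conv snd_conv by linarith
    qed
  qed auto
  have "(\<lambda>N. \<bar>(\<integral>\<omega>. W.\<theta> t \<omega> * A N t \<omega> \<partial>M)
      - (\<Sum>k\<in>{-int N..int N}. (norm (fcoef L k u0))\<^sup>2) - t * (\<Sum>k\<in>{-int N..int N}. noise.\<sigma> (c k))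
      - 2 * W.integral_Q (\<lambda>s \<omega>. W.\<theta> s \<omega> * R N s \<omega>)\<bar>)
    \<longlonglongrightarrow> \<bar>(\<integral>\<omega>. W.\<theta> t \<omega> * (l2_norm L (u t \<omega>))\<^sup>2 \<partial>M) - (l2_norm L u0)\<^sup>2 - t * \<Sigma> - 2 * (\<integral>p. 0 \<partial>W.Q)\<bar>"
    by (intro tendsto_rabs tendsto_diff tendsto_mult_left lim1 lim2 \<Sigma> Parseval[OF L u0])
  from LIMSEQ_le_const2[OF this, of "\<integral>\<omega>. (1 - W.\<theta> t \<omega>) * (S \<omega> + t * \<Sigma>) \<partial>M"]
  show ?thesis using truncated_energy[OF \<epsilon>] by simp
qed

theorem mean_energy:
  "(\<integral>\<omega>. (l2_norm L (u t \<omega>))\<^sup>2 \<partial>M) = (l2_norm L u0)\<^sup>2 + \<Sigma> * t"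
proof -
  define e where "e n = 1 / real (Suc n)" for n
  have e: "0 < e n" for n by (simp add: e_def)
  have tt: "t \<in> {0..t}" using t by simp
  define A where "A \<omega> = integral {0..t} (\<lambda>r. h r \<omega>)" for \<omega>
  have \<theta>: "weight.\<theta> h (e n) t \<omega> = exp (- e n * A \<omega>)" for n \<omega>
    by (simp add: weight.\<theta>_def[OF weight[OF e]] A_def)
  have e0: "(\<lambda>n. e n) \<longlonglongrightarrow> 0" unfolding e_def by (rule LIMSEQ_Suc[OF lim_1_over_n])
  have lim: "(\<lambda>n. weight.\<theta> h (e n) t \<omega>) \<longlonglongrightarrow> 1" for \<omega>
  proof -
    have "(\<lambda>n. exp (- e n * A \<omega>)) \<longlonglongrightarrow> exp (- 0 * A \<omega>)" by (intro tendsto_intros e0)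
    then show ?thesis by (simp add: \<theta>)
  qed
  have \<theta>m: "weight.\<theta> h (e n) t \<in> borel_measurable M" for n
    by (rule weight.augment_meas[OF weight[OF e] weight.\<theta>_meas[OF weight[OF e] tt]])
  have \<theta>b: "0 \<le> weight.\<theta> h (e n) t \<omega>" "weight.\<theta> h (e n) t \<omega> \<le> 1" if "\<omega> \<in> space M" for n \<omega>
    using weight.\<theta>_pos[OF weight[OF e[of n]]] weight.\<theta>_le_1[OF weight[OF e] tt that] by (auto intro: less_imp_le)
  note [measurable] = \<theta>m l2_meas
  have Sm [measurable]: "S \<in> borel_measurable M" using S by simp
  have uS: "(l2_norm L (u t \<omega>))\<^sup>2 \<le> S \<omega>" if "\<omega> \<in> space M" for \<omega>
    by (rule order_trans[OF power_mono[OF l2_norm_le_h1_norm l2_norm_nonneg] u_le[OF tt that]])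
  have lim1: "(\<lambda>n. \<integral>\<omega>. weight.\<theta> h (e n) t \<omega> * (l2_norm L (u t \<omega>))\<^sup>2 \<partial>M) \<longlonglongrightarrow> (\<integral>\<omega>. 1 * (l2_norm L (u t \<omega>))\<^sup>2 \<partial>M)"
  proof (rule integral_dominated_convergence[OF _ _ S])
    show "AE \<omega> in M. (\<lambda>n. weight.\<theta> h (e n) t \<omega> * (l2_norm L (u t \<omega>))\<^sup>2) \<longlonglongrightarrow> 1 * (l2_norm L (u t \<omega>))\<^sup>2"
      by (intro AE_I2 tendsto_mult_right lim)
    show "AE \<omega> in M. norm (weight.\<theta> h (e n) t \<omega> * (l2_norm L (u t \<omega>))\<^sup>2) \<le> S \<omega>" for n
    proof (rule AE_I2)
      fix \<omega> assume w: "\<omega> \<in> space M"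
      have "weight.\<theta> h (e n) t \<omega> * (l2_norm L (u t \<omega>))\<^sup>2 \<le> 1 * S \<omega>"
        using \<theta>b[OF w, of n] by (intro mult_mono uS[OF w]) auto
      then show "norm (weight.\<theta> h (e n) t \<omega> * (l2_norm L (u t \<omega>))\<^sup>2) \<le> S \<omega>"
        using \<theta>b[OF w, of n] by (simp add: abs_mult)
    qed
  qed measurable
  have lim2: "(\<lambda>n. \<integral>\<omega>. (1 - weight.\<theta> h (e n) t \<omega>) * (S \<omega> + t * \<Sigma>) \<partial>M) \<longlonglongrightarrow> (\<integral>\<omega>. (1 - 1) * (S \<omega> + t * \<Sigma>) \<partial>M)"
  proof (rule integral_dominated_convergence[where w="\<lambda>\<omega>. S \<omega> + t * \<Sigma>"])
    show "integrable M (\<lambda>\<omega>. S \<omega> + t * \<Sigma>)" using S by simp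
    show "AE \<omega> in M. (\<lambda>n. (1 - weight.\<theta> h (e n) t \<omega>) * (S \<omega> + t * \<Sigma>)) \<longlonglongrightarrow> (1 - 1) * (S \<omega> + t * \<Sigma>)"
      by (intro AE_I2 tendsto_mult_right tendsto_diff tendsto_const lim)
    show "AE \<omega> in M. norm ((1 - weight.\<theta> h (e n) t \<omega>) * (S \<omega> + t * \<Sigma>)) \<le> S \<omega> + t * \<Sigma>" for n
    proof (rule AE_I2)
      fix \<omega> assume w: "\<omega> \<in> space M"
      have "0 \<le> S \<omega> + t * \<Sigma>" using S_nonneg[OF w] \<Sigma>_nonneg t by simp
      then show "norm ((1 - weight.\<theta> h (e n) t \<omega>) * (S \<omega> + t * \<Sigma>)) \<le> S \<omega> + t * \<Sigma>"
        using \<theta>b[OF w, of n] by (simp add: abs_mult mult_left_le_one_le)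
    qed
  qed measurable
  have "\<bar>(\<integral>\<omega>. 1 * (l2_norm L (u t \<omega>))\<^sup>2 \<partial>M) - (l2_norm L u0)\<^sup>2 - t * \<Sigma>\<bar> \<le> (\<integral>\<omega>. (1 - 1) * (S \<omega> + t * \<Sigma>) \<partial>M)"
    by (rule LIMSEQ_le[OF tendsto_rabs[OF tendsto_diff[OF tendsto_diff[OF lim1 tendsto_const] tendsto_const]] lim2])
      (use weighted_energy[OF e] in blast)
  then show ?thesis by (simp add: mult.commute)
qed

end

section \<open>Solutions of the equation\<close>

lemma pairing_ftest:
  assumes "0 < L" "f \<in> L2_space L"
  shows "pairing L (ftest_cos L k) f = of_real (sqrt L) * (fcoef L k f + fcoef L (- k) f) / 2"
    and "pairing L (ftest_sin L k) f = of_real (sqrt L) * \<i> * (fcoef L k f - fcoef L (- k) f) / 2"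
proof -
  let ?c = "pairing L (ftest_cos L k) f" and ?s = "pairing L (ftest_sin L k) f" and ?r = "complex_of_real (sqrt L)"
  have neg: "ftest_cos L (- k) = ftest_cos L k" "ftest_sin L (- k) = (\<lambda>x. - 1 * ftest_sin L k x)"
    by (auto simp: ftest_cos_def ftest_sin_def freq_def)
  have r: "?r \<noteq> 0" using assms(1) by simp
  have p: "fcoef L k f = (?c - \<i> * ?s) / ?r" by (rule fcoef_eq_pairing[OF assms])
  have m: "fcoef L (- k) f = (?c + \<i> * ?s) / ?r"
    unfolding fcoef_eq_pairing[OF assms, of "- k"] neg pairing_scale by simp
  show "?c = ?r * (fcoef L k f + fcoef L (- k) f) / 2"
    unfolding p m using r by (simp add: add_divide_distrib[symmetric])
  have "\<i> * ((?c - \<i> * ?s) - (?c + \<i> * ?s)) = 2 * ?s" by (simp add: complex_eq_iff)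
  then have "\<i> * (fcoef L k f - fcoef L (- k) f) = 2 * ?s / ?r"
    unfolding p m diff_divide_distrib[symmetric] times_divide_eq_right by (simp only:)
  then show "?s = ?r * \<i> * (fcoef L k f - fcoef L (- k) f) / 2"
    using r by (simp add: mult.assoc)
qed

text \<open>The weak equation is tested with the cosine and the sine of the mode.\<close>

lemma weak_solution_mode:
  fixes U NL :: "real \<Rightarrow> real \<Rightarrow> complex"
  assumes L: "0 < L" and f: "f \<in> L2_space L" "f0 \<in> L2_space L" "z \<in> L2_space L"
    and U: "\<And>r. r \<in> {0..s} \<Longrightarrow> U r \<in> L2_space L" "\<And>k. continuous_on {0..s} (\<lambda>r. fcoef L k (U r))"
    and NL: "\<And>r. r \<in> {0..s} \<Longrightarrow> NL r \<in> L2_space L" "\<And>k. continuous_on {0..s} (\<lambda>r. fcoef L k (NL r))"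
    and eq: "\<And>\<phi>. test_function L \<phi> \<Longrightarrow> pairing L \<phi> f = pairing L \<phi> f0
      + (LINT r|lebesgue_on {0..s}. \<i> * pairing L ((deriv ^^ 2) \<phi>) (U r) - \<i> * pairing L \<phi> (NL r)) + pairing L \<phi> z"
  shows "fcoef L k f = fcoef L k f0
      + integral {0..s} (\<lambda>r. - \<i> * (freq L k)\<^sup>2 * fcoef L k (U r) - \<i> * fcoef L k (NL r)) + fcoef L k z"
proof -
  let ?r = "complex_of_real (sqrt L)"
  define gc where "gc r = \<i> * (- (freq L k)\<^sup>2 *\<^sub>R pairing L (ftest_cos L k) (U r)) - \<i> * pairing L (ftest_cos L k) (NL r)" for r
  define gs where "gs r = \<i> * (- (freq L k)\<^sup>2 *\<^sub>R pairing L (ftest_sin L k) (U r)) - \<i> * pairing L (ftest_sin L k) (NL r)" for r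
  have cont: "continuous_on {0..s} (\<lambda>r. pairing L (ftest_cos L k) (W r))" "continuous_on {0..s} (\<lambda>r. pairing L (ftest_sin L k) (W r))"
    if W: "\<And>r. r \<in> {0..s} \<Longrightarrow> W r \<in> L2_space L" and c: "\<And>k. continuous_on {0..s} (\<lambda>r. fcoef L k (W r))" for W :: "real \<Rightarrow> real \<Rightarrow> complex"
  proof -
    have "continuous_on {0..s} (\<lambda>r. ?r * (fcoef L k (W r) + fcoef L (- k) (W r)) / 2)"
      by (intro continuous_intros c) simp
    then show "continuous_on {0..s} (\<lambda>r. pairing L (ftest_cos L k) (W r))"
      by (rule continuous_on_eq) (simp add: pairing_ftest(1)[OF L W])
    have "continuous_on {0..s} (\<lambda>r. ?r * \<i> * (fcoef L k (W r) - fcoef L (- k) (W r)) / 2)"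
      by (intro continuous_intros c) simp
    then show "continuous_on {0..s} (\<lambda>r. pairing L (ftest_sin L k) (W r))"
      by (rule continuous_on_eq) (simp add: pairing_ftest(2)[OF L W])
  qed
  have gcc: "continuous_on {0..s} gc"
    unfolding gc_def[abs_def] by (intro continuous_intros cont(1)[OF U] cont(1)[OF NL])
  have gsc: "continuous_on {0..s} gs"
    unfolding gs_def[abs_def] by (intro continuous_intros cont(2)[OF U] cont(2)[OF NL])
  have ec: "pairing L (ftest_cos L k) f = pairing L (ftest_cos L k) f0 + (LINT r|lebesgue_on {0..s}. gc r) + pairing L (ftest_cos L k) z"
    using eq[OF test_function_ftest(1)[OF L, of k]] unfolding deriv2_ftest pairing_scale gc_def .
  have es: "pairing L (ftest_sin L k) f = pairing L (ftest_sin L k) f0 + (LINT r|lebesgue_on {0..s}. gs r) + pairing L (ftest_sin L k) z"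
    using eq[OF test_function_ftest(2)[OF L, of k]] unfolding deriv2_ftest pairing_scale gs_def .
  define bb where "bb r = - \<i> * (freq L k)\<^sup>2 * fcoef L k (U r) - \<i> * fcoef L k (NL r)" for r
  have bc: "continuous_on {0..s} bb" unfolding bb_def[abs_def] by (intro continuous_intros U NL)
  have bb: "bb r = (gc r - \<i> * gs r) / ?r" if "r \<in> {0..s}" for r
    unfolding bb_def gc_def gs_def fcoef_eq_pairing[OF L U(1)[OF that]] fcoef_eq_pairing[OF L NL(1)[OF that]]
    by (simp add: scaleR_conv_of_real algebra_simps diff_divide_distrib add_divide_distrib)
  have "integral {0..s} bb = (LINT r|lebesgue_on {0..s}. bb r)" by (rule integrable_lebesgue_on_Icc(2)[OF bc, symmetric])
  also have "\<dots> = (LINT r|lebesgue_on {0..s}. (gc r - \<i> * gs r) / ?r)"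
    by (rule Bochner_Integration.integral_cong[OF refl]) (simp add: bb)
  also have "\<dots> = ((LINT r|lebesgue_on {0..s}. gc r) - \<i> * (LINT r|lebesgue_on {0..s}. gs r)) / ?r"
    using integrable_lebesgue_on_Icc(1)[OF gcc] integrable_lebesgue_on_Icc(1)[OF gsc] by simp
  finally have I: "integral {0..s} bb = ((LINT r|lebesgue_on {0..s}. gc r) - \<i> * (LINT r|lebesgue_on {0..s}. gs r)) / ?r" .
  have "fcoef L k f = fcoef L k f0 + integral {0..s} bb + fcoef L k z"
    unfolding I fcoef_eq_pairing[OF L f(1)] fcoef_eq_pairing[OF L f(2)] fcoef_eq_pairing[OF L f(3)] ec es
    by (simp add: algebra_simps diff_divide_distrib add_divide_distrib)
  then show ?thesis unfolding bb_def .
qed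

lemma closure_Icc_Rats:
  assumes "(0::real) < T" shows "closure ({0..T} \<inter> \<rat>) = {0..T}"
proof -
  have "closure ({0..T} \<inter> \<rat>) = closure {0..T}"
    by (intro closure_convex_Int_superset) (use assms in \<open>auto simp: Rats_closure_real\<close>)
  then show ?thesis by simp
qed

lemma mode_noise:
  assumes "prob_space M" "\<And>t. subalgebra M (F t)" and L: "0 < L"
    and e: "L2_orthonormal_basis L e\<^sub>1" and bf: "brownian_family M F (case_sum B\<^sub>1 B\<^sub>2)"
    and hs: "hilbert_schmidt L \<Phi>" and Z: "wiener_integral M L e\<^sub>1 B\<^sub>1 \<Phi> Z"
  shows "noise M F (case_sum B\<^sub>1 B\<^sub>2) Inl (\<lambda>i. fcoef L k (\<Phi> (e\<^sub>1 i))) (\<lambda>s \<omega>. fcoef L k (Z s \<omega>))"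
proof -
  have \<Phi>H: "\<Phi> (e\<^sub>1 i) \<in> H1_space L" for i
    using hs e unfolding hilbert_schmidt_def L2_orthonormal_basis_def by blast
  have sm: "summable (\<lambda>i. (h1_norm L (\<Phi> (e\<^sub>1 i)))\<^sup>2)" using hs e unfolding hilbert_schmidt_def by blast
  have Zm: "Z s \<in> M \<rightarrow>\<^sub>M H1_borel L"
    and Zl: "(\<lambda>n. \<integral>\<^sup>+\<omega>. ennreal ((h1_norm L (\<lambda>x. Z s \<omega> x - (\<Sum>i<n. B\<^sub>1 i s \<omega> *\<^sub>R \<Phi> (e\<^sub>1 i) x)))\<^sup>2) \<partial>M) \<longlonglongrightarrow> 0"
    if "0 \<le> s" for s
    using Z that unfolding wiener_integral_def by auto
  have ZH: "Z s \<omega> \<in> H1_space L" if "0 \<le> s" "\<omega> \<in> space M" for s \<omega>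
    using measurable_space[OF Zm[OF that(1)] that(2)] by (simp add: space_H1_borel)
  show ?thesis
  proof (intro noise.intro noise_axioms.intro assms(1,2) bf)
    show "inj Inl" by simp
    have "norm (fcoef L k (\<Phi> (e\<^sub>1 i))) \<le> h1_norm L (\<Phi> (e\<^sub>1 i))" for i
      by (rule order_trans[OF norm_fcoef_le[OF L H1_L2[OF \<Phi>H]] l2_norm_le_h1_norm])
    then show "summable (\<lambda>i. (norm (fcoef L k (\<Phi> (e\<^sub>1 i))))\<^sup>2)"
      by (intro summable_comparison_test'[OF sm]) (simp add: power_mono)
    fix s :: real assume s: "0 \<le> s"
    show "(\<lambda>\<omega>. fcoef L k (Z s \<omega>)) \<in> borel_measurable M"
      by (rule measurable_compose[OF Zm[OF s] fcoef_H1_measurable[OF L]])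
    show "(\<lambda>n. \<integral>\<^sup>+\<omega>. ennreal ((norm (fcoef L k (Z s \<omega>) - (\<Sum>i<n. of_real (case_sum B\<^sub>1 B\<^sub>2 (Inl i) s \<omega>) * fcoef L k (\<Phi> (e\<^sub>1 i)))))\<^sup>2) \<partial>M) \<longlonglongrightarrow> 0"
    proof (rule tendsto_sandwich[OF always_eventually[OF allI] always_eventually[OF allI] tendsto_const Zl[OF s]])
      fix n
      show "(\<integral>\<^sup>+\<omega>. ennreal ((norm (fcoef L k (Z s \<omega>) - (\<Sum>i<n. of_real (case_sum B\<^sub>1 B\<^sub>2 (Inl i) s \<omega>) * fcoef L k (\<Phi> (e\<^sub>1 i)))))\<^sup>2) \<partial>M)
        \<le> (\<integral>\<^sup>+\<omega>. ennreal ((h1_norm L (\<lambda>x. Z s \<omega> x - (\<Sum>i<n. B\<^sub>1 i s \<omega> *\<^sub>R \<Phi> (e\<^sub>1 i) x)))\<^sup>2) \<partial>M)"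
      proof (rule nn_integral_mono, rule ennreal_leI, rule power_mono)
        fix \<omega> assume w: "\<omega> \<in> space M"
        let ?p = "\<lambda>x. \<Sum>i<n. B\<^sub>1 i s \<omega> *\<^sub>R \<Phi> (e\<^sub>1 i) x"
        have p: "?p \<in> L2_space L" by (intro L2_sum L2_scaleR H1_L2 \<Phi>H)
        have "fcoef L k ?p = (\<Sum>i<n. of_real (B\<^sub>1 i s \<omega>) * fcoef L k (\<Phi> (e\<^sub>1 i)))"
        proof (subst fcoef_sum[OF L])
          show "(\<lambda>x. B\<^sub>1 i s \<omega> *\<^sub>R \<Phi> (e\<^sub>1 i) x) \<in> L2_space L" for i by (intro L2_scaleR H1_L2 \<Phi>H)
        qed (simp add: scaleR_conv_of_real fcoef_mult)
        then have "fcoef L k (Z s \<omega>) - (\<Sum>i<n. of_real (case_sum B\<^sub>1 B\<^sub>2 (Inl i) s \<omega>) * fcoef L k (\<Phi> (e\<^sub>1 i))) = fcoef L k (\<lambda>x. Z s \<omega> x - ?p x)"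
          using fcoef_diff[OF L H1_L2[OF ZH[OF s w]] p] by simp
        also have "norm \<dots> \<le> h1_norm L (\<lambda>x. Z s \<omega> x - ?p x)"
          by (rule order_trans[OF norm_fcoef_le[OF L L2_diff[OF H1_L2[OF ZH[OF s w]] p]] l2_norm_le_h1_norm])
        finally show "norm (fcoef L k (Z s \<omega>) - (\<Sum>i<n. of_real (case_sum B\<^sub>1 B\<^sub>2 (Inl i) s \<omega>) * fcoef L k (\<Phi> (e\<^sub>1 i)))) \<le> h1_norm L (\<lambda>x. Z s \<omega> x - ?p x)" .
      qed simp
    qed (rule zero_le)
  qed
qed

text \<open>The sums over the modes and over the basis are exchanged by dominated convergence; for each
  basis element the sum over the modes is Parseval's identity.\<close>

lemma L20_norm_modes:
  assumes L: "0 < L" and e: "L2_orthonormal_basis L e\<^sub>1" and hs: "hilbert_schmidt L \<Phi>"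
  shows "(\<lambda>N. \<Sum>k\<in>{-int N..int N}. \<Sum>i. (norm (fcoef L k (\<Phi> (e\<^sub>1 i))))\<^sup>2) \<longlonglongrightarrow> (L20_norm L e\<^sub>1 \<Phi>)\<^sup>2"
proof -
  have \<Phi>H: "\<Phi> (e\<^sub>1 i) \<in> H1_space L" for i
    using hs e unfolding hilbert_schmidt_def L2_orthonormal_basis_def by blast
  have sm: "summable (\<lambda>i. (h1_norm L (\<Phi> (e\<^sub>1 i)))\<^sup>2)" using hs e unfolding hilbert_schmidt_def by blast
  have lh: "(l2_norm L (\<Phi> (e\<^sub>1 i)))\<^sup>2 \<le> (h1_norm L (\<Phi> (e\<^sub>1 i)))\<^sup>2" for i
    by (intro power_mono l2_norm_le_h1_norm) simp
  have sl: "summable (\<lambda>i. (l2_norm L (\<Phi> (e\<^sub>1 i)))\<^sup>2)"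
    by (rule summable_comparison_test'[OF sm, of 0]) (simp add: lh)
  have le: "norm (fcoef L k (\<Phi> (e\<^sub>1 i))) \<le> h1_norm L (\<Phi> (e\<^sub>1 i))" for i k
    by (rule order_trans[OF norm_fcoef_le[OF L H1_L2[OF \<Phi>H]] l2_norm_le_h1_norm])
  have sk: "summable (\<lambda>i. (norm (fcoef L k (\<Phi> (e\<^sub>1 i))))\<^sup>2)" for k
    by (rule summable_comparison_test'[OF sm, of 0]) (simp add: power_mono le)
  let ?a = "\<lambda>i N. \<Sum>k\<in>{-int N..int N}. (norm (fcoef L k (\<Phi> (e\<^sub>1 i))))\<^sup>2"
  have "(\<lambda>N. \<Sum>i. ?a i N) \<longlonglongrightarrow> (\<Sum>i. (l2_norm L (\<Phi> (e\<^sub>1 i)))\<^sup>2)"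
  proof (rule conjunct2[OF conjunct2[OF tannerys_theorem[where M="\<lambda>i. (h1_norm L (\<Phi> (e\<^sub>1 i)))\<^sup>2"]]])
    show "(\<lambda>N. ?a i N) \<longlonglongrightarrow> (l2_norm L (\<Phi> (e\<^sub>1 i)))\<^sup>2" for i by (rule Parseval[OF L H1_L2[OF \<Phi>H]])
    have "norm (?a i N) \<le> (h1_norm L (\<Phi> (e\<^sub>1 i)))\<^sup>2" for i N
      using order_trans[OF Bessel[OF L H1_L2[OF \<Phi>H]] lh] by (simp add: sum_nonneg)
    then show "\<forall>\<^sub>F (i, N) in at_top \<times>\<^sub>F sequentially. norm (?a i N) \<le> (h1_norm L (\<Phi> (e\<^sub>1 i)))\<^sup>2"
      by (intro always_eventually) (auto simp del: real_norm_def)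
  qed (use sm in auto)
  moreover have "(\<Sum>i. ?a i N) = (\<Sum>k\<in>{-int N..int N}. \<Sum>i. (norm (fcoef L k (\<Phi> (e\<^sub>1 i))))\<^sup>2)" for N
    by (rule suminf_sum[OF sk])
  moreover have "(L20_norm L e\<^sub>1 \<Phi>)\<^sup>2 = (\<Sum>i. (l2_norm L (\<Phi> (e\<^sub>1 i)))\<^sup>2)"
    unfolding L20_norm_def by (rule real_sqrt_pow2[OF suminf_nonneg[OF sl]]) simp
  ultimately show ?thesis by simp
qed

theorem mainTheorem2:
  fixes M :: "'w measure" and F :: "real \<Rightarrow> 'w measure"
    and L T \<gamma>\<^sub>1 \<gamma>\<^sub>2 \<beta> :: real
    and e\<^sub>1 e\<^sub>2 :: "nat \<Rightarrow> real \<Rightarrow> real"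
    and B\<^sub>1 B\<^sub>2 :: "nat \<Rightarrow> real \<Rightarrow> 'w \<Rightarrow> real"
    and \<Phi>\<^sub>1 :: "(real \<Rightarrow> real) \<Rightarrow> real \<Rightarrow> complex"
    and \<Phi>\<^sub>2 :: "(real \<Rightarrow> real) \<Rightarrow> real \<Rightarrow> real"
    and u\<^sub>0 :: "real \<Rightarrow> complex" and v\<^sub>0 :: "real \<Rightarrow> real"
    and u :: "real \<Rightarrow> 'w \<Rightarrow> real \<Rightarrow> complex"
    and v :: "real \<Rightarrow> 'w \<Rightarrow> real \<Rightarrow> real"
  assumes "prob_space M"
    and "filtration (space M) F" and "\<And>t. subalgebra M (F t)"
    and "0 < L" and "0 < T" and "0 < \<gamma>\<^sub>1 * \<gamma>\<^sub>2"
    and "L2_orthonormal_basis L e\<^sub>1" and "L2_orthonormal_basis L e\<^sub>2"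
    and "brownian_family M F (case_sum B\<^sub>1 B\<^sub>2)"
    and "u\<^sub>0 \<in> H1_space L" and "v\<^sub>0 \<in> H1_space L"
    and "hilbert_schmidt L \<Phi>\<^sub>1" and "hilbert_schmidt L \<Phi>\<^sub>2"
    and "SKdV_solution M F L T \<gamma>\<^sub>1 \<gamma>\<^sub>2 \<beta> e\<^sub>1 B\<^sub>1 e\<^sub>2 B\<^sub>2 \<Phi>\<^sub>1 \<Phi>\<^sub>2 u\<^sub>0 v\<^sub>0 u v"
  shows "\<forall>t\<in>{0..T}.
    prob_space.expectation M (\<lambda>\<omega>. LINT x|lebesgue_on {0<..<L}. (cmod (u t \<omega> x))\<^sup>2)
    = prob_space.expectation M (\<lambda>\<omega>. LINT x|lebesgue_on {0<..<L}. (cmod (u\<^sub>0 x))\<^sup>2)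
      + (L20_norm L e\<^sub>1 \<Phi>\<^sub>1)\<^sup>2 * t"
proof
  fix t assume t: "t \<in> {0..T}"
  note sub = assms(3) and L = assms(4) and T = assms(5)
  interpret prob_space M by fact
  have mono: "sets (F s) \<subseteq> sets (F r)" if "s \<le> r" for s r
    using assms(2) that unfolding filtration_def by auto
  note sol = assms(14)[unfolded SKdV_solution_def]
  have uC: "L2_C_H1 M F L T u" and vC: "L2_C_H1 M F L T v"
    and init: "AE \<omega> in M. AE x in interval_measure0 L. u 0 \<omega> x = u\<^sub>0 x \<and> v 0 \<omega> x = v\<^sub>0 x"
    using sol by auto
  obtain Z where Z: "wiener_integral M L e\<^sub>1 B\<^sub>1 \<Phi>\<^sub>1 Z"
    and weak: "\<And>s. s \<in> {0..T} \<Longrightarrow> AE \<omega> in M. \<forall>\<phi>. test_function L \<phi> \<longrightarrow>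
          pairing L \<phi> (u s \<omega>) = pairing L \<phi> u\<^sub>0
            + (LINT r|lebesgue_on {0..s}.
                 \<i> * pairing L ((deriv ^^ 2) \<phi>) (u r \<omega>)
                 - \<i> * pairing L \<phi> (nonlin \<gamma>\<^sub>1 \<beta> (u r \<omega>) (v r \<omega>)))
            + pairing L \<phi> (Z s \<omega>)"
  proof -
    obtain Z\<^sub>1 Z\<^sub>2 where "wiener_integral M L e\<^sub>1 B\<^sub>1 \<Phi>\<^sub>1 Z\<^sub>1"
      and w: "\<forall>t\<in>{0..T}. AE \<omega> in M. \<forall>\<phi>. test_function L \<phi> \<longrightarrow>
          pairing L \<phi> (u t \<omega>) = pairing L \<phi> u\<^sub>0
            + (LINT s|lebesgue_on {0..t}.
                 \<i> * pairing L ((deriv ^^ 2) \<phi>) (u s \<omega>)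
                 - \<i> * pairing L \<phi>
                     (\<lambda>x. of_real (\<gamma>\<^sub>1 * v s \<omega> x + \<beta> * (cmod (u s \<omega> x))\<^sup>2) * u s \<omega> x))
            + pairing L \<phi> (Z\<^sub>1 t \<omega>) \<and>
          pairing L \<phi> (v t \<omega>) = pairing L \<phi> v\<^sub>0
            + (LINT s|lebesgue_on {0..t}.
                 pairing L ((deriv ^^ 3) \<phi>) (v s \<omega>)
                 + \<gamma>\<^sub>2 * pairing L \<phi> (weak_deriv L (\<lambda>x. (cmod (u s \<omega> x))\<^sup>2))
                 - pairing L \<phi> (\<lambda>x. v s \<omega> x * weak_deriv L (v s \<omega>) x))
            + pairing L \<phi> (Z\<^sub>2 t \<omega>)"
      using sol by (elim conjE exE)
    moreover have "AE \<omega> in M. \<forall>\<phi>. test_function L \<phi> \<longrightarrow>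
          pairing L \<phi> (u s \<omega>) = pairing L \<phi> u\<^sub>0
            + (LINT r|lebesgue_on {0..s}.
                 \<i> * pairing L ((deriv ^^ 2) \<phi>) (u r \<omega>)
                 - \<i> * pairing L \<phi> (nonlin \<gamma>\<^sub>1 \<beta> (u r \<omega>) (v r \<omega>)))
            + pairing L \<phi> (Z\<^sub>1 s \<omega>)" if "s \<in> {0..T}" for s
      using bspec[OF w that] unfolding nonlin_def[abs_def] by (rule eventually_mono) blast
    ultimately show ?thesis using that by blast
  qed
  have um: "u s \<in> F s \<rightarrow>\<^sub>M H1_borel L" and vm: "v s \<in> F s \<rightarrow>\<^sub>M H1_borel L" if "s \<in> {0..T}" for s
    using uC vC that unfolding L2_C_H1_def by auto
  have spF: "space (F s) = space M" for s using sub[of s] by (simp add: subalgebra_def)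
  have uH: "u s \<omega> \<in> H1_space L" and vH: "v s \<omega> \<in> H1_space L" if "s \<in> {0..T}" "\<omega> \<in> space M" for s \<omega>
    using measurable_space[OF um[OF that(1)], of \<omega>] measurable_space[OF vm[OF that(1)], of \<omega>] that(2) by (auto simp: spF space_H1_borel)
  have l2m: "(\<lambda>\<omega>. (l2_norm L (u s \<omega>))\<^sup>2) \<in> borel_measurable M" if "s \<in> {0..T}" for s
    using measurable_compose[OF measurable_from_subalg[OF sub um[OF that]] l2_norm_measurable] by measurable
  have "expectation (\<lambda>\<omega>. (l2_norm L (u t \<omega>))\<^sup>2) = (l2_norm L u\<^sub>0)\<^sup>2 + (L20_norm L e\<^sub>1 \<Phi>\<^sub>1)\<^sup>2 * t"
  proof (cases "t = 0")
    case True
    have "AE \<omega> in M. (l2_norm L (u 0 \<omega>))\<^sup>2 = (l2_norm L u\<^sub>0)\<^sup>2"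
      using init AE_space
    proof eventually_elim
      case (elim \<omega>)
      have "u 0 \<omega> \<in> H1_space L" using uH[of 0 \<omega>] elim(2) T by simp
      then have "l2_norm L (u 0 \<omega>) = l2_norm L u\<^sub>0"
        using elim(1) assms(10) by (intro l2_norm_cong_AE) (auto intro: L2_measurable H1_L2)
      then show ?case by simp
    qed
    then have "expectation (\<lambda>\<omega>. (l2_norm L (u 0 \<omega>))\<^sup>2) = expectation (\<lambda>\<omega>. (l2_norm L u\<^sub>0)\<^sup>2)"
      using l2m[of 0] T by (intro integral_cong_AE) auto
    then show ?thesis using True by (simp add: prob_space)
  next
    case False
    with t have t0: "0 < t" "t \<le> T" by auto
    have good: "AE \<omega> in M. (\<forall>s\<in>{0..T}. ((\<lambda>r. h1_norm L (\<lambda>x. u r \<omega> x - u s \<omega> x)) \<longlongrightarrow> 0) (at s within {0..T}))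
        \<and> (\<forall>s\<in>{0..T}. ((\<lambda>r. h1_norm L (\<lambda>x. v r \<omega> x - v s \<omega> x)) \<longlongrightarrow> 0) (at s within {0..T}))"
      using uC vC unfolding L2_C_H1_def by (intro AE_conjI) auto
    obtain N where N: "{\<omega> \<in> space M. \<not> ((\<forall>s\<in>{0..T}. ((\<lambda>r. h1_norm L (\<lambda>x. u r \<omega> x - u s \<omega> x)) \<longlongrightarrow> 0) (at s within {0..T}))
        \<and> (\<forall>s\<in>{0..T}. ((\<lambda>r. h1_norm L (\<lambda>x. v r \<omega> x - v s \<omega> x)) \<longlongrightarrow> 0) (at s within {0..T})))} \<subseteq> N"
      "emeasure M N = 0" "N \<in> sets M"
      using AE_E[OF good] by blast
    define G where "G = space M - N"
    have G: "G \<in> sets M" unfolding G_def using N(3) by auto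
    have aeG: "AE \<omega> in M. \<omega> \<in> G"
      using AE_not_in[of N M] N(2,3) AE_space unfolding G_def by (auto simp: null_sets_def elim: eventually_elim2)
    have Gu: "((\<lambda>r. h1_norm L (\<lambda>x. u r \<omega> x - u s \<omega> x)) \<longlongrightarrow> 0) (at s within {0..T})"
      and Gv: "((\<lambda>r. h1_norm L (\<lambda>x. v r \<omega> x - v s \<omega> x)) \<longlongrightarrow> 0) (at s within {0..T})"
      if "\<omega> \<in> G" "s \<in> {0..T}" for \<omega> s
      using that N(1) unfolding G_def by blast+
    \<comment> \<open>On the exceptional null set the solution is replaced by zero, so that all paths are continuous.\<close>
    define U where "U s \<omega> = (if \<omega> \<in> G then u s \<omega> else (\<lambda>x. 0))" for s \<omega>
    define V where "V s \<omega> = (if \<omega> \<in> G then v s \<omega> else (\<lambda>x. 0))" for s \<omega>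
    have Gaug: "G \<inter> space (augment M (F s)) \<in> sets (augment M (F s))" for s
      using full_set_augment[OF sub G aeG] by auto
    have Um: "U s \<in> augment M (F s) \<rightarrow>\<^sub>M H1_borel L" and Vm: "V s \<in> augment M (F s) \<rightarrow>\<^sub>M H1_borel L" if "s \<in> {0..T}" for s
      unfolding U_def[abs_def] V_def[abs_def]
      by (intro measurable_If_set measurable_augment[OF sub] um vm that Gaug measurable_const; simp add: space_H1_borel H1_zero)+
    have Uc: "((\<lambda>r. h1_norm L (\<lambda>x. U r \<omega> x - U s \<omega> x)) \<longlongrightarrow> 0) (at s within {0..T})"
      and Vc: "((\<lambda>r. h1_norm L (\<lambda>x. V r \<omega> x - V s \<omega> x)) \<longlongrightarrow> 0) (at s within {0..T})" if "s \<in> {0..T}" for \<omega> s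
      using Gu[OF _ that, of \<omega>] Gv[OF _ that, of \<omega>]
      by (cases "\<omega> \<in> G"; simp add: U_def V_def h1_norm_zero[OF L] h1_norm_zero_real[OF L])+
    have UH: "U s \<omega> \<in> H1_space L" if "s \<in> {0..T}" "\<omega> \<in> space M" for s \<omega>
      using uH[OF that] by (simp add: U_def H1_zero)
    obtain C where C: "0 \<le> C" "\<And>f :: real \<Rightarrow> complex. f \<in> H1_space L \<Longrightarrow> AE x in interval_measure0 L. norm (f x) \<le> C * h1_norm L f"
      using Sobolev_embedding[OF L] by blast
    interpret sobolev_constant L C by unfold_locales (use L C in auto)
    \<comment> \<open>A countable dense set of times gives a measurable supremum, by continuity the full one.\<close>
    let ?D = "{0..T} \<inter> \<rat>"
    define S' where "S' \<omega> = (SUP r\<in>?D. ennreal ((h1_norm L (U r \<omega>))\<^sup>2))" for \<omega>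
    define S where "S \<omega> = enn2real (S' \<omega>)" for \<omega>
    have hm: "(\<lambda>\<omega>. h1_norm L (U r \<omega>)) \<in> borel_measurable M" if "r \<in> {0..T}" for r
      by (rule measurable_compose[OF measurable_from_subalg[OF subalgebra_augment[OF sub] Um[OF that]] h1_norm_measurable[OF L]])
    have S'm: "S' \<in> borel_measurable M"
      unfolding S'_def[abs_def]
    proof (rule borel_measurable_SUP)
      show "countable ?D" using countable_rat by (rule countable_subset[rotated]) blast
      fix r assume "r \<in> ?D"
      then have [measurable]: "(\<lambda>\<omega>. h1_norm L (U r \<omega>)) \<in> borel_measurable M" by (intro hm) simp
      show "(\<lambda>\<omega>. ennreal ((h1_norm L (U r \<omega>))\<^sup>2)) \<in> borel_measurable M" by measurable
    qed
    have hc: "continuous_on {0..T} (\<lambda>r. (h1_norm L (U r \<omega>))\<^sup>2)" if "\<omega> \<in> space M" for \<omega>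
      by (intro continuous_intros continuous_on_h1_norm UH that Uc)
    have S'fin: "S' \<omega> < \<top>" if w: "\<omega> \<in> space M" for \<omega>
    proof -
      have "bounded ((\<lambda>r. (h1_norm L (U r \<omega>))\<^sup>2) ` {0..T})"
        by (intro compact_imp_bounded compact_continuous_image hc w) simp
      then obtain b where "\<forall>x\<in>(\<lambda>r. (h1_norm L (U r \<omega>))\<^sup>2) ` {0..T}. norm x \<le> b"
        unfolding bounded_iff by blast
      then have b: "(h1_norm L (U r \<omega>))\<^sup>2 \<le> b" if "r \<in> {0..T}" for r using that by simp
      have "S' \<omega> \<le> ennreal b"
        unfolding S'_def by (intro SUP_least ennreal_leI b) simp
      then show ?thesis by (rule le_less_trans) simp
    qed
    have Sle: "(h1_norm L (U s \<omega>))\<^sup>2 \<le> S \<omega>" if w: "\<omega> \<in> space M" and s: "s \<in> {0..T}" for s \<omega>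
    proof (rule continuous_le_on_closure[of ?D "\<lambda>r. (h1_norm L (U r \<omega>))\<^sup>2"])
      show "continuous_on (closure ?D) (\<lambda>r. (h1_norm L (U r \<omega>))\<^sup>2)" using hc[OF w] closure_Icc_Rats[OF T] by simp
      show "s \<in> closure ?D" using s closure_Icc_Rats[OF T] by simp
      fix r assume r: "r \<in> ?D"
      then have "ennreal ((h1_norm L (U r \<omega>))\<^sup>2) \<le> S' \<omega>" unfolding S'_def by (rule SUP_upper)
      also have "S' \<omega> = ennreal (S \<omega>)" unfolding S_def using S'fin[OF w] by (simp add: ennreal_enn2real)
      finally show "(h1_norm L (U r \<omega>))\<^sup>2 \<le> S \<omega>" by (subst (asm) ennreal_le_iff) (auto simp: S_def)
    qed
    have Sint: "integrable M S"
    proof (rule integrableI_bounded)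
      show "S \<in> borel_measurable M" unfolding S_def[abs_def] using S'm by measurable
      have "(\<integral>\<^sup>+\<omega>. ennreal (norm (S \<omega>)) \<partial>M) \<le> (\<integral>\<^sup>+\<omega>. (SUP r\<in>{0..T}. ennreal ((h1_norm L (u r \<omega>))\<^sup>2)) \<partial>M)"
      proof (rule nn_integral_mono)
        fix \<omega> assume w: "\<omega> \<in> space M"
        have "ennreal (norm (S \<omega>)) = S' \<omega>" unfolding S_def using S'fin[OF w] by (simp add: ennreal_enn2real)
        also have "\<dots> \<le> (SUP r\<in>{0..T}. ennreal ((h1_norm L (u r \<omega>))\<^sup>2))"
        proof (cases "\<omega> \<in> G")
          case True
          then show ?thesis unfolding S'_def U_def by (auto intro: SUP_subset_mono)
        next
          case False
          then show ?thesis unfolding S'_def U_def by (auto simp: h1_norm_zero[OF L] intro!: SUP_least)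
        qed
        finally show "ennreal (norm (S \<omega>)) \<le> (SUP r\<in>{0..T}. ennreal ((h1_norm L (u r \<omega>))\<^sup>2))" .
      qed
      also have "\<dots> < \<infinity>" using uC unfolding L2_C_H1_def by blast
      finally show "(\<integral>\<^sup>+\<omega>. ennreal (norm (S \<omega>)) \<partial>M) < \<infinity>" .
    qed
    have noise: "noise M F (case_sum B\<^sub>1 B\<^sub>2) Inl (\<lambda>i. fcoef L k (\<Phi>\<^sub>1 (e\<^sub>1 i))) (\<lambda>s \<omega>. fcoef L k (Z s \<omega>))" for k
      by (rule mode_noise[OF prob_space_axioms sub L assms(7,9,12) Z])
    have ZH: "Z s \<omega> \<in> H1_space L" if "0 \<le> s" "\<omega> \<in> space M" for s \<omega>
      using Z that measurable_space[of "Z s" M "H1_borel L" \<omega>] unfolding wiener_integral_def by (auto simp: space_H1_borel)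
    have eq: "AE \<omega> in M. fcoef L k (U s \<omega>) = fcoef L k u\<^sub>0
      + integral {0..s} (\<lambda>r. - \<i> * (freq L k)\<^sup>2 * fcoef L k (U r \<omega>) - \<i> * fcoef L k (nonlin \<gamma>\<^sub>1 \<beta> (U r \<omega>) (V r \<omega>)))
      + fcoef L k (Z s \<omega>)" if s: "s \<in> {0..t}" for k s
    proof -
      have sT: "s \<in> {0..T}" and s0: "0 \<le> s" and ss: "{0..s} \<subseteq> {0..T}" using s t0 by auto
      show ?thesis
        using weak[OF sT] aeG AE_space
      proof eventually_elim
        case (elim \<omega>)
        have UV: "U r \<omega> = u r \<omega>" "V r \<omega> = v r \<omega>" for r using elim(2) by (auto simp: U_def V_def)
        have H: "u r \<omega> \<in> H1_space L" "v r \<omega> \<in> H1_space L" if "r \<in> {0..s}" for r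
          using uH vH elim(3) that ss by auto
        have c: "((\<lambda>q. h1_norm L (\<lambda>x. u q \<omega> x - u r \<omega> x)) \<longlongrightarrow> 0) (at r within {0..s})"
          "((\<lambda>q. h1_norm L (\<lambda>x. v q \<omega> x - v r \<omega> x)) \<longlongrightarrow> 0) (at r within {0..s})" if "r \<in> {0..s}" for r
          using tendsto_within_subset[OF Gu[OF elim(2)] ss] tendsto_within_subset[OF Gv[OF elim(2)] ss] that ss by auto
        show ?case unfolding UV
          by (rule weak_solution_mode[OF L H1_L2[OF uH[OF sT elim(3)]] H1_L2[OF assms(10)] H1_L2[OF ZH[OF s0 elim(3)]]
                H1_L2[OF H(1)] continuous_on_fcoef[OF H(1) c(1)] L2_nonlin[OF H] continuous_on_fcoef_nonlin[OF H c]])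
            (assumption | rule elim(1)[rule_format])+
      qed
    qed
    have sum: "(\<lambda>N. \<Sum>k\<in>{-int N..int N}. noise.\<sigma> (\<lambda>i. fcoef L k (\<Phi>\<^sub>1 (e\<^sub>1 i)))) \<longlonglongrightarrow> (L20_norm L e\<^sub>1 \<Phi>\<^sub>1)\<^sup>2"
      unfolding noise.\<sigma>_def[OF noise] by (rule L20_norm_modes[OF L assms(7,12)])
    have tT: "{0..t} \<subseteq> {0..T}" using t0 by auto
    have "energy_system L C M F (case_sum B\<^sub>1 B\<^sub>2) Inl (\<lambda>k i. fcoef L k (\<Phi>\<^sub>1 (e\<^sub>1 i))) (\<lambda>k s \<omega>. fcoef L k (Z s \<omega>))
        U V u\<^sub>0 S \<gamma>\<^sub>1 \<beta> t ((L20_norm L e\<^sub>1 \<Phi>\<^sub>1)\<^sup>2)"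
      using tT by (intro energy_system.intro energy_system_axioms.intro sobolev_constant_axioms prob_space_axioms sub mono t0 noise
        Um Vm tendsto_within_subset[OF Uc tT] tendsto_within_subset[OF Vc tT] Sint Sle H1_L2[OF assms(10)] eq sum) (auto dest: subsetD)
    from energy_system.mean_energy[OF this]
    have "expectation (\<lambda>\<omega>. (l2_norm L (U t \<omega>))\<^sup>2) = (l2_norm L u\<^sub>0)\<^sup>2 + (L20_norm L e\<^sub>1 \<Phi>\<^sub>1)\<^sup>2 * t" .
    moreover have "expectation (\<lambda>\<omega>. (l2_norm L (U t \<omega>))\<^sup>2) = expectation (\<lambda>\<omega>. (l2_norm L (u t \<omega>))\<^sup>2)"
    proof (rule integral_cong_AE)
      show "(\<lambda>\<omega>. (l2_norm L (U t \<omega>))\<^sup>2) \<in> borel_measurable M"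
        using measurable_compose[OF measurable_from_subalg[OF subalgebra_augment[OF sub] Um[OF t]] l2_norm_measurable] by measurable
      show "AE \<omega> in M. (l2_norm L (U t \<omega>))\<^sup>2 = (l2_norm L (u t \<omega>))\<^sup>2" using aeG by eventually_elim (simp add: U_def)
    qed (rule l2m[OF t])
    ultimately show ?thesis by simp
  qed
  then show "expectation (\<lambda>\<omega>. LINT x|lebesgue_on {0<..<L}. (cmod (u t \<omega> x))\<^sup>2)
    = expectation (\<lambda>\<omega>. LINT x|lebesgue_on {0<..<L}. (cmod (u\<^sub>0 x))\<^sup>2) + (L20_norm L e\<^sub>1 \<Phi>\<^sub>1)\<^sup>2 * t"
    unfolding l2_norm_sq by (simp add: prob_space)
qed

end
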